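(* The Conjunctive Query Finite Determinacy Problem is undecidable. That is, there is no algorithm which, given a relational signature $\Sigma$, a finite set $\mathcal Q=\{Q_1,\dots,Q_k\}$ of conjunctive queries over $\Sigma$ and a conjunctive query $Q_0$ over $\Sigma$, decides whether $\mathcal Q$ finitely determines $Q_0$.
   Context: A relational signature $\Sigma$ consists of relation symbols (with arities) and possibly constants; a structure over $\Sigma$ (database instance) interprets every constant as an element of the domain. A conjunctive query (CQ) $Q(\bar x)=\exists\bar y\,\Psi(\bar x,\bar y)$ is a conjunction $\Psi$ of atoms whose arguments are variables or constants of $\Sigma$, with some variables existentially quantified; $\bar x$ are its free variables. For a structure $\mathbb D$, ${\mathbb D}\models Q(\bar a)$ means there is a homomorphism from the canonical structure of $\Psi$ into $\mathbb D$ mapping $\bar x$ to $\bar a$ (and constants to themselves), and the view $Q(\mathbb D)$ is the relation $\{\bar a:\mathbb D\models Q(\bar a)\}$. A set $\mathcal Q$ of CQs finitely determines $Q_0$ if for every two finite structures $\mathbb D_1,\mathbb D_2$ over $\Sigma$ such that $Q(\mathbb D_1)=Q(\mathbb D_2)$ for every $Q\in\mathcal Q$, also $Q_0(\mathbb D_1)=Q_0(\mathbb D_2)$. *)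

theory Defs
  imports Main "HOL-Library.Nat_Bijection"
begin

datatype recf =
    Zero
  | Succ
  | Proj nat
  | Comp recf "recf list"
  | Prim recf recf
  | Mn recf

inductive eval :: "recf \<Rightarrow> nat list \<Rightarrow> nat \<Rightarrow> bool" where
  eval_Zero: "eval Zero xs 0"
| eval_Succ: "eval Succ (x # xs) (Suc x)"
| eval_Proj: "i < length xs \<Longrightarrow> eval (Proj i) xs (xs ! i)"
| eval_Comp: "list_all2 (\<lambda>g y. eval g xs y) gs ys \<Longrightarrow> eval f ys z
              \<Longrightarrow> eval (Comp f gs) xs z"
| eval_Prim0: "eval f xs y \<Longrightarrow> eval (Prim f g) (0 # xs) y"
| eval_PrimS: "eval (Prim f g) (n # xs) r \<Longrightarrow> eval g (n # r # xs) y
              \<Longrightarrow> eval (Prim f g) (Suc n # xs) y"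
| eval_Mn: "eval f (n # xs) 0 \<Longrightarrow> (\<forall>m<n. \<exists>y. eval f (m # xs) y \<and> 0 < y)
              \<Longrightarrow> eval (Mn f) xs n"

datatype qterm = Var nat | Cst nat

type_synonym atom = "nat \<times> qterm list"   \<comment> \<open>relation symbol, arguments\<close>

text \<open>A signature: list of (relation symbol, arity) pairs and a list of constants.\<close>
type_synonym signature = "(nat \<times> nat) list \<times> nat list"

text \<open>A CQ: the tuple of free variables and the list of atoms of its body;
  all other variables occurring in the body are existentially quantified.\<close>
type_synonym cq = "nat list \<times> atom list"

fun term_vars :: "qterm \<Rightarrow> nat set" where
  "term_vars (Var v) = {v}"
| "term_vars (Cst c) = {}"

definition body_vars :: "atom list \<Rightarrow> nat set" where
  "body_vars as = (\<Union>(r, ts) \<in> set as. \<Union>t \<in> set ts. term_vars t)"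

definition wf_signature :: "signature \<Rightarrow> bool" where
  "wf_signature \<Sigma> = distinct (map fst (fst \<Sigma>))"

definition atom_over :: "signature \<Rightarrow> atom \<Rightarrow> bool" where
  "atom_over \<Sigma> a = ((fst a, length (snd a)) \<in> set (fst \<Sigma>) \<and>
                      (\<forall>c. Cst c \<in> set (snd a) \<longrightarrow> c \<in> set (snd \<Sigma>)))"

definition cq_over :: "signature \<Rightarrow> cq \<Rightarrow> bool" where
  "cq_over \<Sigma> Q = ((\<forall>a \<in> set (snd Q). atom_over \<Sigma> a) \<and>
                   distinct (fst Q) \<and> set (fst Q) \<subseteq> body_vars (snd Q))"

definition is_structure :: "signature \<Rightarrow> nat set \<Rightarrow> (nat \<Rightarrow> nat list set) \<Rightarrow> (nat \<Rightarrow> nat) \<Rightarrow> bool" where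
  "is_structure \<Sigma> D R c =
     (finite D \<and>
      (\<forall>r. r \<notin> fst ` set (fst \<Sigma>) \<longrightarrow> R r = {}) \<and>
      (\<forall>(r, k) \<in> set (fst \<Sigma>). \<forall>t \<in> R r. length t = k \<and> set t \<subseteq> D) \<and>
      (\<forall>k \<in> set (snd \<Sigma>). c k \<in> D))"

fun term_val :: "(nat \<Rightarrow> nat) \<Rightarrow> (nat \<Rightarrow> nat) \<Rightarrow> qterm \<Rightarrow> nat" where
  "term_val h c (Var v) = h v"
| "term_val h c (Cst k) = c k"

text \<open>The view Q(D): tuples a such that a homomorphism from the canonical structure of
  the body into D maps the free variables to a (constants to themselves).\<close>
definition view :: "cq \<Rightarrow> nat set \<Rightarrow> (nat \<Rightarrow> nat list set) \<Rightarrow> (nat \<Rightarrow> nat) \<Rightarrow> nat list set" where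
  "view Q D R c = {map h (fst Q) | h.
      (\<forall>v \<in> body_vars (snd Q). h v \<in> D) \<and>
      (\<forall>(r, ts) \<in> set (snd Q). map (term_val h c) ts \<in> R r)}"

definition fin_determines :: "signature \<Rightarrow> cq list \<Rightarrow> cq \<Rightarrow> bool" where
  "fin_determines \<Sigma> Qs Q0 =
     (\<forall>D1 R1 c1 D2 R2 c2.
        is_structure \<Sigma> D1 R1 c1 \<longrightarrow> is_structure \<Sigma> D2 R2 c2 \<longrightarrow>
        (\<forall>Q \<in> set Qs. view Q D1 R1 c1 = view Q D2 R2 c2) \<longrightarrow>
        view Q0 D1 R1 c1 = view Q0 D2 R2 c2)"

definition wf_instance :: "signature \<Rightarrow> cq list \<Rightarrow> cq \<Rightarrow> bool" where
  "wf_instance \<Sigma> Qs Q0 = (wf_signature \<Sigma> \<and> (\<forall>Q \<in> set Qs. cq_over \<Sigma> Q) \<and> cq_over \<Sigma> Q0)"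

fun enc_term :: "qterm \<Rightarrow> nat" where
  "enc_term (Var v) = sum_encode (Inl v)"
| "enc_term (Cst k) = sum_encode (Inr k)"

definition enc_atom :: "atom \<Rightarrow> nat" where
  "enc_atom a = prod_encode (fst a, list_encode (map enc_term (snd a)))"

definition enc_cq :: "cq \<Rightarrow> nat" where
  "enc_cq Q = prod_encode (list_encode (fst Q), list_encode (map enc_atom (snd Q)))"

definition enc_signature :: "signature \<Rightarrow> nat" where
  "enc_signature \<Sigma> = prod_encode (list_encode (map prod_encode (fst \<Sigma>)), list_encode (snd \<Sigma>))"

definition enc_instance :: "signature \<Rightarrow> cq list \<Rightarrow> cq \<Rightarrow> nat" where
  "enc_instance \<Sigma> Qs Q0 =
     prod_encode (enc_signature \<Sigma>, prod_encode (list_encode (map enc_cq Qs), enc_cq Q0))"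

end

theory Submission
  imports Defs
begin

text \<open>
  Suppose that a recursive function decides determinacy. We construct, uniformly in a number e,
  an instance I(e) that describes a finite set of rewriting rules coded by e and a start word of
  length proportional to e. The function that sends e to the decision on I(e) is recursive, hence
  performed by a register machine, hence by a rewriting system on words; let e be its code. If the
  decision is "not determined", the rewriting reaches an alarm, and the alarm forces determinacy.
  If the decision is "determined", the rewriting stops without an alarm, and the finite set of words
  that lead to the final word yields a finite counterexample. Since both outcomes are halting runs,
  nothing has to be said about infinite chases.

  The instances rest on the spiders of Gogacz and Marcinkowski. Relation 0 holds tuples
  (x, y, k_0, ..., k_(N-1)), edges from x to y with N knees, and relation 1 is a set of knees. Call the
  two structures green and red. The label of a green edge is the set of its legs j whose knee k_j is
  in the red relation 1 while all other knees are in the green one, and conversely for red edges. A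
  view that asks for an edge, leaves the knees of a set I of legs free and requires relation 1 for the
  others, turns a green edge with label T (a subset of I) into a red edge with label I - T and vice
  versa. A letter is a one-element label: main letters live on red edges, intermediate letters on
  green ones. A word is a zigzag path x0 -> x1 <- x2 -> ..., and the view of two consecutive edges with
  I = {a, n} and I = {b, m} and existential middle vertex exchanges the factors ab and nm. As a zigzag
  path folds onto one edge, a single green edge with empty label matches the view that produces the
  start word, and a letter at the end of the word can be expanded into two letters.
\<close>

text \<open>Every view matches the green edge with empty label, so the obstacle to a counterexample
  is to answer all these matches in red without creating a red edge with empty label. Each kind of
  view gets its own answer: rule views free two legs per edge and are answered by red edges with
  two-element labels; the start view by a path that spells the start word through the left quotients
  of a finite language; the alarm view by a separate edge with exchanged colours. That separate edge
  must not match the start view in turn, so letters that can end a word are kept off it. The views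
  are symmetric, so the finite language must be closed under the rules in both directions.
  Determinism of the oriented rewriting provides this: the ancestors of a halting word are closed
  under successors as well as predecessors, and they are finitely many because no step shortens a
  word. The number e is both the code of the rules and the input written in unary on the tape. The
  program is fixed before e is chosen, so the self-reference needs no fixed-point theorem.\<close>

section \<open>Recursive functions on argument lists\<close>

text \<open>Keeping all arguments in one list allows bound variables to be handled in de Bruijn
  style: \<open>hd xs\<close> is the most recently bound variable and \<open>tl xs\<close> the
  environment around it.\<close>

definition is_rec :: "nat \<Rightarrow> (nat list \<Rightarrow> nat) \<Rightarrow> bool" where
  "is_rec n F = (\<exists>r. \<forall>xs. length xs = n \<longrightarrow> eval r xs (F xs))"

lemma is_rec_cong: "is_rec n F \<Longrightarrow> (\<And>xs. length xs = n \<Longrightarrow> F xs = G xs) \<Longrightarrow> is_rec n G"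
  unfolding is_rec_def by (elim exE, rule_tac x = r in exI) auto

lemma is_rec_comp:
  assumes "is_rec (length Gs) F" "\<And>G. G \<in> set Gs \<Longrightarrow> is_rec n G"
  shows "is_rec n (\<lambda>xs. F (map (\<lambda>G. G xs) Gs))"
proof -
  obtain f where f: "\<And>xs. length xs = length Gs \<Longrightarrow> eval f xs (F xs)"
    using assms(1) unfolding is_rec_def by blast
  have "\<exists>gs. \<forall>xs. length xs = n \<longrightarrow> list_all2 (\<lambda>g y. eval g xs y) gs (map (\<lambda>G. G xs) Gs)"
    using assms(2)
  proof (induction Gs)
    case Nil
    show ?case by (rule exI[of _ "[]"]) simp
  next
    case (Cons G Gs)
    then obtain gs where gs: "\<forall>xs. length xs = n \<longrightarrow> list_all2 (\<lambda>g y. eval g xs y) gs (map (\<lambda>G. G xs) Gs)"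
      by auto
    obtain g where "\<forall>xs. length xs = n \<longrightarrow> eval g xs (G xs)"
      using Cons.prems[of G] unfolding is_rec_def by auto
    with gs show ?case by (intro exI[of _ "g # gs"]) simp
  qed
  then obtain gs where gs: "\<And>xs. length xs = n \<Longrightarrow> list_all2 (\<lambda>g y. eval g xs y) gs (map (\<lambda>G. G xs) Gs)"
    by blast
  show ?thesis unfolding is_rec_def
    by (rule exI[of _ "Comp f gs"]) (use eval_Comp[OF gs f] in auto)
qed

lemma is_rec_nth: "i < n \<Longrightarrow> is_rec n (\<lambda>xs. xs ! i)"
  unfolding is_rec_def by (auto intro: eval_Proj)

lemma is_rec_hd: "is_rec (Suc n) hd"
  by (rule is_rec_cong[OF is_rec_nth[of 0]]) (auto simp: length_Suc_conv)

lemma is_rec_weaken: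
  assumes "is_rec n F" shows "is_rec (Suc n) (\<lambda>xs. F (tl xs))"
proof (rule is_rec_cong)
  show "is_rec (Suc n) (\<lambda>xs. F (map (\<lambda>G. G xs) (map (\<lambda>i xs. xs ! Suc i) [0..<n])))"
    using assms by (intro is_rec_comp) (auto intro: is_rec_nth)
  fix xs :: "nat list" assume "length xs = Suc n"
  then have "map (\<lambda>G. G xs) (map (\<lambda>i xs. xs ! Suc i) [0..<n]) = tl xs"
    by (intro nth_equalityI) (auto simp: nth_tl)
  then show "F (map (\<lambda>G. G xs) (map (\<lambda>i xs. xs ! Suc i) [0..<n])) = F (tl xs)" by simp
qed

lemma is_rec_comp1:
  assumes "is_rec 1 (\<lambda>xs. F (hd xs))" "is_rec n A" shows "is_rec n (\<lambda>xs. F (A xs))"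
  using is_rec_comp[of "[A]" "\<lambda>xs. F (hd xs)" n] assms by simp

lemma is_rec_Suc: "is_rec n A \<Longrightarrow> is_rec n (\<lambda>xs. Suc (A xs))"
proof (rule is_rec_comp1[of Suc])
  show "is_rec 1 (\<lambda>xs. Suc (hd xs))"
    unfolding is_rec_def by (rule exI[of _ Succ]) (auto simp: length_Suc_conv intro: eval_Succ)
qed

lemma is_rec_const: "is_rec n (\<lambda>xs. k)"
proof (induction k)
  case 0
  show ?case unfolding is_rec_def by (rule exI[of _ Zero]) (auto intro: eval_Zero)
next
  case (Suc k)
  then show ?case by (rule is_rec_Suc)
qed

text \<open>Counter and accumulator come in front of the environment, the order in which
  \<open>Prim\<close> hands them to its step function; the whole environment serves as parameter
  list.\<close>

lemma is_rec_rec: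
  assumes A: "is_rec n A" and B: "is_rec n B"
    and C: "is_rec (Suc (Suc n)) (\<lambda>xs. C (hd xs) (hd (tl xs)) (tl (tl xs)))"
  shows "is_rec n (\<lambda>xs. rec_nat (B xs) (\<lambda>k r. C k r xs) (A xs))"
proof -
  obtain b where b: "\<And>xs. length xs = n \<Longrightarrow> eval b xs (B xs)"
    using B unfolding is_rec_def by blast
  obtain c where c: "\<And>xs. length xs = Suc (Suc n) \<Longrightarrow> eval c xs (C (hd xs) (hd (tl xs)) (tl (tl xs)))"
    using C unfolding is_rec_def by blast
  have ev: "eval (Prim b c) (k # xs) (rec_nat (B xs) (\<lambda>k r. C k r xs) k)" if "length xs = n" for k xs
  proof (induction k)
    case 0
    show ?case using b[OF that] by (simp add: eval_Prim0)
  next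
    case (Suc k)
    show ?case by (rule eval_PrimS[OF Suc.IH]) (use c[of "k # _ # xs"] that in simp)
  qed
  have P: "is_rec (Suc n) (\<lambda>xs. rec_nat (B (tl xs)) (\<lambda>k r. C k r (tl xs)) (hd xs))"
    unfolding is_rec_def
  proof (intro exI[of _ "Prim b c"] allI impI)
    fix xs :: "nat list" assume "length xs = Suc n"
    then show "eval (Prim b c) xs (rec_nat (B (tl xs)) (\<lambda>k r. C k r (tl xs)) (hd xs))"
      using ev[of "tl xs" "hd xs"] by (cases xs) auto
  qed
  show ?thesis
  proof (rule is_rec_cong)
    show "is_rec n (\<lambda>xs. (\<lambda>xs. rec_nat (B (tl xs)) (\<lambda>k r. C k r (tl xs)) (hd xs))
                       (map (\<lambda>G. G xs) (A # map (\<lambda>i xs. xs ! i) [0..<n])))"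
      by (rule is_rec_comp) (use P A in \<open>auto intro: is_rec_nth\<close>)
    fix xs :: "nat list" assume l: "length xs = n"
    have "map (\<lambda>i. xs ! i) [0..<n] = xs" using l by (simp add: map_nth flip: l)
    then show "rec_nat (B (tl (map (\<lambda>G. G xs) (A # map (\<lambda>i xs. xs ! i) [0..<n]))))
       (\<lambda>k r. C k r (tl (map (\<lambda>G. G xs) (A # map (\<lambda>i xs. xs ! i) [0..<n]))))
       (hd (map (\<lambda>G. G xs) (A # map (\<lambda>i xs. xs ! i) [0..<n]))) =
      rec_nat (B xs) (\<lambda>k r. C k r xs) (A xs)" by (simp add: comp_def)
  qed
qed

lemma is_rec_hd_tl: "is_rec (Suc (Suc n)) (\<lambda>xs. hd (tl xs))"
  by (rule is_rec_weaken[OF is_rec_hd])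

lemma is_rec_hd_tl_tl: "is_rec (Suc (Suc (Suc n))) (\<lambda>xs. hd (tl (tl xs)))"
  by (rule is_rec_weaken[OF is_rec_hd_tl])

lemma is_rec_hd_tl_tl_tl: "is_rec (Suc (Suc (Suc (Suc n)))) (\<lambda>xs. hd (tl (tl (tl xs))))"
  by (rule is_rec_weaken[OF is_rec_hd_tl_tl])

lemma is_rec_weaken2: "is_rec n F \<Longrightarrow> is_rec (Suc (Suc n)) (\<lambda>xs. F (tl (tl xs)))"
  by (rule is_rec_weaken[OF is_rec_weaken])

lemmas is_rec_vars = is_rec_hd is_rec_hd_tl is_rec_hd_tl_tl is_rec_hd_tl_tl_tl

lemma is_rec_add: "is_rec n A \<Longrightarrow> is_rec n B \<Longrightarrow> is_rec n (\<lambda>xs. A xs + B xs)"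
proof -
  assume AB: "is_rec n A" "is_rec n B"
  have "rec_nat b (\<lambda>k. Suc) a = a + b" for a b :: nat by (induction a) auto
  then show ?thesis
    using is_rec_rec[OF AB, where C = "\<lambda>k r xs. Suc r"] by (simp add: is_rec_Suc is_rec_vars)
qed


lemma is_rec_mult: 
  assumes AB: "is_rec n A" "is_rec n B" shows "is_rec n (\<lambda>xs. A xs * B xs)"
proof -
  have "rec_nat 0 (\<lambda>k r. r + b) a = a * b" for a b :: nat by (induction a) auto
  then show ?thesis
    using is_rec_rec[OF AB(1) is_rec_const[of n 0], where C = "\<lambda>k r xs. r + B xs"]
    by (simp add: is_rec_add is_rec_vars is_rec_weaken2[OF AB(2)])
qed

lemma is_rec_power:
  assumes AB: "is_rec n A" "is_rec n B" shows "is_rec n (\<lambda>xs. A xs ^ B xs)"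
proof -
  have "rec_nat 1 (\<lambda>k r. r * b) a = b ^ a" for a b :: nat by (induction a) auto
  then show ?thesis
    using is_rec_rec[OF AB(2) is_rec_const[of n 1], where C = "\<lambda>k r xs. r * A xs"]
    by (simp add: is_rec_mult is_rec_vars is_rec_weaken2[OF AB(1)])
qed

lemma is_rec_pred: assumes "is_rec n A" shows "is_rec n (\<lambda>xs. A xs - Suc 0)"
proof -
  have "rec_nat 0 (\<lambda>k r. k) a = a - Suc 0" for a :: nat by (cases a) auto
  then show ?thesis
    using is_rec_rec[OF assms is_rec_const[of n 0], where C = "\<lambda>k r xs. k"]
    by (simp add: is_rec_vars)
qed

lemma is_rec_diff: 
  assumes AB: "is_rec n A" "is_rec n B" shows "is_rec n (\<lambda>xs. A xs - B xs)"
proof -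
  have "rec_nat a (\<lambda>k r. r - Suc 0) b = a - b" for a b :: nat by (induction b) auto
  then show ?thesis
    using is_rec_rec[OF AB(2,1), where C = "\<lambda>k r xs. r - Suc 0"]
    by (simp add: is_rec_pred is_rec_vars)
qed

lemma is_rec_if_zero:
  assumes "is_rec n A" "is_rec n B" "is_rec n C"
  shows "is_rec n (\<lambda>xs. if A xs = 0 then B xs else C xs)"
proof -
  have "rec_nat b (\<lambda>k r. c) a = (if a = 0 then b else c)" for a b c :: nat by (cases a) auto
  then show ?thesis
    using is_rec_rec[OF assms(1,2), where C = "\<lambda>k r xs. C xs"]
    by (simp add: is_rec_weaken2[OF assms(3)])
qed

lemma is_rec_if_le:
  assumes "is_rec n A" "is_rec n A'" "is_rec n B" "is_rec n C"
  shows "is_rec n (\<lambda>xs. if A xs \<le> A' xs then B xs else C xs)"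
  using is_rec_if_zero[OF is_rec_diff[OF assms(1,2)] assms(3,4)] by simp

lemma is_rec_if_eq:
  assumes "is_rec n A" "is_rec n A'" "is_rec n B" "is_rec n C"
  shows "is_rec n (\<lambda>xs. if A xs = A' xs then B xs else C xs)"
proof -
  have "((if (a::nat) \<le> a' then (if a' \<le> a then b else c) else c) :: nat) = (if a = a' then b else c)" for a a' b c
    by auto
  then show ?thesis
    using is_rec_if_le[OF assms(1,2) is_rec_if_le[OF assms(2,1,3,4)] assms(4)] by simp
qed

lemma is_rec_sum:
  assumes A: "is_rec n A" and F: "is_rec (Suc n) (\<lambda>xs. F (hd xs) (tl xs))"
  shows "is_rec n (\<lambda>xs. \<Sum>i<A xs. F i xs)"
proof -
  have eq: "rec_nat 0 (\<lambda>k r. r + f k) a = (\<Sum>i<a. f i)" for a and f :: "nat \<Rightarrow> nat" by (induction a) auto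
  have "is_rec (Suc (Suc n)) (\<lambda>xs. (\<lambda>ys. F (hd ys) (tl ys)) (map (\<lambda>G. G xs) (hd # map (\<lambda>i xs. xs ! (i + 2)) [0..<n])))"
    using F by (intro is_rec_comp) (auto intro: is_rec_nth is_rec_vars)
  then have "is_rec (Suc (Suc n)) (\<lambda>xs. F (hd xs) (tl (tl xs)))"
  proof (rule is_rec_cong)
    fix xs :: "nat list" assume l: "length xs = Suc (Suc n)"
    have "map (\<lambda>G. G xs) (map (\<lambda>i xs. xs ! (i + 2)) [0..<n]) = tl (tl xs)"
      using l by (intro nth_equalityI) (auto simp: nth_tl)
    then show "F (hd (map (\<lambda>G. G xs) (hd # map (\<lambda>i xs. xs ! (i + 2)) [0..<n])))
      (tl (map (\<lambda>G. G xs) (hd # map (\<lambda>i xs. xs ! (i + 2)) [0..<n]))) = F (hd xs) (tl (tl xs))" by simp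
  qed
  then have "is_rec n (\<lambda>xs. rec_nat 0 (\<lambda>k r. r + F k xs) (A xs))"
    by (intro is_rec_rec[OF A is_rec_const] is_rec_add is_rec_vars)
  then show ?thesis by (simp add: eq)
qed

text \<open>The quotient counts the positive multiples of the divisor that do not exceed the
  dividend, which makes it a bounded sum.\<close>

lemma is_rec_div:
  assumes A: "is_rec n A" and B: "is_rec n B" and pos: "\<And>xs. B xs > 0"
  shows "is_rec n (\<lambda>xs. A xs div B xs)"
proof -
  have "(\<Sum>i<a. if Suc i * b \<le> a then 1 else (0::nat)) = a div b" if "b > 0" for a b :: nat
  proof -
    have "Suc i * b \<le> a \<longleftrightarrow> i < a div b" for i
      using that less_eq_div_iff_mult_less_eq[of b "Suc i" a] by (simp add: Suc_le_eq)
    then have "{i \<in> {..<a}. Suc i * b \<le> a} = {..<a div b}"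
      using div_le_dividend[of a b] by (auto intro: less_le_trans simp del: mult_Suc)
    moreover have "(\<Sum>i<a. if Suc i * b \<le> a then 1 else (0::nat)) = card {i \<in> {..<a}. Suc i * b \<le> a}"
      by (subst sum.inter_filter[symmetric]) auto
    ultimately show ?thesis by simp
  qed
  then have eq: "(\<lambda>xs. A xs div B xs) = (\<lambda>xs. \<Sum>i<A xs. if Suc i * B xs \<le> A xs then 1 else 0)"
    using pos by auto
  show ?thesis unfolding eq
    by (intro is_rec_sum A is_rec_if_le is_rec_mult is_rec_Suc is_rec_vars is_rec_const
        is_rec_weaken[OF A] is_rec_weaken[OF B])
qed

lemma is_rec_mod:
  assumes A: "is_rec n A" and B: "is_rec n B" and pos: "\<And>xs. B xs > 0"
  shows "is_rec n (\<lambda>xs. A xs mod B xs)"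
proof -
  have "(\<lambda>xs. A xs mod B xs) = (\<lambda>xs. A xs - B xs * (A xs div B xs))"
    by (simp add: minus_mult_div_eq_mod)
  then show ?thesis
    by (simp only:) (intro is_rec_diff is_rec_mult is_rec_div A B pos)
qed

section \<open>Computing the pairing function, its inverse and list codes\<close>

lemma is_rec_triangle: "is_rec n A \<Longrightarrow> is_rec n (\<lambda>xs. triangle (A xs))"
  unfolding triangle_def by (intro is_rec_div is_rec_mult is_rec_Suc is_rec_const) auto

lemma is_rec_prod_encode:
  "is_rec n A \<Longrightarrow> is_rec n B \<Longrightarrow> is_rec n (\<lambda>xs. prod_encode (A xs, B xs))"
  unfolding prod_encode_def by (simp add: is_rec_add is_rec_triangle)

lemma triangle_mono: "m \<le> n \<Longrightarrow> triangle m \<le> triangle n"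
  by (rule lift_Suc_mono_le[of triangle]) auto

text \<open>The code of (a, b) is \<open>triangle (a + b) + a\<close>, which lies below the next
  triangular number. Counting the positive triangular numbers up to the code therefore recovers a +
  b, and this inverts the pairing function by a bounded sum.\<close>

lemma triangle_root:
  "(\<Sum>t < prod_encode (a, b). if triangle (Suc t) \<le> prod_encode (a, b) then 1 else 0) = a + b"
proof -
  let ?z = "prod_encode (a, b)"
  have z: "?z = triangle (a + b) + a" by (simp add: prod_encode_def)
  have ge: "triangle (Suc t) \<ge> Suc t" for t by simp
  have "triangle (Suc t) \<le> ?z \<longleftrightarrow> t < a + b" for t
  proof
    assume "triangle (Suc t) \<le> ?z"
    then show "t < a + b" using triangle_mono[of "Suc (a + b)" "Suc t"] by (auto simp: z not_less[symmetric] intro: ccontr)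
  next
    assume "t < a + b"
    then show "triangle (Suc t) \<le> ?z" using triangle_mono[of "Suc t" "a + b"] by (simp add: z)
  qed
  then have "{t \<in> {..<?z}. triangle (Suc t) \<le> ?z} = {..<a + b}"
    using ge by (auto simp del: triangle_Suc) (meson Suc_le_lessD le_trans)
  moreover have "(\<Sum>t < ?z. if triangle (Suc t) \<le> ?z then 1 else 0) = card {t \<in> {..<?z}. triangle (Suc t) \<le> ?z}"
    by (subst sum.inter_filter[symmetric]) auto
  ultimately show ?thesis by simp
qed

lemma prod_decode_eq:
  fixes z defines "s \<equiv> (\<Sum>t < z. if triangle (Suc t) \<le> z then 1 else 0)"
  shows "fst (prod_decode z) = z - triangle s" "snd (prod_decode z) = s - (z - triangle s)"
proof -
  obtain a b where ab: "z = prod_encode (a, b)" by (metis prod_decode_inverse surj_pair)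
  have s: "s = a + b" unfolding s_def ab by (rule triangle_root)
  have "z - triangle s = a" unfolding s by (simp add: ab prod_encode_def)
  with s show "fst (prod_decode z) = z - triangle s" "snd (prod_decode z) = s - (z - triangle s)"
    by (simp_all add: ab)
qed

lemma is_rec_prod_decode:
  assumes A: "is_rec n A"
  shows "is_rec n (\<lambda>xs. fst (prod_decode (A xs)))" "is_rec n (\<lambda>xs. snd (prod_decode (A xs)))"
  unfolding prod_decode_eq
  by (intro is_rec_diff is_rec_triangle is_rec_sum A is_rec_if_le is_rec_Suc is_rec_vars is_rec_const
      is_rec_weaken[OF A])+

text \<open>The code of a list nests the code of its tail, so the recursion works from the back:
  after k rounds the accumulator holds the code of the last k table entries followed by
  \<open>B xs\<close>.\<close>

lemma is_rec_tabulate: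
  assumes A: "is_rec n A" and B: "is_rec n (\<lambda>xs. list_encode (B xs))"
    and F: "is_rec (Suc n) (\<lambda>xs. F (hd xs) (tl xs))"
  shows "is_rec n (\<lambda>xs. list_encode (map (\<lambda>i. F i xs) [0..<A xs] @ B xs))"
proof -
  have eq: "rec_nat (list_encode ys) (\<lambda>k r. Suc (prod_encode (f (a - Suc k), r))) k
      = list_encode (map f [a - k..<a] @ ys)" if "k \<le> a" for f a k ys
    using that
  proof (induction k)
    case (Suc k)
    then have "[a - Suc k..<a] = (a - Suc k) # [a - k..<a]"
      by (simp add: upt_conv_Cons Suc_diff_Suc)
    with Suc show ?case by simp
  qed simp
  have "is_rec (Suc (Suc n)) (\<lambda>xs. (\<lambda>ys. F (hd ys) (tl ys)) (map (\<lambda>G. G xs) ((\<lambda>xs. A (tl (tl xs)) - Suc (hd xs)) # map (\<lambda>i xs. xs ! (i + 2)) [0..<n])))"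
    using F by (intro is_rec_comp) (auto intro!: is_rec_nth is_rec_vars is_rec_diff is_rec_weaken2[OF A] is_rec_Suc)
  then have "is_rec (Suc (Suc n)) (\<lambda>xs. F (A (tl (tl xs)) - Suc (hd xs)) (tl (tl xs)))"
  proof (rule is_rec_cong)
    fix xs :: "nat list" assume l: "length xs = Suc (Suc n)"
    have "map (\<lambda>G. G xs) (map (\<lambda>i xs. xs ! (i + 2)) [0..<n]) = tl (tl xs)"
      using l by (intro nth_equalityI) (auto simp: nth_tl)
    then show "F (hd (map (\<lambda>G. G xs) ((\<lambda>xs. A (tl (tl xs)) - Suc (hd xs)) # map (\<lambda>i xs. xs ! (i + 2)) [0..<n])))
      (tl (map (\<lambda>G. G xs) ((\<lambda>xs. A (tl (tl xs)) - Suc (hd xs)) # map (\<lambda>i xs. xs ! (i + 2)) [0..<n])))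
      = F (A (tl (tl xs)) - Suc (hd xs)) (tl (tl xs))" by simp
  qed
  then have "is_rec n (\<lambda>xs. rec_nat (list_encode (B xs))
      (\<lambda>k r. Suc (prod_encode (F (A xs - Suc k) xs, r))) (A xs))"
    by (intro is_rec_rec[OF A B] is_rec_Suc is_rec_prod_encode is_rec_vars)
  then show ?thesis using eq[OF order.refl, where f = "\<lambda>i. F i xs" for xs] by simp
qed

lemma is_rec_list_encode_Nil: "is_rec n (\<lambda>xs. list_encode [])"
  by (simp add: is_rec_const)

lemma is_rec_list_encode_Cons:
  "is_rec n A \<Longrightarrow> is_rec n (\<lambda>xs. list_encode (B xs)) \<Longrightarrow> is_rec n (\<lambda>xs. list_encode (A xs # B xs))"
  by (simp add: is_rec_Suc is_rec_prod_encode)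

lemmas is_rec_list = is_rec_tabulate is_rec_tabulate[OF _ is_rec_list_encode_Nil, simplified append_Nil2]
  is_rec_list_encode_Nil is_rec_list_encode_Cons

section \<open>Zigzag path queries\<close>

text \<open>Edge e joins the path vertices e and e + 1 in a direction that alternates with e; for z
  = 0 the first edge leaves vertex 0, for z = 1 it enters it.\<close>

definition esrc :: "nat \<Rightarrow> nat \<Rightarrow> nat" where
  "esrc z e = e + (e + z) mod 2"

definition etgt :: "nat \<Rightarrow> nat \<Rightarrow> nat" where
  "etgt z e = e + (e + z + 1) mod 2"

text \<open>Knees get odd variables, while vertex v is the variable 2 * v. The blocks have length N
  + 1, as the blocks of atoms in \<open>path_body\<close> do.\<close>

definition kvar :: "nat \<Rightarrow> nat \<Rightarrow> nat \<Rightarrow> nat" where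
  "kvar N e j = 2 * (e * Suc N + j) + 1"

definition H_atom :: "nat \<Rightarrow> nat \<Rightarrow> nat \<Rightarrow> atom" where
  "H_atom N z e = (0, Var (2 * esrc z e) # Var (2 * etgt z e) # map (\<lambda>j. Var (kvar N e j)) [0..<N])"

definition C_atom :: "nat \<Rightarrow> nat \<Rightarrow> nat \<Rightarrow> atom" where
  "C_atom N e j = (1, [Var (kvar N e j)])"

text \<open>In the block of an edge, position N holds the \<open>H_atom\<close> and position j < N
  the \<open>C_atom\<close> of knee j. At a freed leg the \<open>H_atom\<close> is repeated as
  padding: this does not change the query, and the body becomes a table of known length, computable
  without filtering.\<close>

definition path_body :: "nat \<Rightarrow> nat \<Rightarrow> nat \<Rightarrow> (nat \<Rightarrow> nat \<Rightarrow> bool) \<Rightarrow> atom list" where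
  "path_body N z p I = map (\<lambda>i. if i mod Suc N = N \<or> I (i div Suc N) (i mod Suc N)
      then H_atom N z (i div Suc N) else C_atom N (i div Suc N) (i mod Suc N)) [0..<p * Suc N]"

definition sig :: "nat \<Rightarrow> signature" where
  "sig N = ([(0, N + 2), (1, 1)], [])"

lemma index_div_mod: "j \<le> N \<Longrightarrow> (e * Suc N + j) div Suc N = e \<and> (e * Suc N + j) mod Suc N = j"
  by (simp add: less_Suc_eq_le del: mult_Suc_right)

lemma index_less: "e < p \<Longrightarrow> j \<le> N \<Longrightarrow> e * Suc N + j < p * Suc N"
proof -
  assume "e < p" "j \<le> N"
  then have "e * Suc N + j < Suc e * Suc N" by simp
  also have "\<dots> \<le> p * Suc N" using \<open>e < p\<close> by (intro mult_le_mono1) simp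
  finally show ?thesis .
qed

lemma kvar_inj: "j \<le> N \<Longrightarrow> j' \<le> N \<Longrightarrow> kvar N e j = kvar N e' j' \<longleftrightarrow> e = e' \<and> j = j'"
proof
  assume j: "j \<le> N" "j' \<le> N" and "kvar N e j = kvar N e' j'"
  then have eq: "e * Suc N + j = e' * Suc N + j'" by (simp add: kvar_def del: mult_Suc_right)
  show "e = e' \<and> j = j'"
    using index_div_mod[OF j(1), of e] index_div_mod[OF j(2), of e'] unfolding eq by simp
qed simp

lemma kvar_odd: "kvar N e j \<noteq> 2 * v"
  unfolding kvar_def by presburger

lemma set_path_body:
  "set (path_body N z p I) = {H_atom N z e | e. e < p} \<union> {C_atom N e j | e j. e < p \<and> j < N \<and> \<not> I e j}"
    (is "?l = ?r")
proof
  show "?l \<subseteq> ?r"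
  proof
    fix x assume "x \<in> ?l"
    then obtain i where i: "i < p * Suc N" "x = (if i mod Suc N = N \<or> I (i div Suc N) (i mod Suc N)
      then H_atom N z (i div Suc N) else C_atom N (i div Suc N) (i mod Suc N))"
      by (auto simp: path_body_def simp del: mult_Suc_right)
    have "i div Suc N < p" using i(1) by (simp add: div_less_iff_less_mult del: mult_Suc_right)
    moreover have "i mod Suc N \<noteq> N \<longrightarrow> i mod Suc N < N"
      using mod_less_divisor[of "Suc N" i] by linarith
    ultimately show "x \<in> ?r" using i(2) by (cases "i mod Suc N = N \<or> I (i div Suc N) (i mod Suc N)") auto
  qed
  have "H_atom N z e \<in> ?l" if "e < p" for e
    unfolding path_body_def set_map using index_div_mod[of N N e] index_less[OF that, of N N]
    by (intro image_eqI[of _ _ "e * Suc N + N"]) (auto simp del: mult_Suc_right)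
  moreover have "C_atom N e j \<in> ?l" if "e < p" "j < N" "\<not> I e j" for e j
    unfolding path_body_def set_map using index_div_mod[of j N e] index_less[OF that(1), of j N] that
    by (intro image_eqI[of _ _ "e * Suc N + j"]) (auto simp del: mult_Suc_right)
  ultimately show "?r \<subseteq> ?l" by auto
qed

text \<open>The content of a path body once the numbering of variables is stripped off:
  \<open>vs\<close> places the vertices, \<kappa> the knees of each edge.\<close>

definition path_sat :: "nat \<Rightarrow> nat \<Rightarrow> nat \<Rightarrow> (nat \<Rightarrow> nat \<Rightarrow> bool) \<Rightarrow> (nat \<Rightarrow> nat list set) \<Rightarrow>
    (nat \<Rightarrow> nat) \<Rightarrow> (nat \<Rightarrow> nat \<Rightarrow> nat) \<Rightarrow> bool" where
  "path_sat N z p I R vs \<kappa> = (\<forall>e<p. vs (esrc z e) # vs (etgt z e) # map (\<kappa> e) [0..<N] \<in> R 0 \<and>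
      (\<forall>j<N. \<not> I e j \<longrightarrow> [\<kappa> e j] \<in> R 1))"

definition assign :: "nat \<Rightarrow> (nat \<Rightarrow> nat) \<Rightarrow> (nat \<Rightarrow> nat \<Rightarrow> nat) \<Rightarrow> nat \<Rightarrow> nat" where
  "assign N vs \<kappa> v = (if even v then vs (v div 2) else \<kappa> (v div 2 div Suc N) (v div 2 mod Suc N))"

lemma assign_vertex: "assign N vs \<kappa> (2 * v) = vs v"
  by (simp add: assign_def)

lemma assign_knee: "j \<le> N \<Longrightarrow> assign N vs \<kappa> (kvar N e j) = \<kappa> e j"
  using index_div_mod[of j N e] by (simp add: assign_def kvar_def del: mult_Suc_right)

lemma assign_collect: "assign N (\<lambda>v. h (2 * v)) (\<lambda>e j. h (kvar N e j)) = h"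
proof
  fix v
  show "assign N (\<lambda>v. h (2 * v)) (\<lambda>e j. h (kvar N e j)) v = h v"
  proof (cases "even v")
    case False
    then have "kvar N (v div 2 div Suc N) (v div 2 mod Suc N) = v"
      by (simp add: kvar_def del: mult_Suc_right)
    then show ?thesis using False by (simp add: assign_def)
  qed (simp add: assign_def)
qed

lemma path_sat_body:
  "(\<forall>(r, ts) \<in> set (path_body N z p I). map (term_val (assign N vs \<kappa>) c) ts \<in> R r) \<longleftrightarrow> path_sat N z p I R vs \<kappa>"
proof -
  have H: "map (term_val (assign N vs \<kappa>) c) (snd (H_atom N z e)) = vs (esrc z e) # vs (etgt z e) # map (\<kappa> e) [0..<N]" for e
    by (simp add: H_atom_def assign_vertex assign_knee comp_def)
  have C: "j < N \<Longrightarrow> map (term_val (assign N vs \<kappa>) c) (snd (C_atom N e j)) = [\<kappa> e j]" for e j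
    by (simp add: C_atom_def assign_knee)
  have "(\<forall>(r, ts) \<in> set (path_body N z p I). map (term_val (assign N vs \<kappa>) c) ts \<in> R r)
    \<longleftrightarrow> (\<forall>x \<in> set (path_body N z p I). map (term_val (assign N vs \<kappa>) c) (snd x) \<in> R (fst x))"
    by (auto simp: case_prod_beta)
  also have "\<dots> \<longleftrightarrow> path_sat N z p I R vs \<kappa>"
  proof -
    have fst: "fst (H_atom N z e) = 0" "fst (C_atom N e j) = 1" for e j
      by (auto simp: H_atom_def C_atom_def)
    have "(\<forall>x \<in> set (path_body N z p I). map (term_val (assign N vs \<kappa>) c) (snd x) \<in> R (fst x)) \<longleftrightarrow>
        (\<forall>e<p. map (term_val (assign N vs \<kappa>) c) (snd (H_atom N z e)) \<in> R (fst (H_atom N z e))) \<and>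
        (\<forall>e j. e < p \<and> j < N \<and> \<not> I e j \<longrightarrow> map (term_val (assign N vs \<kappa>) c) (snd (C_atom N e j)) \<in> R (fst (C_atom N e j)))"
      unfolding set_path_body by blast
    then show ?thesis unfolding H fst path_sat_def by (simp add: C) blast
  qed
  finally show ?thesis .
qed

text \<open>The range condition of \<open>view\<close> is automatic: each variable of a body occurs
  in an atom, and the tuples of a structure stay inside its domain.\<close>

lemma path_view:
  assumes "is_structure (sig N) D R c"
  shows "view (fr, path_body N z p I) D R c = {map (assign N vs \<kappa>) fr | vs \<kappa>. path_sat N z p I R vs \<kappa>}"
proof -
  have D: "h v \<in> D" if "\<forall>(r, ts) \<in> set bd. map (term_val h c) ts \<in> R r" "v \<in> body_vars bd" for h v bd
  proof -
    from that(2) obtain r ts t where t: "(r, ts) \<in> set bd" "t \<in> set ts" "v \<in> term_vars t"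
      by (auto simp: body_vars_def)
    then have tv: "t = Var v" by (cases t) auto
    have m: "map (term_val h c) ts \<in> R r" using that(1) t(1) by auto
    then have "r \<in> fst ` set (fst (sig N))" using assms by (auto simp: is_structure_def)
    then have "set (map (term_val h c) ts) \<subseteq> D" using m assms by (fastforce simp: is_structure_def sig_def)
    moreover have "h v \<in> set (map (term_val h c) ts)" using t(2) tv by force
    ultimately show ?thesis by blast
  qed
  have "view (fr, path_body N z p I) D R c =
      {map h fr | h. \<forall>(r, ts) \<in> set (path_body N z p I). map (term_val h c) ts \<in> R r}"
    unfolding view_def fst_conv snd_conv using D by blast
  also have "\<dots> = {map (assign N vs \<kappa>) fr | vs \<kappa>. path_sat N z p I R vs \<kappa>}"
    (is "{map h fr | h. ?P h} = ?r")
  proof -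
    have "{map h fr | h. ?P h} = {map (assign N vs \<kappa>) fr | vs \<kappa>. ?P (assign N vs \<kappa>)}" (is "?x = ?y")
    proof
      show "?x \<subseteq> ?y"
      proof
        fix x assume "x \<in> ?x"
        then obtain h where h: "x = map h fr" "?P h" by blast
        show "x \<in> ?y"
          by (rule CollectI, rule exI[of _ "\<lambda>v. h (2 * v)"], rule exI[of _ "\<lambda>e j. h (kvar N e j)"])
             (use h in \<open>simp only: assign_collect\<close>)
      qed
      show "?y \<subseteq> ?x" by blast
    qed
    then show ?thesis unfolding path_sat_body .
  qed
  finally show ?thesis .
qed

lemma assign_agree:
  assumes "map (assign N vs \<kappa>) fr = map (assign N vs' \<kappa>') fr"
  shows "2 * v \<in> set fr \<Longrightarrow> vs' v = vs v" "j \<le> N \<Longrightarrow> kvar N e j \<in> set fr \<Longrightarrow> \<kappa>' e j = \<kappa> e j"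
  using assms by (metis assign_vertex map_eq_conv, metis assign_knee map_eq_conv)

lemma path_transfer:
  assumes "is_structure (sig N) D R c" "is_structure (sig N) D' R' c'"
    "view (fr, path_body N z p I) D R c = view (fr, path_body N z p I) D' R' c'"
    "path_sat N z p I R vs \<kappa>"
  shows "\<exists>vs' \<kappa>'. path_sat N z p I R' vs' \<kappa>' \<and> (\<forall>v. 2 * v \<in> set fr \<longrightarrow> vs' v = vs v) \<and>
    (\<forall>e j. j \<le> N \<longrightarrow> kvar N e j \<in> set fr \<longrightarrow> \<kappa>' e j = \<kappa> e j)"
proof -
  have "map (assign N vs \<kappa>) fr \<in> view (fr, path_body N z p I) D' R' c'"
    using assms(4) unfolding assms(3)[symmetric] path_view[OF assms(1)] by blast
  then obtain vs' \<kappa>' where "path_sat N z p I R' vs' \<kappa>'" "map (assign N vs \<kappa>) fr = map (assign N vs' \<kappa>') fr"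
    unfolding path_view[OF assms(2)] by blast
  with assign_agree[OF this(2)] show ?thesis by blast
qed

lemma path_view_subset:
  assumes "is_structure (sig N) D R c" "is_structure (sig N) D' R' c'"
    and ex: "\<And>vs \<kappa>. path_sat N z p I R vs \<kappa> \<Longrightarrow> \<exists>vs' \<kappa>'. path_sat N z p I R' vs' \<kappa>' \<and>
      (\<forall>v. 2 * v \<in> set fr \<longrightarrow> vs' v = vs v) \<and> (\<forall>e j. j \<le> N \<longrightarrow> kvar N e j \<in> set fr \<longrightarrow> \<kappa>' e j = \<kappa> e j)"
  shows "view (fr, path_body N z p I) D R c \<subseteq> view (fr, path_body N z p I) D' R' c'"
proof
  fix x assume "x \<in> view (fr, path_body N z p I) D R c"
  then obtain vs \<kappa> where x: "x = map (assign N vs \<kappa>) fr" "path_sat N z p I R vs \<kappa>"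
    unfolding path_view[OF assms(1)] by blast
  from ex[OF x(2)] obtain vs' \<kappa>' where p: "path_sat N z p I R' vs' \<kappa>'"
    "\<And>v. 2 * v \<in> set fr \<Longrightarrow> vs' v = vs v" "\<And>e j. j \<le> N \<Longrightarrow> kvar N e j \<in> set fr \<Longrightarrow> \<kappa>' e j = \<kappa> e j" by blast
  have "assign N vs' \<kappa>' v = assign N vs \<kappa> v" if "v \<in> set fr" for v
  proof (cases "even v")
    case True
    then show ?thesis using p(2)[of "v div 2"] that by (simp add: assign_def)
  next
    case False
    then have "kvar N (v div 2 div Suc N) (v div 2 mod Suc N) = v"
      by (simp add: kvar_def del: mult_Suc_right)
    then show ?thesis using False p(3)[of "v div 2 mod Suc N" "v div 2 div Suc N"] that
        mod_less_divisor[of "Suc N" "v div 2"] by (simp add: assign_def less_Suc_eq_le)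
  qed
  then have "x = map (assign N vs' \<kappa>') fr" using x(1) by simp
  with p(1) show "x \<in> view (fr, path_body N z p I) D' R' c'"
    unfolding path_view[OF assms(2)] by blast
qed

text \<open>Each letter owns two legs, one for each direction of the edge that carries it, so the
  leg tells which way the edge is read along the path.\<close>

definition leg :: "nat \<Rightarrow> nat \<Rightarrow> nat \<Rightarrow> nat" where
  "leg z e a = 2 * a + (e + z) mod 2"

text \<open>Only knees are free, no vertices: a match may fold the path onto a single edge, and the
  other structure answers with some path, possibly elsewhere, that carries the complementary
  labels.\<close>

definition word_query :: "nat \<Rightarrow> nat \<Rightarrow> (nat \<Rightarrow> nat) \<Rightarrow> cq" where
  "word_query N p w = (map (\<lambda>e. kvar N e (leg 0 e (w e))) [0..<p],
     path_body N 0 p (\<lambda>e j. j = leg 0 e (w e)))"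

text \<open>For a = b the second edge is meant to be matched by the first one traversed backwards; it
  then carries the parity of the first edge, and the end of the path is not free.\<close>

definition leg2 :: "nat \<Rightarrow> nat \<Rightarrow> nat \<Rightarrow> nat" where
  "leg2 z a b = (if a = b then leg z 0 b else leg z 1 b)"

text \<open>Variables 0 and 4 are the path vertices 0 and 2; the middle vertex 1 is existential. The
  free knees are those of the main and of the intermediate letter on each edge.\<close>

definition rule_query :: "nat \<Rightarrow> nat \<Rightarrow> nat \<Rightarrow> nat \<Rightarrow> nat \<Rightarrow> nat \<Rightarrow> cq" where
  "rule_query N z a b n m =
    ((if a = b then [0] else [0, 4]) @ [kvar N 0 (leg z 0 a), kvar N 0 (leg z 0 n), kvar N 1 (leg2 z a b), kvar N 1 (leg z 1 m)],
     path_body N z 2 (\<lambda>e j. if e = 0 then j = leg z 0 a \<or> j = leg z 0 n else j = leg2 z a b \<or> j = leg z 1 m))"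

definition goal_query :: "nat \<Rightarrow> cq" where
  "goal_query N = ([], path_body N 0 1 (\<lambda>_ _. False))"

lemma body_vars_path:
  "e < p \<Longrightarrow> 2 * esrc z e \<in> body_vars (path_body N z p I)"
  "e < p \<Longrightarrow> 2 * etgt z e \<in> body_vars (path_body N z p I)"
  "e < p \<Longrightarrow> j < N \<Longrightarrow> kvar N e j \<in> body_vars (path_body N z p I)"
proof -
  have *: "x \<in> body_vars (path_body N z p I)" if "e < p" "Var x \<in> set (snd (H_atom N z e))" for x
    unfolding body_vars_def set_path_body using that by (force simp: H_atom_def)
  show "e < p \<Longrightarrow> 2 * esrc z e \<in> body_vars (path_body N z p I)"
    "e < p \<Longrightarrow> 2 * etgt z e \<in> body_vars (path_body N z p I)"
    "e < p \<Longrightarrow> j < N \<Longrightarrow> kvar N e j \<in> body_vars (path_body N z p I)"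
    by (auto intro!: * simp: H_atom_def)
qed

lemma path_atoms_over: "a \<in> set (path_body N z p I) \<Longrightarrow> atom_over (sig N) a"
  unfolding set_path_body by (auto simp: atom_over_def sig_def H_atom_def C_atom_def)

lemma cq_over_word_query:
  assumes "\<And>e. e < p \<Longrightarrow> 2 * w e + 1 < N"
  shows "cq_over (sig N) (word_query N p w)"
proof -
  have l: "leg 0 e (w e) < N" if "e < p" for e using assms[OF that] by (auto simp: leg_def)
  have "inj_on (\<lambda>e. kvar N e (leg 0 e (w e))) {0..<p}"
    by (rule inj_onI) (use l kvar_inj in \<open>auto simp: less_imp_le\<close>)
  then show ?thesis using l
    by (auto simp: cq_over_def word_query_def distinct_map path_atoms_over body_vars_path)
qed

lemma cq_over_rule_query:
  assumes "2 * a + 1 < N" "2 * b + 1 < N" "2 * n + 1 < N" "2 * m + 1 < N" "a \<noteq> n" "b \<noteq> m" "z < 2"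
  shows "cq_over (sig N) (rule_query N z a b n m)"
proof -
  have l: "leg z 0 a < N" "leg z 0 n < N" "leg z 1 b < N" "leg z 1 m < N" "leg z 0 b < N"
    using assms by (auto simp: leg_def)
  then have l2: "leg2 z a b < N" by (simp add: leg2_def)
  have ne: "leg z 0 a \<noteq> leg z 0 n" "leg2 z a b \<noteq> leg z 1 m"
    using assms by (auto simp: leg_def leg2_def)
  have "0 \<in> body_vars (path_body N z 2 I)" "4 \<in> body_vars (path_body N z 2 I)" for I
    using body_vars_path(1)[of 0 2 z N I] body_vars_path(2)[of 0 2 z N I] assms(7)
      body_vars_path(1)[of 1 2 z N I] body_vars_path(2)[of 1 2 z N I]
    by (auto simp: esrc_def etgt_def less_2_cases_iff)
  moreover have "kvar N e j \<noteq> 0" "kvar N e j \<noteq> 4" for e j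
    using kvar_odd[of N e j 0] kvar_odd[of N e j 2] by auto
  ultimately show ?thesis using l l2 ne
    by (auto simp: cq_over_def rule_query_def path_atoms_over body_vars_path kvar_inj less_imp_le)
qed

lemma cq_over_goal_query: "cq_over (sig N) (goal_query N)"
  by (auto simp: cq_over_def goal_query_def path_atoms_over)

section \<open>Instances; the alarm forces determinacy\<close>

definition rule_of :: "nat \<Rightarrow> nat \<times> nat \<times> nat \<times> nat" where
  "rule_of j = (fst (prod_decode (fst (prod_decode j))), snd (prod_decode (fst (prod_decode j))),
     fst (prod_decode (snd (prod_decode j))), snd (prod_decode (snd (prod_decode j))))"

text \<open>The binary digits of e mark the codes of the rules. Every number thus codes a finite set
  of rules, and e is a strict bound for the rule codes and for all letters in the rules.\<close>

definition rules :: "nat \<Rightarrow> (nat \<times> nat \<times> nat \<times> nat) set" where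
  "rules e = rule_of ` set_decode e"

text \<open>Two legs for each letter below e + 6: the letters of the rules are below e, and the
  letters 0 to 5 are reserved.\<close>

definition legs :: "nat \<Rightarrow> nat" where
  "legs e = 2 * (e + 6)"

text \<open>Spells an initial configuration: left end 0, initial state 5, then e copies of 1 as the
  input e in unary, right end 2. The remaining reserved letters 3 and 4 form the alarm.\<close>

definition start_letter :: "nat \<Rightarrow> nat \<Rightarrow> nat" where
  "start_letter e i = (if i = 0 then 0 else if i = 1 then 5 else if i = e + 2 then 2 else 1)"

text \<open>The index packs a rule code and a parity. Indices without a rule give the empty query,
  whose view is the same in all structures; with this padding the list of queries is a table of
  known length.\<close>

definition indexed_query :: "nat \<Rightarrow> nat \<Rightarrow> cq" where
  "indexed_query e i = (if i div 2 \<in> set_decode e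
     then case rule_of (i div 2) of (a, b, n, m) \<Rightarrow> rule_query (legs e) (i mod 2) a b n m else ([], []))"

definition queries :: "nat \<Rightarrow> cq list" where
  "queries e = word_query (legs e) (e + 3) (start_letter e) # word_query (legs e) 2 (\<lambda>i. 3 + i)
     # map (indexed_query e) [0..<2 * e]"

lemma set_decode_less: "j \<in> set_decode e \<Longrightarrow> j < e"
proof -
  assume "j \<in> set_decode e"
  then have "e div 2 ^ j \<noteq> 0" by (auto simp: set_decode_def elim: oddE intro: ccontr)
  then have "2 ^ j \<le> e" by (simp add: div_eq_0_iff)
  moreover have "j < 2 ^ j" by simp
  ultimately show ?thesis by linarith
qed

lemma rule_query_in_queries:
  "(a, b, n, m) \<in> rules e \<Longrightarrow> z < 2 \<Longrightarrow> rule_query (legs e) z a b n m \<in> set (queries e)"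
proof -
  assume "(a, b, n, m) \<in> rules e" and z: "z < 2"
  then obtain j where j: "j \<in> set_decode e" "rule_of j = (a, b, n, m)" by (auto simp: rules_def)
  have "j < e" using set_decode_less j by blast
  have i: "(2 * j + z) div 2 = j" "(2 * j + z) mod 2 = z" using z by auto
  have "rule_query (legs e) z a b n m = indexed_query e (2 * j + z)"
    unfolding indexed_query_def i using j by simp
  moreover have "2 * j + z < 2 * e" using z \<open>j < e\<close> by linarith
  ultimately show ?thesis unfolding queries_def by auto
qed

lemma queries_cases:
  assumes "Q \<in> set (queries e)"
  obtains "Q = word_query (legs e) (e + 3) (start_letter e)" | "Q = word_query (legs e) 2 (\<lambda>i. 3 + i)"
  | "Q = ([], [])" | z a b n m where "(a, b, n, m) \<in> rules e" "z < 2" "Q = rule_query (legs e) z a b n m"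
proof -
  from assms consider "Q = word_query (legs e) (e + 3) (start_letter e)" | "Q = word_query (legs e) 2 (\<lambda>i. 3 + i)"
    | i where "Q = indexed_query e i" by (auto simp: queries_def)
  then show thesis
  proof cases
    case (3 i)
    show thesis
    proof (cases "i div 2 \<in> set_decode e")
      case True
      obtain a b n m where r: "rule_of (i div 2) = (a, b, n, m)" by (cases "rule_of (i div 2)") auto
      show thesis by (rule that(4)[of a b n m "i mod 2"])
          (use True r 3 in \<open>auto simp: rules_def indexed_query_def image_iff intro!: bexI[of _ "i div 2"]\<close>)
    next
      case False
      then show thesis using that(3) 3 by (simp add: indexed_query_def)
    qed
  qed (use that in auto)
qed

text \<open>A rule with equal main letters codes the expansion of a single letter. Its view fixes
  only the start of the path, so it may act at the end of a word only, whereas exchanges of pairs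
  keep both endpoints.\<close>

inductive thue :: "(nat \<times> nat \<times> nat \<times> nat) set \<Rightarrow> nat list \<Rightarrow> nat list \<Rightarrow> bool" for Q where
  thue_fwd: "(a, b, n, m) \<in> Q \<Longrightarrow> a \<noteq> b \<Longrightarrow> thue Q (u @ [a, b] @ v) (u @ [n, m] @ v)"
| thue_bwd: "(a, b, n, m) \<in> Q \<Longrightarrow> a \<noteq> b \<Longrightarrow> thue Q (u @ [n, m] @ v) (u @ [a, b] @ v)"
| thue_tail: "(a, a, n, m) \<in> Q \<Longrightarrow> thue Q (u @ [a]) (u @ [n, m])"

section \<open>Labelled edges in two structures with equal views\<close>

definition labelled_edge :: "nat \<Rightarrow> (nat \<Rightarrow> nat list set) \<Rightarrow> (nat \<Rightarrow> nat list set) \<Rightarrow> nat set \<Rightarrow> nat \<Rightarrow> nat \<Rightarrow> bool" where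
  "labelled_edge N R R' T x y = (\<exists>\<kappa>. x # y # map \<kappa> [0..<N] \<in> R 0 \<and> (\<forall>j<N. [\<kappa> j] \<in> (if j \<in> T then R' else R) 1))"

abbreviation edge :: "nat \<Rightarrow> (nat \<Rightarrow> nat list set) \<Rightarrow> (nat \<Rightarrow> nat list set) \<Rightarrow> nat \<Rightarrow> nat \<Rightarrow> nat \<Rightarrow> bool" where
  "edge N R R' l \<equiv> labelled_edge N R R' {l}"

definition full_edge :: "nat \<Rightarrow> (nat \<Rightarrow> nat list set) \<Rightarrow> nat \<Rightarrow> nat \<Rightarrow> bool" where
  "full_edge N R x y = (\<exists>\<kappa>. x # y # map \<kappa> [0..<N] \<in> R 0 \<and> (\<forall>j<N. [\<kappa> j] \<in> R 1))"

lemma labelled_edge_empty: "labelled_edge N R R' {} = full_edge N R"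
  by (simp add: labelled_edge_def full_edge_def fun_eq_iff)

text \<open>A freed knee keeps its value and hence its unary relation, but a relation that was
  foreign to the first structure is native to the second. So within the freed legs a label turns
  into its complement, while the query itself makes every other knee native.\<close>

lemma labelled_edge_transfer:
  assumes st: "is_structure (sig N) D R c" "is_structure (sig N) D' R' c'"
    "view (fr, path_body N z p I) D R c = view (fr, path_body N z p I) D' R' c'"
    and ed: "\<And>i. i < p \<Longrightarrow> labelled_edge N R R' (T i) (vs (esrc z i)) (vs (etgt z i))"
    and I: "\<And>i j. i < p \<Longrightarrow> j < N \<Longrightarrow> I i j \<longleftrightarrow> j \<in> T i \<union> T' i" "\<And>i. i < p \<Longrightarrow> T i \<inter> T' i = {}"
    and fr: "\<And>i j. i < p \<Longrightarrow> j < N \<Longrightarrow> I i j \<Longrightarrow> kvar N i j \<in> set fr"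
  shows "\<exists>vs'. (\<forall>i<p. labelled_edge N R' R (T' i) (vs' (esrc z i)) (vs' (etgt z i))) \<and> (\<forall>v. 2 * v \<in> set fr \<longrightarrow> vs' v = vs v)"
proof -
  from ed have "\<forall>i. \<exists>\<kappa>. i < p \<longrightarrow> vs (esrc z i) # vs (etgt z i) # map \<kappa> [0..<N] \<in> R 0 \<and>
      (\<forall>j<N. [\<kappa> j] \<in> (if j \<in> T i then R' else R) 1)" unfolding labelled_edge_def by blast
  then obtain \<kappa> where \<kappa>: "\<And>i. i < p \<Longrightarrow> vs (esrc z i) # vs (etgt z i) # map (\<kappa> i) [0..<N] \<in> R 0"
    "\<And>i j. i < p \<Longrightarrow> j < N \<Longrightarrow> [\<kappa> i j] \<in> (if j \<in> T i then R' else R) 1" by metis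
  have "path_sat N z p I R vs \<kappa>"
    unfolding path_sat_def
  proof (intro allI impI conjI)
    fix i j assume "i < p" "j < N" "\<not> I i j"
    then show "[\<kappa> i j] \<in> R 1" using \<kappa>(2)[of i j] I(1)[of i j] by simp
  qed (use \<kappa>(1) in auto)
  from path_transfer[OF st this] obtain vs' \<kappa>' where t: "path_sat N z p I R' vs' \<kappa>'"
    "\<And>v. 2 * v \<in> set fr \<Longrightarrow> vs' v = vs v" "\<And>i j. j \<le> N \<Longrightarrow> kvar N i j \<in> set fr \<Longrightarrow> \<kappa>' i j = \<kappa> i j" by blast
  have "labelled_edge N R' R (T' i) (vs' (esrc z i)) (vs' (etgt z i))" if i: "i < p" for i
    unfolding labelled_edge_def
  proof (intro exI[of _ "\<kappa>' i"] conjI allI impI)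
    show "vs' (esrc z i) # vs' (etgt z i) # map (\<kappa>' i) [0..<N] \<in> R' 0"
      using t(1) i by (simp add: path_sat_def)
    fix j assume j: "j < N"
    show "[\<kappa>' i j] \<in> (if j \<in> T' i then R else R') 1"
    proof (cases "I i j")
      case True
      then have "\<kappa>' i j = \<kappa> i j" using t(3) fr i j by simp
      moreover have "j \<in> T' i \<longleftrightarrow> j \<notin> T i" using I(1)[OF i j] I(2)[OF i] True by blast
      ultimately show ?thesis using \<kappa>(2)[OF i j] by (simp split: if_splits)
    next
      case False
      then have "j \<notin> T' i" using I(1)[OF i j] by blast
      then show ?thesis using t(1) i j False by (simp add: path_sat_def)
    qed
  qed
  with t(2) show ?thesis by blast
qed

lemma full_to_edge:
  assumes st: "is_structure (sig N) D R c" "is_structure (sig N) D' R' c'"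
    "view (word_query N p w) D R c = view (word_query N p w) D' R' c'"
    and ed: "\<And>i. i < p \<Longrightarrow> full_edge N R (vs (esrc 0 i)) (vs (etgt 0 i))"
  shows "\<exists>vs'. \<forall>i<p. edge N R' R (leg 0 i (w i)) (vs' (esrc 0 i)) (vs' (etgt 0 i))"
  using labelled_edge_transfer[OF st(1,2) st(3)[unfolded word_query_def],
      where T = "\<lambda>_. {}" and T' = "\<lambda>i. {leg 0 i (w i)}" and vs = vs] ed
  by (auto simp: labelled_edge_empty)

lemma edge_to_full:
  assumes st: "is_structure (sig N) D R c" "is_structure (sig N) D' R' c'"
    "view (word_query N p w) D R c = view (word_query N p w) D' R' c'"
    and ed: "\<And>i. i < p \<Longrightarrow> edge N R R' (leg 0 i (w i)) (vs (esrc 0 i)) (vs (etgt 0 i))"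
  shows "\<exists>vs'. \<forall>i<p. full_edge N R' (vs' (esrc 0 i)) (vs' (etgt 0 i))"
  using labelled_edge_transfer[OF st(1,2) st(3)[unfolded word_query_def],
      where T' = "\<lambda>_. {}" and T = "\<lambda>i. {leg 0 i (w i)}" and vs = vs] ed
  by (auto simp: labelled_edge_empty)

lemma goal_view:
  assumes "is_structure (sig N) D R c"
  shows "view (goal_query N) D R c = (if \<exists>x y. full_edge N R x y then {[]} else {})"
proof -
  have "(\<exists>vs \<kappa>. path_sat N 0 1 (\<lambda>_ _. False) R vs \<kappa>) \<longleftrightarrow> (\<exists>x y. full_edge N R x y)"
  proof
    assume "\<exists>x y. full_edge N R x y"
    then obtain x y \<kappa> where "x # y # map \<kappa> [0..<N] \<in> R 0" "\<forall>j<N. [\<kappa> j] \<in> R 1" by (auto simp: full_edge_def)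
    then have "path_sat N 0 1 (\<lambda>_ _. False) R (\<lambda>v. if v = 0 then x else y) (\<lambda>_. \<kappa>)"
      by (auto simp: path_sat_def esrc_def etgt_def)
    then show "\<exists>vs \<kappa>. path_sat N 0 1 (\<lambda>_ _. False) R vs \<kappa>" by blast
  qed (auto simp: path_sat_def full_edge_def)
  then show ?thesis unfolding goal_query_def path_view[OF assms] by auto
qed

definition letter_edge :: "(nat \<Rightarrow> bool) \<Rightarrow> nat \<Rightarrow> (nat \<Rightarrow> nat list set) \<Rightarrow> (nat \<Rightarrow> nat list set) \<Rightarrow> nat \<Rightarrow> nat \<Rightarrow> nat \<Rightarrow> nat \<Rightarrow> bool" where
  "letter_edge mn N G R a z x y = (let l = 2 * a + z mod 2; S = (if mn a then R else G); S' = (if mn a then G else R) in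
     if even z then edge N S S' l x y else edge N S S' l y x)"

fun word_path :: "(nat \<Rightarrow> bool) \<Rightarrow> nat \<Rightarrow> (nat \<Rightarrow> nat list set) \<Rightarrow> (nat \<Rightarrow> nat list set) \<Rightarrow> nat \<Rightarrow> nat list \<Rightarrow> nat \<Rightarrow> nat \<Rightarrow> bool" where
  "word_path mn N G R z [] x y = (x = y)"
| "word_path mn N G R z (a # w) x y = (\<exists>u. letter_edge mn N G R a z x u \<and> word_path mn N G R (Suc z) w u y)"

lemma word_path_append:
  "word_path mn N G R z (u @ v) x y \<longleftrightarrow> (\<exists>m. word_path mn N G R z u x m \<and> word_path mn N G R (z + length u) v m y)"
  by (induction u arbitrary: z x) auto

lemma letter_edge_mod: "letter_edge mn N G R a (z mod 2) x y = letter_edge mn N G R a z x y"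
  by (simp add: letter_edge_def Let_def mod_2_eq_odd)

lemma letter_edge_iff:
  "letter_edge mn N G R a (e + z) (vs e) (vs (Suc e)) \<longleftrightarrow>
     edge N (if mn a then R else G) (if mn a then G else R) (leg z e a) (vs (esrc z e)) (vs (etgt z e))"
  by (auto simp: letter_edge_def Let_def leg_def esrc_def etgt_def mod_2_eq_odd)

locale equivalent_pair =
  fixes e :: nat and mn :: "nat \<Rightarrow> bool" and D D' :: "nat set" and G R :: "nat \<Rightarrow> nat list set" and c c' :: "nat \<Rightarrow> nat"
  assumes st: "is_structure (sig (legs e)) D G c" "is_structure (sig (legs e)) D' R c'"
    and views: "\<And>Q. Q \<in> set (queries e) \<Longrightarrow> view Q D G c = view Q D' R c'"
    and rl: "\<And>a b n m. (a, b, n, m) \<in> rules e \<Longrightarrow> mn a \<and> mn b \<and> \<not> mn n \<and> \<not> mn m"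
    and fixed: "mn 0" "mn 1" "mn 2" "mn 5" "\<not> mn 3" "\<not> mn 4"
begin

abbreviation "N \<equiv> legs e"
abbreviation "le \<equiv> letter_edge mn N G R"
abbreviation "wp \<equiv> word_path mn N G R"

text \<open>The two alternatives are the two directions of one view: from red edges with main
  letters to green edges with intermediate letters, and back.\<close>

lemma rule_edges:
  assumes r: "(a, b, n, m) \<in> rules e" and z: "z < 2"
    and ed: "\<And>i. i < 2 \<Longrightarrow> edge N S S' (l i) (vs (esrc z i)) (vs (etgt z i))"
    and S: "(S, S') = (R, G) \<and> l = (\<lambda>i. if i = 0 then leg z 0 a else leg2 z a b) \<and> l' = (\<lambda>i. if i = 0 then leg z 0 n else leg z 1 m) \<or>
      (S, S') = (G, R) \<and> l' = (\<lambda>i. if i = 0 then leg z 0 a else leg2 z a b) \<and> l = (\<lambda>i. if i = 0 then leg z 0 n else leg z 1 m)"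
  shows "\<exists>vs'. (\<forall>i<2. edge N S' S (l' i) (vs' (esrc z i)) (vs' (etgt z i))) \<and> vs' 0 = vs 0 \<and> (a \<noteq> b \<longrightarrow> vs' 2 = vs 2)"
proof -
  let ?fr = "(if a = b then [0] else [0, 4]) @ [kvar N 0 (leg z 0 a), kvar N 0 (leg z 0 n), kvar N 1 (leg2 z a b), kvar N 1 (leg z 1 m)]"
  let ?I = "\<lambda>i j. if i = 0 then j = leg z 0 a \<or> j = leg z 0 n else j = leg2 z a b \<or> j = leg z 1 m"
  note p = rl[OF r]
  have v: "view (?fr, path_body N z 2 ?I) D G c = view (?fr, path_body N z 2 ?I) D' R c'"
    using views[OF rule_query_in_queries[OF r z]] unfolding rule_query_def .
  have "a \<noteq> n" "b \<noteq> m" using p by auto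
  then have ne: "leg z 0 a \<noteq> leg z 0 n" "leg2 z a b \<noteq> leg z 1 m"
    by (auto simp: leg_def leg2_def mod_2_eq_odd split: if_splits)
  have "\<exists>vs'. (\<forall>i<2. edge N S' S (l' i) (vs' (esrc z i)) (vs' (etgt z i))) \<and> (\<forall>v. 2 * v \<in> set ?fr \<longrightarrow> vs' v = vs v)"
  proof -
    from S show ?thesis
    proof
      assume S: "(S, S') = (R, G) \<and> l = (\<lambda>i. if i = 0 then leg z 0 a else leg2 z a b) \<and> l' = (\<lambda>i. if i = 0 then leg z 0 n else leg z 1 m)"
      show ?thesis
        by (rule labelled_edge_transfer[where I = ?I and T = "\<lambda>i. {l i}" and p = 2 and D = D' and D' = D and c = c' and c' = c])
           (use S st v ed ne in \<open>auto simp: less_2_cases_iff\<close>)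
    next
      assume S: "(S, S') = (G, R) \<and> l' = (\<lambda>i. if i = 0 then leg z 0 a else leg2 z a b) \<and> l = (\<lambda>i. if i = 0 then leg z 0 n else leg z 1 m)"
      show ?thesis
        by (rule labelled_edge_transfer[where I = ?I and T = "\<lambda>i. {l i}" and p = 2 and D' = D' and D = D and c' = c' and c = c])
           (use S st v ed ne in \<open>auto simp: less_2_cases_iff\<close>)
    qed
  qed
  then obtain vs' where vs': "\<forall>i<2. edge N S' S (l' i) (vs' (esrc z i)) (vs' (etgt z i))"
    "\<And>v. 2 * v \<in> set ?fr \<Longrightarrow> vs' v = vs v" by blast
  have "vs' 0 = vs 0" using vs'(2)[of 0] by auto
  moreover have "vs' 2 = vs 2" if "a \<noteq> b" using vs'(2)[of 2] that by auto
  ultimately show ?thesis using vs'(1) by blast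
qed

lemma rule_edges_main:
  assumes r: "(a, b, n, m) \<in> rules e" and z: "z < 2"
    and "edge N R G (leg z 0 a) (vs (esrc z 0)) (vs (etgt z 0))"
    and "edge N R G (leg2 z a b) (vs (esrc z 1)) (vs (etgt z 1))"
  shows "\<exists>vs'. edge N G R (leg z 0 n) (vs' (esrc z 0)) (vs' (etgt z 0)) \<and>
    edge N G R (leg z 1 m) (vs' (esrc z 1)) (vs' (etgt z 1)) \<and> vs' 0 = vs 0 \<and> (a \<noteq> b \<longrightarrow> vs' 2 = vs 2)"
proof -
  let ?l = "\<lambda>i::nat. if i = 0 then leg z 0 a else leg2 z a b"
  let ?l' = "\<lambda>i::nat. if i = 0 then leg z 0 n else leg z 1 m"
  have "\<exists>vs'. (\<forall>i<2. edge N G R (?l' i) (vs' (esrc z i)) (vs' (etgt z i))) \<and> vs' 0 = vs 0 \<and> (a \<noteq> b \<longrightarrow> vs' 2 = vs 2)"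
  proof (rule rule_edges[OF r z])
    show "edge N R G (?l i) (vs (esrc z i)) (vs (etgt z i))" if "i < 2" for i
      using assms(3,4) that by (cases "i = 0") (auto simp: less_2_cases_iff)
  qed simp
  then obtain vs' where v: "\<forall>i<2. edge N G R (?l' i) (vs' (esrc z i)) (vs' (etgt z i))"
    "vs' 0 = vs 0" "a \<noteq> b \<longrightarrow> vs' 2 = vs 2" by (elim exE conjE)
  show ?thesis
    by (rule exI[of _ vs']) (use v(1)[THEN spec, of 0] v(1)[THEN spec, of 1] v(2,3) in simp)
qed

lemma rule_edges_inter:
  assumes r: "(a, b, n, m) \<in> rules e" and z: "z < 2"
    and "edge N G R (leg z 0 n) (vs (esrc z 0)) (vs (etgt z 0))"
    and "edge N G R (leg z 1 m) (vs (esrc z 1)) (vs (etgt z 1))"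
  shows "\<exists>vs'. edge N R G (leg z 0 a) (vs' (esrc z 0)) (vs' (etgt z 0)) \<and>
    edge N R G (leg2 z a b) (vs' (esrc z 1)) (vs' (etgt z 1)) \<and> vs' 0 = vs 0 \<and> (a \<noteq> b \<longrightarrow> vs' 2 = vs 2)"
proof -
  let ?l' = "\<lambda>i::nat. if i = 0 then leg z 0 a else leg2 z a b"
  let ?l = "\<lambda>i::nat. if i = 0 then leg z 0 n else leg z 1 m"
  have "\<exists>vs'. (\<forall>i<2. edge N R G (?l' i) (vs' (esrc z i)) (vs' (etgt z i))) \<and> vs' 0 = vs 0 \<and> (a \<noteq> b \<longrightarrow> vs' 2 = vs 2)"
  proof (rule rule_edges[OF r z])
    show "edge N G R (?l i) (vs (esrc z i)) (vs (etgt z i))" if "i < 2" for i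
      using assms(3,4) that by (cases "i = 0") (auto simp: less_2_cases_iff)
  qed simp
  then obtain vs' where v: "\<forall>i<2. edge N R G (?l' i) (vs' (esrc z i)) (vs' (etgt z i))"
    "vs' 0 = vs 0" "a \<noteq> b \<longrightarrow> vs' 2 = vs 2" by (elim exE conjE)
  show ?thesis
    by (rule exI[of _ vs']) (use v(1)[THEN spec, of 0] v(1)[THEN spec, of 1] v(2,3) in simp)
qed

lemma path_two: "wp z [a, b] x y \<longleftrightarrow> (\<exists>u. le a (z mod 2) x u \<and> le b (Suc (z mod 2)) u y)"
proof -
  have "le b (Suc (z mod 2)) u y = le b (Suc z) u y" for u
    using letter_edge_mod[of mn N G R b "Suc z" u y] letter_edge_mod[of mn N G R b "Suc (z mod 2)" u y]
    by (simp add: mod_Suc_eq)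
  then show ?thesis by (simp add: letter_edge_mod)
qed

lemma edges_two:
  assumes "z < 2"
  shows "le a z (vs 0) (vs 1) \<and> le b (Suc z) (vs 1) (vs 2) \<longleftrightarrow>
    edge N (if mn a then R else G) (if mn a then G else R) (leg z 0 a) (vs (esrc z 0)) (vs (etgt z 0)) \<and>
    edge N (if mn b then R else G) (if mn b then G else R) (leg z 1 b) (vs (esrc z 1)) (vs (etgt z 1))"
  using letter_edge_iff[of mn N G R a 0 z vs] letter_edge_iff[of mn N G R b 1 z vs]
  by (simp add: numeral_2_eq_2)

text \<open>For distinct main letters both ends of the two-edge path are free variables, so the
  answer in the other structure joins the same two vertices.\<close>

lemma rule_step:
  assumes r: "(a, b, n, m) \<in> rules e" "a \<noteq> b"
  shows "wp z [a, b] x y \<longleftrightarrow> wp z [n, m] x y"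
proof -
  note p = rl[OF r(1)]
  define w where "w = z mod 2"
  have w: "w < 2" by (simp add: w_def)
  have l2: "leg2 w a b = leg w 1 b" using r(2) by (simp add: leg2_def)
  have a: "\<exists>u. le n w x u \<and> le m (Suc w) u y" if "le a w x u" "le b (Suc w) u y" for u
  proof -
    define vs where "vs i = (if i = 0 then x else if i = 1 then u else y)" for i :: nat
    have vs: "vs 0 = x" "vs 1 = u" "vs 2 = y" by (auto simp: vs_def)
    have ed: "edge N R G (leg w 0 a) (vs (esrc w 0)) (vs (etgt w 0)) \<and> edge N R G (leg2 w a b) (vs (esrc w 1)) (vs (etgt w 1))"
      using edges_two[OF w, of a vs b] that p unfolding vs l2 by simp
    from rule_edges_main[OF r(1) w ed[THEN conjunct1] ed[THEN conjunct2]] r(2) obtain vs' where vs': "edge N G R (leg w 0 n) (vs' (esrc w 0)) (vs' (etgt w 0))"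
      "edge N G R (leg w 1 m) (vs' (esrc w 1)) (vs' (etgt w 1))" "vs' 0 = vs 0" "vs' 2 = vs 2"
      by (elim exE conjE) simp
    then show ?thesis using edges_two[OF w, of n vs' m] p vs by auto
  qed
  have b: "\<exists>u. le a w x u \<and> le b (Suc w) u y" if "le n w x u" "le m (Suc w) u y" for u
  proof -
    define vs where "vs i = (if i = 0 then x else if i = 1 then u else y)" for i :: nat
    have vs: "vs 0 = x" "vs 1 = u" "vs 2 = y" by (auto simp: vs_def)
    have ed: "edge N G R (leg w 0 n) (vs (esrc w 0)) (vs (etgt w 0)) \<and> edge N G R (leg w 1 m) (vs (esrc w 1)) (vs (etgt w 1))"
      using edges_two[OF w, of n vs m] that p unfolding vs by simp
    from rule_edges_inter[OF r(1) w ed[THEN conjunct1] ed[THEN conjunct2], unfolded l2] r(2) obtain vs' where vs': "edge N R G (leg w 0 a) (vs' (esrc w 0)) (vs' (etgt w 0))"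
      "edge N R G (leg w 1 b) (vs' (esrc w 1)) (vs' (etgt w 1))" "vs' 0 = vs 0" "vs' 2 = vs 2"
      by (elim exE conjE) simp
    then show ?thesis using edges_two[OF w, of a vs' b] p vs by auto
  qed
  show ?thesis unfolding path_two w_def[symmetric] using a b by blast
qed

text \<open>One edge walked forth and back already matches the two-edge query, since
  \<open>leg2\<close> gives the second edge the leg of the first. The answer is a path of two edges
  from the same start, whose far end is arbitrary.\<close>

lemma tail_step:
  assumes r: "(a, a, n, m) \<in> rules e" and "wp z [a] x y"
  shows "\<exists>y'. wp z [n, m] x y'"
proof -
  note p = rl[OF r(1)]
  define w where "w = z mod 2"
  have w: "w < 2" by (simp add: w_def)
  have ed: "le a w x y" using assms(2) by (simp add: w_def letter_edge_mod)
  \<comment> \<open>Vertices 0 and 2 coincide in x, which folds the second edge onto the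
    first.\<close>
  define vs where "vs i = (if i = 1 then y else x)" for i :: nat
  have vs: "vs 0 = x" "vs (Suc 0) = y" by (auto simp: vs_def)
  have e0: "edge N R G (leg w 0 a) (vs (esrc w 0)) (vs (etgt w 0))"
    using letter_edge_iff[of mn N G R a 0 w vs] ed p vs by simp
  have "vs (esrc w 1) = vs (esrc w 0)" "vs (etgt w 1) = vs (etgt w 0)"
    using w by (auto simp: esrc_def etgt_def less_2_cases_iff vs_def)
  then have "edge N R G (leg2 w a a) (vs (esrc w 1)) (vs (etgt w 1))"
    using e0 by (simp add: leg2_def)
  from rule_edges_main[OF r(1) w e0 this] obtain vs' where
    vs': "edge N G R (leg w 0 n) (vs' (esrc w 0)) (vs' (etgt w 0))"
      "edge N G R (leg w 1 m) (vs' (esrc w 1)) (vs' (etgt w 1))" "vs' 0 = vs 0"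
    by (elim exE conjE)
  then show ?thesis unfolding path_two w_def[symmetric] using edges_two[OF w, of n vs' m] p vs by auto
qed

lemma thue_path: "thue (rules e) u v \<Longrightarrow> wp z u x y \<Longrightarrow> \<exists>y'. wp z v x y'"
proof (induction rule: thue.induct)
  case (thue_fwd a b n m u v)
  have "wp z (u @ [n, m] @ v) x y"
    using thue_fwd.prems rule_step[OF thue_fwd.hyps] by (simp add: word_path_append[of _ _ _ _ _ u]
        word_path_append[of _ _ _ _ _ "[a, b]"] word_path_append[of _ _ _ _ _ "[n, m]"] del: append.simps word_path.simps)
  then show ?case by (rule exI)
next
  case (thue_bwd a b n m u v)
  have "wp z (u @ [a, b] @ v) x y"
    using thue_bwd.prems rule_step[OF thue_bwd.hyps] by (simp add: word_path_append[of _ _ _ _ _ u]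
        word_path_append[of _ _ _ _ _ "[a, b]"] word_path_append[of _ _ _ _ _ "[n, m]"] del: append.simps word_path.simps)
  then show ?case by (rule exI)
next
  case (thue_tail a n m u)
  from thue_tail.prems obtain p where p: "wp z u x p" "wp (z + length u) [a] p y" unfolding word_path_append by (elim exE conjE)
  from tail_step[OF thue_tail.hyps p(2)] obtain y' where "wp (z + length u) [n, m] p y'" by (elim exE)
  with p(1) have "wp z (u @ [n, m]) x y'" unfolding word_path_append by (intro exI conjI)
  then show ?case by (rule exI)
qed

text \<open>With z = 0 all edges of a zigzag path run from even to odd vertices, so the path folds
  onto the full edge. The start view answers with a red path that spells the start word, rewriting
  leads to a path that begins with the alarm, and the alarm view turns its two green letters into
  full red edges.\<close>

lemma alarm_determines:
  assumes "(thue (rules e))\<^sup>*\<^sup>* (map (start_letter e) [0..<e + 3]) (3 # 4 # v)"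
    and full: "full_edge N G s t"
  shows "\<exists>x y. full_edge N R x y"
proof -
  have sl: "mn (start_letter e i)" for i using fixed by (auto simp: start_letter_def)
  have "\<exists>vs'. \<forall>i<e+3. edge N R G (leg 0 i (start_letter e i)) (vs' (esrc 0 i)) (vs' (etgt 0 i))"
  proof (rule full_to_edge[OF st, where vs = "\<lambda>v. if even v then s else t"])
    show "view (word_query N (e + 3) (start_letter e)) D G c = view (word_query N (e + 3) (start_letter e)) D' R c'"
      by (rule views) (simp add: queries_def)
    show "full_edge N G (if even (esrc 0 i) then s else t) (if even (etgt 0 i) then s else t)" for i
      using full by (auto simp: esrc_def etgt_def mod_2_eq_odd)
  qed
  then obtain vs where vs: "\<And>i. i < e + 3 \<Longrightarrow> edge N R G (leg 0 i (start_letter e i)) (vs (esrc 0 i)) (vs (etgt 0 i))"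
    by blast
  have "wp 0 (map (start_letter e) [0..<p]) (vs 0) (vs p)" if "p \<le> e + 3" for p
    using that
  proof (induction p)
    case (Suc p)
    have "le (start_letter e p) (p + 0) (vs p) (vs (Suc p))"
      unfolding letter_edge_iff using vs[of p] Suc.prems sl[of p] by simp
    with Suc show ?case by (auto simp: word_path_append)
  qed simp
  then have "\<exists>y. wp 0 (map (start_letter e) [0..<e + 3]) (vs 0) y" by blast
  with assms(1) have "\<exists>y. wp 0 (3 # 4 # v) (vs 0) y"
  proof (induction rule: rtranclp_induct)
    case (step u v)
    from step.IH[OF step.prems] obtain y where "wp 0 u (vs 0) y" by (elim exE)
    then show ?case by (rule thue_path[OF step.hyps(2)])
  qed
  then obtain u y where u: "le 3 0 (vs 0) u" "le 4 (Suc 0) u y" by auto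
  let ?vs = "\<lambda>i::nat. if i = 0 then vs 0 else if i = 1 then u else y"
  have ed: "edge N G R (leg 0 0 3) (?vs (esrc 0 0)) (?vs (etgt 0 0)) \<and> edge N G R (leg 0 1 4) (?vs (esrc 0 1)) (?vs (etgt 0 1))"
    using edges_two[of 0 3 ?vs 4] u fixed by simp
  have "\<exists>vs'. \<forall>i<2. full_edge N R (vs' (esrc 0 i)) (vs' (etgt 0 i))"
  proof (rule edge_to_full[OF st, where vs = ?vs and w = "\<lambda>i. 3 + i"])
    show "view (word_query N 2 (\<lambda>i. 3 + i)) D G c = view (word_query N 2 (\<lambda>i. 3 + i)) D' R c'"
      by (rule views) (simp add: queries_def)
    show "edge N G R (leg 0 i (3 + i)) (?vs (esrc 0 i)) (?vs (etgt 0 i))" if "i < 2" for i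
      using ed that by (auto simp: less_2_cases_iff)
  qed
  then show ?thesis using zero_less_numeral by blast
qed

end

text \<open>The views do not distinguish green from red, so the implication between full edges holds
  in both directions; the goal is Boolean and asks for nothing else.\<close>

lemma alarm_fin_determines:
  assumes rl: "\<And>a b n m. (a, b, n, m) \<in> rules e \<Longrightarrow> mn a \<and> mn b \<and> \<not> mn n \<and> \<not> mn m"
    and fixed: "mn 0" "mn 1" "mn 2" "mn 5" "\<not> mn 3" "\<not> mn 4"
    and alarm: "(thue (rules e))\<^sup>*\<^sup>* (map (start_letter e) [0..<e + 3]) (3 # 4 # v)"
  shows "fin_determines (sig (legs e)) (queries e) (goal_query (legs e))"
  unfolding fin_determines_def
proof (intro allI impI)
  fix D1 R1 c1 D2 R2 c2
  assume st: "is_structure (sig (legs e)) D1 R1 c1" "is_structure (sig (legs e)) D2 R2 c2"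
    and v: "\<forall>Q\<in>set (queries e). view Q D1 R1 c1 = view Q D2 R2 c2"
  interpret one: equivalent_pair e mn D1 D2 R1 R2 c1 c2
    by unfold_locales (use st v rl fixed in auto)
  interpret two: equivalent_pair e mn D2 D1 R2 R1 c2 c1
    by unfold_locales (use st v rl fixed in auto)
  have "(\<exists>x y. full_edge (legs e) R1 x y) \<longleftrightarrow> (\<exists>x y. full_edge (legs e) R2 x y)"
    using one.alarm_determines[OF alarm] two.alarm_determines[OF alarm] by blast
  then show "view (goal_query (legs e)) D1 R1 c1 = view (goal_query (legs e)) D2 R2 c2"
    by (simp add: goal_view[OF st(1)] goal_view[OF st(2)])
qed

section \<open>A finite counterexample from a finite class of words\<close>

text \<open>Here \<open>W\<close> is the finite language behind the main component, and
  \<open>Z\<close> selects the letters of the colour-exchanged edge: the alarm letters belong to it,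
  the right end 2 does not, and the rules respect it.\<close>

locale countermodel =
  fixes e :: nat and mn Z :: "nat \<Rightarrow> bool" and W :: "nat list set"
  assumes finW: "finite W"
    and rl: "\<And>a b n m. (a, b, n, m) \<in> rules e \<Longrightarrow> mn a \<and> mn b \<and> \<not> mn n \<and> \<not> mn m \<and>
        a < e + 6 \<and> b < e + 6 \<and> n < e + 6 \<and> m < e + 6"
    and fixed: "mn 0" "mn 1" "mn 2" "mn 5" "\<not> mn 3" "\<not> mn 4"
    and startW: "map (start_letter e) [0..<e + 3] \<in> W"
    and pair: "\<And>a b n m u v. (a, b, n, m) \<in> rules e \<Longrightarrow> a \<noteq> b \<Longrightarrow> u @ [a, b] @ v \<in> W \<longleftrightarrow> u @ [n, m] @ v \<in> W"
    and tail: "\<And>a n m u. (a, a, n, m) \<in> rules e \<Longrightarrow> u @ [a] \<in> W \<longleftrightarrow> u @ [n, m] \<in> W"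
    and tail_main_end: "\<And>a n m u v. (a, a, n, m) \<in> rules e \<Longrightarrow> u @ [a] @ v \<in> W \<Longrightarrow> v = []"
    and tail_inter_end: "\<And>a n m u v. (a, a, n, m) \<in> rules e \<Longrightarrow> u @ [n, m] @ v \<in> W \<Longrightarrow> v = []"
    and no_alarm: "\<And>u v. u @ [3, 4] @ v \<notin> W"
    and Zfixed: "Z 3" "Z 4" "\<not> Z 2"
    and Zpair: "\<And>a b n m. (a, b, n, m) \<in> rules e \<Longrightarrow> Z a \<and> Z b \<longleftrightarrow> Z n \<and> Z m"
begin

abbreviation "N \<equiv> legs e"

section \<open>Left quotients of the language as vertices\<close>

definition res :: "nat list \<Rightarrow> nat list set" where
  "res p = {s. p @ s \<in> W}"

definition Res :: "nat list set set" where
  "Res = range res - {{}}"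

text \<open>The Brzozowski derivative. On \<open>Res\<close> it gives the transitions of the minimal
  automaton of \<open>W\<close> without its dead state {}.\<close>

definition der :: "nat \<Rightarrow> nat list set \<Rightarrow> nat list set" where
  "der a X = {s. a # s \<in> X}"

lemma der_res: "der a (res p) = res (p @ [a])"
  by (simp add: der_def res_def)

lemma der_Res: "X \<in> Res \<Longrightarrow> der a X \<noteq> {} \<Longrightarrow> der a X \<in> Res"
  by (auto simp: Res_def der_res)

text \<open>A nonempty quotient belongs to a prefix of a word of \<open>W\<close>, and there are
  finitely many of these.\<close>

lemma finite_Res: "finite Res"
proof -
  have "Res \<subseteq> res ` (\<Union>w\<in>W. (\<lambda>k. take k w) ` {..length w})"
  proof
    fix X assume "X \<in> Res"
    then obtain p s where X: "X = res p" "p @ s \<in> W" by (auto simp: Res_def res_def)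
    have "p = take (length p) (p @ s)" by simp
    then have "p \<in> (\<Union>w\<in>W. (\<lambda>k. take k w) ` {..length w})"
      using X(2) by (intro UN_I[of "p @ s"] image_eqI[of _ _ "length p"]) auto
    then show "X \<in> res ` (\<Union>w\<in>W. (\<lambda>k. take k w) ` {..length w})" using X(1) by blast
  qed
  then show ?thesis by (rule finite_subset) (use finW in auto)
qed

definition idx :: "nat list set \<Rightarrow> nat" where
  "idx = (SOME f. inj_on f Res)"

lemma idx_inj: "inj_on idx Res"
proof -
  have "\<exists>f :: nat list set \<Rightarrow> nat. inj_on f Res" using finite_imp_inj_to_nat_seg[OF finite_Res] by blast
  then show ?thesis unfolding idx_def by (rule someI_ex)
qed

text \<open>The numbers below 6 are taken: 0 and 1 by the start edge, 2 and 3 by the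
  colour-exchanged edge, 4 and 5 by the knees of the two colours.\<close>

definition vx :: "nat list set \<Rightarrow> nat" where
  "vx X = 6 + idx X"

lemma vx_inj: "X \<in> Res \<Longrightarrow> Y \<in> Res \<Longrightarrow> vx X = vx Y \<longleftrightarrow> X = Y"
  using idx_inj by (auto simp: vx_def inj_on_def)

definition mv :: "nat \<Rightarrow> nat \<Rightarrow> nat \<Rightarrow> bool" where
  "mv a x y = (\<exists>X\<in>Res. der a X \<in> Res \<and> x = vx X \<and> y = vx (der a X))"

definition mvdir :: "nat \<Rightarrow> nat \<Rightarrow> nat \<Rightarrow> nat \<Rightarrow> bool" where
  "mvdir w a x y = (if w = 0 then mv a x y else mv a y x)"

lemma mv_two: "mv a x u \<Longrightarrow> mv b u y \<Longrightarrow> \<exists>X\<in>Res. x = vx X \<and> y = vx (der b (der a X)) \<and> der b (der a X) \<noteq> {}"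
proof -
  assume "mv a x u" "mv b u y"
  then obtain X Y where X: "X \<in> Res" "der a X \<in> Res" "x = vx X" "u = vx (der a X)"
    and Y: "Y \<in> Res" "der b Y \<in> Res" "u = vx Y" "y = vx (der b Y)" unfolding mv_def by auto
  have "Y = der a X" using vx_inj[OF Y(1) X(2)] X(4) Y(3) by simp
  with X Y show ?thesis by (auto simp: Res_def intro!: bexI[of _ X])
qed

lemma two_mv:
  assumes "X \<in> Res" "der b (der a X) \<noteq> {}"
  shows "\<exists>u. mv a (vx X) u \<and> mv b u (vx (der b (der a X)))"
proof -
  have "der a X \<noteq> {}" using assms(2) by (auto simp: der_def)
  then have "der a X \<in> Res" using der_Res assms(1) by blast
  then show ?thesis using der_Res[OF _ assms(2)] assms(1) unfolding mv_def by blast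
qed

text \<open>Closure of \<open>W\<close> under the rule makes the derivatives by the two pairs equal,
  and equal quotients are the same vertex, so both paths also end at the same place.\<close>

lemma mv_rule:
  assumes r: "(a, b, n, m) \<in> rules e" "a \<noteq> b"
  shows "(\<exists>u. mv a x u \<and> mv b u y) \<longleftrightarrow> (\<exists>u. mv n x u \<and> mv m u y)"
proof -
  have eq: "der b (der a X) = der m (der n X)" if "X \<in> Res" for X
    using that pair[OF r, of _ "_"] by (auto simp: Res_def der_def res_def)
  show ?thesis
  proof
    assume "\<exists>u. mv a x u \<and> mv b u y"
    then obtain X where "X \<in> Res" "x = vx X" "y = vx (der b (der a X))" "der b (der a X) \<noteq> {}" using mv_two by blast
    then show "\<exists>u. mv n x u \<and> mv m u y" using two_mv[of X m n] eq by simp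
  next
    assume "\<exists>u. mv n x u \<and> mv m u y"
    then obtain X where "X \<in> Res" "x = vx X" "y = vx (der m (der n X))" "der m (der n X) \<noteq> {}" using mv_two by blast
    then show "\<exists>u. mv a x u \<and> mv b u y" using two_mv[of X b a] eq by simp
  qed
qed

text \<open>The tail letter and its expansion occur only at the end of words of \<open>W\<close>, so
  closure at the end of words suffices. The two paths share their start but may end in different
  quotients.\<close>

lemma mv_tail:
  assumes r: "(a, a, n, m) \<in> rules e"
  shows "(\<exists>u. mv a x u) \<longleftrightarrow> (\<exists>u y. mv n x u \<and> mv m u y)"
proof
  assume "\<exists>u. mv a x u"
  then obtain X where X: "X \<in> Res" "x = vx X" "der a X \<noteq> {}" by (auto simp: mv_def Res_def)
  then obtain p s where p: "X = res p" "p @ [a] @ s \<in> W" by (auto simp: Res_def der_def res_def)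
  then have "p @ [n, m] \<in> W" using tail_main_end[OF r p(2)] tail[OF r, of p] by simp
  then have "der m (der n X) \<noteq> {}" using p(1) by (auto simp: der_def res_def)
  then show "\<exists>u y. mv n x u \<and> mv m u y" using two_mv[OF X(1)] X(2) by blast
next
  assume "\<exists>u y. mv n x u \<and> mv m u y"
  then obtain X where X: "X \<in> Res" "x = vx X" "der m (der n X) \<noteq> {}" using mv_two by blast
  then obtain p s where p: "X = res p" "p @ [n, m] @ s \<in> W" by (auto simp: Res_def der_def res_def)
  then have "p @ [a] \<in> W" using tail_inter_end[OF r p(2)] tail[OF r, of p] by simp
  then have "der a X \<noteq> {}" using p(1) by (auto simp: der_def res_def)
  then show "\<exists>u. mv a x u" using X der_Res unfolding mv_def by blast
qed

lemma mv_alarm: "\<not> (mv 3 x u \<and> mv 4 u y)"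
proof
  assume "mv 3 x u \<and> mv 4 u y"
  then obtain X where "X \<in> Res" "der 4 (der 3 X) \<noteq> {}" using mv_two by blast
  then obtain p s where "p @ [3, 4] @ s \<in> W" by (auto simp: Res_def der_def res_def)
  then show False using no_alarm by blast
qed

text \<open>The labels of the edges of the green (c) and the red (not c) structure, in three components:
  the green edge that starts everything, a copy of the rules with colours exchanged, which absorbs
  the effect of the alarm view on that edge, and the graph of residuals of W.\<close>

definition lab_start :: "bool \<Rightarrow> nat \<Rightarrow> nat \<Rightarrow> nat set \<Rightarrow> bool" where
  "lab_start c x y T = (x = 0 \<and> y = 1 \<and> (if c then T = {} else card T = 2))"

definition lab_flip :: "bool \<Rightarrow> nat \<Rightarrow> nat \<Rightarrow> nat set \<Rightarrow> bool" where
  "lab_flip c x y T = (x = 2 \<and> y = 3 \<and> (\<exists>a w. w < 2 \<and> mn a = c \<and> Z a \<and> T = {2 * a + w}))"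

definition lab_word :: "bool \<Rightarrow> nat \<Rightarrow> nat \<Rightarrow> nat set \<Rightarrow> bool" where
  "lab_word c x y T = (\<exists>a w. w < 2 \<and> mn a = (\<not> c) \<and> mvdir w a x y \<and> T = {2 * a + w})"

definition lab :: "bool \<Rightarrow> nat \<Rightarrow> nat \<Rightarrow> nat set \<Rightarrow> bool" where
  "lab c x y T = (lab_start c x y T \<or> lab_flip c x y T \<or> lab_word c x y T)"

definition knee :: "bool \<Rightarrow> nat" where
  "knee c = (if c then 4 else 5)"

definition dom :: "nat set" where
  "dom = {..<6} \<union> vx ` Res"

definition model :: "bool \<Rightarrow> nat \<Rightarrow> nat list set" where
  "model c r = (if r = 0 then {x # y # map \<kappa> [0..<N] | x y \<kappa>.
       lab c x y {j. j < N \<and> \<kappa> j = knee (\<not> c)} \<and> (\<forall>j<N. \<kappa> j \<in> {4, 5})}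
     else if r = 1 then {[knee c]} else {})"

lemma lab_dom: "lab c x y T \<Longrightarrow> x \<in> dom \<and> y \<in> dom"
  by (auto simp: lab_def lab_start_def lab_flip_def lab_word_def mvdir_def mv_def dom_def split: if_splits)

lemma model_structure: "is_structure (sig N) dom (model c) f"
proof -
  have knees: "x \<in> dom" if "\<forall>j<N. \<kappa> j \<in> {4, 5}" "x \<in> set (map \<kappa> [0..<N])" for \<kappa> x
  proof -
    from that(2) obtain j where "j < N" "x = \<kappa> j" by auto
    then have "x = 4 \<or> x = 5" using that(1) by auto
    then show ?thesis by (auto simp: dom_def)
  qed
  have "length t = N + 2 \<and> set t \<subseteq> dom" if "t \<in> model c 0" for t
  proof -
    from that obtain x y \<kappa> T where t: "t = x # y # map \<kappa> [0..<N]" "lab c x y T" "\<forall>j<N. \<kappa> j \<in> {4, 5}"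
      unfolding model_def by auto
    show ?thesis using lab_dom[OF t(2)] knees[OF t(3)] unfolding t(1) by auto
  qed
  moreover have "length t = 1 \<and> set t \<subseteq> dom" if "t \<in> model c 1" for t
    using that by (auto simp: model_def knee_def dom_def)
  moreover have "finite dom" using finite_Res by (simp add: dom_def)
  moreover have "model c r = {}" if "r \<notin> {0, 1}" for r using that by (simp add: model_def)
  ultimately show ?thesis by (simp add: is_structure_def sig_def)
qed

section \<open>Transfer of matches between the two coloured models\<close>

lemma view_sub:
  assumes fr: "\<And>i j. j \<le> N \<Longrightarrow> kvar N i j \<in> set fr \<Longrightarrow> i < p \<and> j < N \<and> I i j"
    and ex: "\<And>vs T. (\<And>i. i < p \<Longrightarrow> lab c (vs (esrc z i)) (vs (etgt z i)) (T i) \<and> T i \<subseteq> {j. j < N \<and> I i j}) \<Longrightarrow>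
      \<exists>vs'. (\<forall>i<p. lab (\<not> c) (vs' (esrc z i)) (vs' (etgt z i)) ({j. j < N \<and> I i j} - T i)) \<and>
        (\<forall>v. 2 * v \<in> set fr \<longrightarrow> vs' v = vs v)"
  shows "view (fr, path_body N z p I) dom (model c) f \<subseteq> view (fr, path_body N z p I) dom (model (\<not> c)) f"
proof (rule path_view_subset[OF model_structure model_structure])
  fix vs \<kappa> assume sat: "path_sat N z p I (model c) vs \<kappa>"
  define T where "T i = {j. j < N \<and> \<kappa> i j = knee (\<not> c)}" for i
  have \<kappa>: "lab c (vs (esrc z i)) (vs (etgt z i)) (T i) \<and> (\<forall>j<N. \<kappa> i j \<in> {4, 5})" if i: "i < p" for i
  proof -
    have "vs (esrc z i) # vs (etgt z i) # map (\<kappa> i) [0..<N] \<in> model c 0"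
      using sat i by (simp add: path_sat_def)
    then obtain \<kappa>' where k: "map (\<kappa> i) [0..<N] = map \<kappa>' [0..<N]"
      "lab c (vs (esrc z i)) (vs (etgt z i)) {j. j < N \<and> \<kappa>' j = knee (\<not> c)}" "\<forall>j<N. \<kappa>' j \<in> {4, 5}"
      by (auto simp: model_def)
    have "\<forall>j<N. \<kappa> i j = \<kappa>' j" using k(1) by auto
    then have "{j. j < N \<and> \<kappa>' j = knee (\<not> c)} = T i" by (auto simp: T_def)
    with k \<open>\<forall>j<N. \<kappa> i j = \<kappa>' j\<close> show ?thesis by auto
  qed
  have sub: "T i \<subseteq> {j. j < N \<and> I i j}" if i: "i < p" for i
  proof
    fix j assume j: "j \<in> T i"
    then have "[\<kappa> i j] \<notin> model c 1" by (auto simp: T_def model_def knee_def)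
    moreover have "\<forall>j<N. \<not> I i j \<longrightarrow> [\<kappa> i j] \<in> model c 1" using sat i by (simp add: path_sat_def)
    ultimately show "j \<in> {j. j < N \<and> I i j}" using j unfolding T_def by blast
  qed
  obtain vs' where vs': "\<And>i. i < p \<Longrightarrow> lab (\<not> c) (vs' (esrc z i)) (vs' (etgt z i)) ({j. j < N \<and> I i j} - T i)"
    "\<And>v. 2 * v \<in> set fr \<Longrightarrow> vs' v = vs v" using ex[of vs T] \<kappa> sub by auto
  \<comment> \<open>Freed knees are copied, since they may be free variables; every other knee takes
    the native value of the target structure.\<close>
  define \<kappa>' where "\<kappa>' i j = (if I i j then \<kappa> i j else knee (\<not> c))" for i j
  have "path_sat N z p I (model (\<not> c)) vs' \<kappa>'"
    unfolding path_sat_def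
  proof (intro allI impI conjI)
    fix i assume i: "i < p"
    have "{j. j < N \<and> \<kappa>' i j = knee (\<not> \<not> c)} = {j. j < N \<and> I i j} - T i"
      using \<kappa>[OF i] by (auto simp: \<kappa>'_def T_def knee_def split: if_splits)
    moreover have "\<forall>j<N. \<kappa>' i j \<in> {4, 5}" using \<kappa>[OF i] by (auto simp: \<kappa>'_def knee_def)
    ultimately show "vs' (esrc z i) # vs' (etgt z i) # map (\<kappa>' i) [0..<N] \<in> model (\<not> c) 0"
      using vs'(1)[OF i] by (auto simp: model_def)
    fix j assume "j < N" "\<not> I i j"
    then show "[\<kappa>' i j] \<in> model (\<not> c) 1" by (simp add: \<kappa>'_def model_def)
  qed
  moreover have "\<forall>i j. j \<le> N \<longrightarrow> kvar N i j \<in> set fr \<longrightarrow> \<kappa>' i j = \<kappa> i j"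
    using fr by (auto simp: \<kappa>'_def)
  ultimately show "\<exists>vs' \<kappa>'. path_sat N z p I (model (\<not> c)) vs' \<kappa>' \<and>
      (\<forall>v. 2 * v \<in> set fr \<longrightarrow> vs' v = vs v) \<and> (\<forall>i j. j \<le> N \<longrightarrow> kvar N i j \<in> set fr \<longrightarrow> \<kappa>' i j = \<kappa> i j)"
    using vs'(2) by blast
qed

text \<open>The three components occupy disjoint ranges of vertices, so edges that share a vertex
  belong to the same component.\<close>

lemma lab_cases:
  assumes "lab c x y T"
  shows "(lab_start c x y T \<and> x < 2 \<and> y < 2) \<or> (lab_flip c x y T \<and> x \<in> {2, 3} \<and> y \<in> {2, 3}) \<or>
    (lab_word c x y T \<and> x \<ge> 6 \<and> y \<ge> 6)"
proof -
  have "lab_start c x y T \<Longrightarrow> x < 2 \<and> y < 2" by (simp add: lab_start_def)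
  moreover have "lab_flip c x y T \<Longrightarrow> x \<in> {2, 3} \<and> y \<in> {2, 3}" by (simp add: lab_flip_def)
  moreover have "mv a u v \<Longrightarrow> u \<ge> 6 \<and> v \<ge> 6" for a u v by (auto simp: mv_def vx_def)
  then have "lab_word c x y T \<Longrightarrow> x \<ge> 6 \<and> y \<ge> 6" unfolding lab_word_def mvdir_def by metis
  ultimately show ?thesis using assms unfolding lab_def by (elim disjE) simp_all
qed

text \<open>Rule views free two legs per edge, so the empty green label becomes a two-element red
  one. Back again, a two-element label inside the freed pair is the whole pair, and its complement
  is empty.\<close>

lemma start_compl: "lab_start c x y T \<Longrightarrow> T \<subseteq> S \<Longrightarrow> card S = 2 \<Longrightarrow> lab_start (\<not> c) x y (S - T)"
proof -
  assume a: "lab_start c x y T" "T \<subseteq> S" "card S = 2"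
  have "finite S" by (rule card_ge_0_finite) (simp add: a(3))
  then have "\<not> c \<Longrightarrow> T = S" using a card_subset_eq[of S T] by (simp add: lab_start_def)
  then show ?thesis using a by (cases c) (simp_all add: lab_start_def)
qed

lemma double_eq: "w < 2 \<Longrightarrow> w' < 2 \<Longrightarrow> 2 * a + w = 2 * a' + w' \<longleftrightarrow> a = a' \<and> w = (w'::nat)"
  by presburger

text \<open>In this component a colour carries only main or only intermediate letters. A singleton
  label inside the freed pair is therefore the leg of the kind that fits the colour, and its
  complement is the leg of the other kind.\<close>

lemma flip_compl:
  assumes "lab_flip c x y T" "T \<subseteq> {2 * a + w, 2 * n + w'}" "mn a" "\<not> mn n" "w < 2" "w' < 2"
  shows "x = 2 \<and> y = 3 \<and> (c \<and> Z a \<and> {2 * a + w, 2 * n + w'} - T = {2 * n + w'} \<or>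
    \<not> c \<and> Z n \<and> {2 * a + w, 2 * n + w'} - T = {2 * a + w})"
proof -
  from assms(1) obtain a' u where T: "x = 2" "y = 3" "u < 2" "mn a' = c" "Z a'" "T = {2 * a' + u}"
    by (auto simp: lab_flip_def)
  have "a \<noteq> n" using assms by auto
  then have ne: "2 * a + w \<noteq> 2 * n + w'" using double_eq[OF assms(5,6), of a n] by simp
  from assms(2) T have "2 * a' + u = 2 * a + w \<or> 2 * a' + u = 2 * n + w'" by auto
  then show ?thesis
  proof
    assume eq: "2 * a' + u = 2 * a + w"
    then have "a' = a" using double_eq[OF T(3) assms(5), of a' a] by simp
    with T assms(3) have "c" "Z a" by simp_all
    moreover have "{2 * a + w, 2 * n + w'} - T = {2 * n + w'}" unfolding T(6) eq using ne by auto
    ultimately show ?thesis using T(1,2) by blast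
  next
    assume eq: "2 * a' + u = 2 * n + w'"
    then have "a' = n" using double_eq[OF T(3) assms(6), of a' n] by simp
    with T assms(4) have "\<not> c" "Z n" by simp_all
    moreover have "{2 * a + w, 2 * n + w'} - T = {2 * a + w}" unfolding T(6) eq using ne by auto
    ultimately show ?thesis using T(1,2) by blast
  qed
qed

lemma word_compl:
  assumes "lab_word c x y T" "T \<subseteq> {2 * a + w, 2 * n + w'}" "mn a" "\<not> mn n" "w < 2" "w' < 2"
  shows "c \<and> mvdir w' n x y \<and> {2 * a + w, 2 * n + w'} - T = {2 * a + w} \<or>
    \<not> c \<and> mvdir w a x y \<and> {2 * a + w, 2 * n + w'} - T = {2 * n + w'}"
proof -
  from assms(1) obtain a' u where T: "mvdir u a' x y" "u < 2" "mn a' = (\<not> c)" "T = {2 * a' + u}"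
    by (auto simp: lab_word_def)
  have "a \<noteq> n" using assms by auto
  then have ne: "2 * a + w \<noteq> 2 * n + w'" using double_eq[OF assms(5,6), of a n] by simp
  from assms(2) T have "2 * a' + u = 2 * a + w \<or> 2 * a' + u = 2 * n + w'" by auto
  then show ?thesis
  proof
    assume eq: "2 * a' + u = 2 * a + w"
    then have "a' = a" "u = w" using double_eq[OF T(2) assms(5), of a' a] by simp_all
    with T assms(3) have "\<not> c" "mvdir w a x y" by simp_all
    moreover have "{2 * a + w, 2 * n + w'} - T = {2 * n + w'}" unfolding T(4) eq using ne by auto
    ultimately show ?thesis by blast
  next
    assume eq: "2 * a' + u = 2 * n + w'"
    then have "a' = n" "u = w'" using double_eq[OF T(2) assms(6), of a' n] by simp_all
    with T assms(4) have "c" "mvdir w' n x y" by simp_all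
    moreover have "{2 * a + w, 2 * n + w'} - T = {2 * a + w}" unfolding T(4) eq using ne by auto
    ultimately show ?thesis by blast
  qed
qed

lemma lab_flipI: "w < 2 \<Longrightarrow> mn a = c \<Longrightarrow> Z a \<Longrightarrow> lab c 2 3 {2 * a + w}"
  by (auto simp: lab_def lab_flip_def)

lemma lab_wordI: "w < 2 \<Longrightarrow> mn a = (\<not> c) \<Longrightarrow> mvdir w a x y \<Longrightarrow> lab c x y {2 * a + w}"
  by (auto simp: lab_def lab_word_def)

text \<open>The two edges share the middle vertex and hence lie in one component. In the start
  component and on the colour-exchanged edge all vertices stay in place; among the quotients a new
  middle vertex is chosen, and for a tail rule a new far end as well.\<close>

lemma rule_transfer:
  assumes r: "(a, b, n, m) \<in> rules e" and z: "z < 2"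
    and w: "w = (if a = b then z else 1 - z)"
    and l0: "lab c (vs (esrc z 0)) (vs (etgt z 0)) T0" "T0 \<subseteq> {2 * a + z, 2 * n + z}"
    and l1: "lab c (vs (esrc z 1)) (vs (etgt z 1)) T1" "T1 \<subseteq> {2 * b + w, 2 * m + (1 - z)}"
  shows "\<exists>vs'. lab (\<not> c) (vs' (esrc z 0)) (vs' (etgt z 0)) ({2 * a + z, 2 * n + z} - T0) \<and>
     lab (\<not> c) (vs' (esrc z 1)) (vs' (etgt z 1)) ({2 * b + w, 2 * m + (1 - z)} - T1) \<and>
     vs' 0 = vs 0 \<and> (a \<noteq> b \<longrightarrow> vs' 2 = vs 2)"
proof -
  note p = rl[OF r]
  have w2: "w < 2" "1 - z < 2" using z w by auto
  have ix: "z = 0 \<and> esrc z 0 = 0 \<and> etgt z 0 = 1 \<and> esrc z 1 = 2 \<and> etgt z 1 = 1 \<or>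
      z = 1 \<and> esrc z 0 = 1 \<and> etgt z 0 = 0 \<and> esrc z 1 = 1 \<and> etgt z 1 = 2"
    using z by (auto simp: esrc_def etgt_def less_2_cases_iff)
  have cd: "card {2 * a + z, 2 * n + z} = 2" "card {2 * b + w, 2 * m + (1 - z)} = 2"
  proof -
    have "a \<noteq> n" "b \<noteq> m" using p by auto
    then have "2 * a + z \<noteq> 2 * n + z" "2 * b + w \<noteq> 2 * m + (1 - z)"
      using double_eq[OF w2] by auto
    then show "card {2 * a + z, 2 * n + z} = 2" "card {2 * b + w, 2 * m + (1 - z)} = 2" by auto
  qed
  note c0 = lab_cases[OF l0(1)] and c1 = lab_cases[OF l1(1)]
  have same: "(vs 1 < 2 \<and> lab_start c (vs (esrc z 0)) (vs (etgt z 0)) T0 \<and> lab_start c (vs (esrc z 1)) (vs (etgt z 1)) T1) \<or>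
    (lab_flip c (vs (esrc z 0)) (vs (etgt z 0)) T0 \<and> lab_flip c (vs (esrc z 1)) (vs (etgt z 1)) T1) \<or>
    (lab_word c (vs (esrc z 0)) (vs (etgt z 0)) T0 \<and> lab_word c (vs (esrc z 1)) (vs (etgt z 1)) T1)"
    using c0 c1 ix by auto
  then show ?thesis
  proof (elim disjE conjE)
    assume "lab_start c (vs (esrc z 0)) (vs (etgt z 0)) T0" "lab_start c (vs (esrc z 1)) (vs (etgt z 1)) T1"
    from start_compl[OF this(1) l0(2) cd(1)] start_compl[OF this(2) l1(2) cd(2)]
    show ?thesis by (intro exI[of _ vs]) (simp add: lab_def)
  next
    assume f: "lab_flip c (vs (esrc z 0)) (vs (etgt z 0)) T0" "lab_flip c (vs (esrc z 1)) (vs (etgt z 1)) T1"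
    have pp: "mn a" "mn b" "\<not> mn n" "\<not> mn m" using p by auto
    note f0 = flip_compl[OF f(1) l0(2) pp(1,3) z z] and f1 = flip_compl[OF f(2) l1(2) pp(2,4) w2]
    show ?thesis
    proof (cases c)
      case True
      then have "Z n" "Z m" using f0 f1 Zpair[OF r] by auto
      then have "lab False 2 3 {2 * n + z}" "lab False 2 3 {2 * m + (1 - z)}" using pp z w2 by (intro lab_flipI; simp)+
      then show ?thesis using f0 f1 True by (intro exI[of _ vs]) simp
    next
      case False
      then have "Z a" "Z b" using f0 f1 Zpair[OF r] by auto
      then have "lab True 2 3 {2 * a + z}" "lab True 2 3 {2 * b + w}" using pp z w2 by (intro lab_flipI; simp)+
      then show ?thesis using f0 f1 False by (intro exI[of _ vs]) simp
    qed
  next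
    assume f: "lab_word c (vs (esrc z 0)) (vs (etgt z 0)) T0" "lab_word c (vs (esrc z 1)) (vs (etgt z 1)) T1"
    have pp: "mn a" "mn b" "\<not> mn n" "\<not> mn m" using p by auto
    note f0 = word_compl[OF f(1) l0(2) pp(1,3) z z] and f1 = word_compl[OF f(2) l1(2) pp(2,4) w2]
    have e0: "mvdir z q (vs' (esrc z 0)) (vs' (etgt z 0)) \<longleftrightarrow> mv q (vs' 0) (vs' 1)" for q vs'
      using ix by (auto simp: mvdir_def)
    have e1: "mvdir (1 - z) q (vs' (esrc z 1)) (vs' (etgt z 1)) \<longleftrightarrow> mv q (vs' 1) (vs' 2)" for q vs'
      using ix by (auto simp: mvdir_def)
    \<comment> \<open>For a tail rule the second edge carries the parity of the first, so it is read
      backwards, from vertex 2 to vertex 1.\<close>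
    have e2: "mvdir z q (vs' (esrc z 1)) (vs' (etgt z 1)) \<longleftrightarrow> mv q (vs' 2) (vs' 1)" for q vs'
      using ix by (auto simp: mvdir_def)
    show ?thesis
    proof (cases c)
      case True
      then have g: "mv n (vs 0) (vs 1)" "mv m (vs 1) (vs 2)"
        and I: "{2 * a + z, 2 * n + z} - T0 = {2 * a + z}" "{2 * b + w, 2 * m + (1 - z)} - T1 = {2 * b + w}"
        using f0 f1 e0[of _ vs] e1[of _ vs] by auto
      have "\<exists>vs'. mvdir z a (vs' (esrc z 0)) (vs' (etgt z 0)) \<and> mvdir w b (vs' (esrc z 1)) (vs' (etgt z 1))
          \<and> vs' 0 = vs 0 \<and> (a \<noteq> b \<longrightarrow> vs' 2 = vs 2)"
      proof (cases "a = b")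
        case True
        from g have "\<exists>u. mv a (vs 0) u" using mv_tail[OF r[folded True]] by blast
        then obtain u where u: "mv a (vs 0) u" by (elim exE)
        have wz: "w = z" using w True by simp
        show ?thesis unfolding wz e0 e2
          by (rule exI[of _ "\<lambda>i. if i = 1 then u else vs 0"]) (use u True in simp)
      next
        case False
        from g have "\<exists>u. mv a (vs 0) u \<and> mv b u (vs 2)" using mv_rule[OF r False] by blast
        then obtain u where u: "mv a (vs 0) u" "mv b u (vs 2)" by (elim exE conjE)
        have wz: "w = 1 - z" using w False by simp
        show ?thesis unfolding wz e0 e1
          by (rule exI[of _ "\<lambda>i. if i = 1 then u else vs i"]) (use u in simp)
      qed
      then obtain vs' where v: "mvdir z a (vs' (esrc z 0)) (vs' (etgt z 0))" "mvdir w b (vs' (esrc z 1)) (vs' (etgt z 1))"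
        "vs' 0 = vs 0 \<and> (a \<noteq> b \<longrightarrow> vs' 2 = vs 2)" by (elim exE conjE) simp
      show ?thesis unfolding I
        by (rule exI[of _ vs'], intro conjI lab_wordI v z w2) (use pp True v(3) in simp_all)
    next
      case False
      then have g: "mv a (vs 0) (vs 1)" "mvdir w b (vs (esrc z 1)) (vs (etgt z 1))"
        and I: "{2 * a + z, 2 * n + z} - T0 = {2 * n + z}" "{2 * b + w, 2 * m + (1 - z)} - T1 = {2 * m + (1 - z)}"
        using f0 f1 e0[of _ vs] by auto
      have "\<exists>vs'. mvdir z n (vs' (esrc z 0)) (vs' (etgt z 0)) \<and> mvdir (1 - z) m (vs' (esrc z 1)) (vs' (etgt z 1))
          \<and> vs' 0 = vs 0 \<and> (a \<noteq> b \<longrightarrow> vs' 2 = vs 2)"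
      proof (cases "a = b")
        case True
        from g(1) have "\<exists>u y. mv n (vs 0) u \<and> mv m u y" using mv_tail[OF r[folded True]] by blast
        then obtain u y where u: "mv n (vs 0) u" "mv m u y" by (elim exE conjE)
        show ?thesis unfolding e0 e1
          by (rule exI[of _ "\<lambda>i. if i = 0 then vs 0 else if i = 1 then u else y"]) (use u True in simp)
      next
        case False
        have wz: "w = 1 - z" using w False by simp
        from g have "mv b (vs 1) (vs 2)" unfolding wz e1 by simp
        with g(1) have "\<exists>u. mv n (vs 0) u \<and> mv m u (vs 2)" using mv_rule[OF r False] by blast
        then obtain u where u: "mv n (vs 0) u" "mv m u (vs 2)" by (elim exE conjE)
        show ?thesis unfolding e0 e1
          by (rule exI[of _ "\<lambda>i. if i = 1 then u else vs i"]) (use u in simp)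
      qed
      then obtain vs' where v: "mvdir z n (vs' (esrc z 0)) (vs' (etgt z 0))" "mvdir (1 - z) m (vs' (esrc z 1)) (vs' (etgt z 1))"
        "vs' 0 = vs 0 \<and> (a \<noteq> b \<longrightarrow> vs' 2 = vs 2)" by (elim exE conjE) simp
      show ?thesis unfolding I
        by (rule exI[of _ vs'], intro conjI lab_wordI v z w2) (use pp False v(3) in simp_all)
    qed
  qed
qed

lemma rule_query_view:
  assumes r: "(a, b, n, m) \<in> rules e" and z: "z < 2"
  shows "view (rule_query N z a b n m) dom (model c) f \<subseteq> view (rule_query N z a b n m) dom (model (\<not> c)) f"
proof -
  note p = rl[OF r]
  define w where "w = (if a = b then z else 1 - z)"
  let ?I = "\<lambda>(i::nat) j. if i = 0 then j = leg z 0 a \<or> j = leg z 0 n else j = leg2 z a b \<or> j = leg z 1 m"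
  have lg: "leg z 0 a = 2 * a + z" "leg z 0 n = 2 * n + z" "leg2 z a b = 2 * b + w" "leg z 1 m = 2 * m + (1 - z)"
    using z by (auto simp: leg_def leg2_def w_def less_2_cases_iff)
  have w2: "w < 2" using z by (auto simp: w_def)
  have less: "2 * a + z < N" "2 * n + z < N" "2 * b + w < N" "2 * m + (1 - z) < N"
    using p z w2 by (auto simp: legs_def)
  have I0: "{j. j < N \<and> ?I 0 j} = {2 * a + z, 2 * n + z}"
    using less unfolding lg by auto
  have I1: "{j. j < N \<and> ?I 1 j} = {2 * b + w, 2 * m + (1 - z)}"
    using less unfolding lg by auto
  have odd: "kvar M i j \<noteq> 0" "kvar M i j \<noteq> 4" for M i j
    using kvar_odd[of M i j 0] kvar_odd[of M i j 2] by auto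
  show ?thesis unfolding rule_query_def
  proof (rule view_sub, goal_cases)
    case (1 i j)
    have "kvar N i j \<in> {kvar N 0 (2 * a + z), kvar N 0 (2 * n + z),
        kvar N 1 (2 * b + w), kvar N 1 (2 * m + (1 - z))}"
      using 1(2) odd[of "N" i j] unfolding lg by (cases "a = b") simp_all
    then have ij: "i = 0 \<and> j = 2 * a + z \<or> i = 0 \<and> j = 2 * n + z \<or> i = 1 \<and> j = 2 * b + w \<or> i = 1 \<and> j = 2 * m + (1 - z)"
      using kvar_inj[OF 1(1) less_imp_le[OF less(1)], of i 0] kvar_inj[OF 1(1) less_imp_le[OF less(2)], of i 0]
        kvar_inj[OF 1(1) less_imp_le[OF less(3)], of i 1] kvar_inj[OF 1(1) less_imp_le[OF less(4)], of i 1] by simp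
    have "j < N" using ij less by (elim disjE conjE) (simp_all only:)
    moreover have i2: "i = 0 \<or> i = 1" using ij by blast
    then have "i < 2" by (elim disjE) (simp_all only: zero_less_numeral one_less_numeral_iff semiring_norm)
    moreover have "?I i j"
    proof (cases "i = 0")
      case True
      have "j = 2 * a + z \<or> j = 2 * n + z" using ij unfolding True by (simp only: zero_neq_one simp_thms)
      then show ?thesis unfolding lg True by (simp only: if_True simp_thms)
    next
      case False
      then have "j = 2 * b + w \<or> j = 2 * m + (1 - z)" using ij by (simp only: simp_thms) blast
      then show ?thesis unfolding lg using False by (simp only: if_False simp_thms)
    qed
    ultimately show ?case by (intro conjI)
  next
    case (2 vs T)
    have "{j. j < N \<and> ?I 0 j} = {2 * a + z, 2 * n + z}" by (rule I0)
    with 2[of 0] have "lab c (vs (esrc z 0)) (vs (etgt z 0)) (T 0)" "T 0 \<subseteq> {2 * a + z, 2 * n + z}" by simp_all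
    moreover have "lab c (vs (esrc z 1)) (vs (etgt z 1)) (T 1)" "T 1 \<subseteq> {2 * b + w, 2 * m + (1 - z)}"
      using 2[of 1] I1 by simp_all
    ultimately have "\<exists>vs'. lab (\<not> c) (vs' (esrc z 0)) (vs' (etgt z 0)) ({2 * a + z, 2 * n + z} - T 0) \<and>
     lab (\<not> c) (vs' (esrc z 1)) (vs' (etgt z 1)) ({2 * b + w, 2 * m + (1 - z)} - T 1) \<and>
     vs' 0 = vs 0 \<and> (a \<noteq> b \<longrightarrow> vs' 2 = vs 2)"
      by (intro rule_transfer[OF r z w_def])
    then obtain vs' where v: "lab (\<not> c) (vs' (esrc z 0)) (vs' (etgt z 0)) ({2 * a + z, 2 * n + z} - T 0)"
     "lab (\<not> c) (vs' (esrc z 1)) (vs' (etgt z 1)) ({2 * b + w, 2 * m + (1 - z)} - T 1)"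
     "vs' 0 = vs 0" "a \<noteq> b \<longrightarrow> vs' 2 = vs 2" by (elim exE conjE)
    have "lab (\<not> c) (vs' (esrc z i)) (vs' (etgt z i)) ({j. j < N \<and> ?I i j} - T i)" if "i < 2" for i
    proof -
      from that have "i = 0 \<or> i = 1" by auto
      then show ?thesis
      proof
        assume i: "i = 0" show ?thesis unfolding i I0 by (rule v(1))
      next
        assume i: "i = 1" show ?thesis unfolding i I1 by (rule v(2))
      qed
    qed
    moreover have "vs' v = vs v" if "2 * v \<in> set ((if a = b then [0] else [0, 4]) @ [kvar N 0 (leg z 0 a), kvar N 0 (leg z 0 n), kvar N 1 (leg2 z a b), kvar N 1 (leg z 1 m)])" for v
    proof -
      have "2 * v \<noteq> kvar M i j" for M i j using kvar_odd[of M i j v] by (rule not_sym)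
      then have "2 * v \<in> set (if a = b then [0] else [0, 4])"
        using that by (simp only: set_append Un_iff list.set insert_iff empty_iff simp_thms)
      then have "v = 0 \<or> a \<noteq> b \<and> v = 2" by (cases "a = b") auto
      then show ?thesis using v(3,4) by blast
    qed
    ultimately show ?case by (intro exI[of _ vs']) simp
  qed
qed

lemma word_query_view:
  assumes less: "\<And>i. i < p \<Longrightarrow> 2 * w i + 1 < N"
    and ex: "\<And>vs T. (\<And>i. i < p \<Longrightarrow> lab c (vs (esrc 0 i)) (vs (etgt 0 i)) (T i) \<and> T i \<subseteq> {leg 0 i (w i)}) \<Longrightarrow>
      \<exists>vs'. \<forall>i<p. lab (\<not> c) (vs' (esrc 0 i)) (vs' (etgt 0 i)) ({leg 0 i (w i)} - T i)"
  shows "view (word_query N p w) dom (model c) f \<subseteq> view (word_query N p w) dom (model (\<not> c)) f"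
  unfolding word_query_def
proof (rule view_sub, goal_cases)
  have lg: "leg 0 i (w i) < N" if "i < p" for i using less[OF that] by (auto simp: leg_def)
  {
    case (1 i j)
    then obtain i' where i: "i' < p" "kvar N i j = kvar N i' (leg 0 i' (w i'))" by auto
    then have "i = i' \<and> j = leg 0 i' (w i')" using kvar_inj[OF 1(1) less_imp_le[OF lg[OF i(1)]]] by simp
    then show ?case using i lg by simp
  next
    case (2 vs T)
    have I: "{j. j < N \<and> j = leg 0 i (w i)} = {leg 0 i (w i)}" if "i < p" for i
      using lg[OF that] by auto
    have "\<exists>vs'. \<forall>i<p. lab (\<not> c) (vs' (esrc 0 i)) (vs' (etgt 0 i)) ({leg 0 i (w i)} - T i)"
      by (rule ex[of vs]) (use 2 I in simp)
    then obtain vs' where v: "\<forall>i<p. lab (\<not> c) (vs' (esrc 0 i)) (vs' (etgt 0 i)) ({leg 0 i (w i)} - T i)" by (elim exE)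
    have "kvar M i j \<noteq> 2 * v" for M i j v by (rule kvar_odd)
    then have "2 * v \<notin> set (map (\<lambda>e'. kvar N e' (leg 0 e' (w e'))) [0..<p])" for v
      by (auto simp: eq_commute[of "2 * v"])
    then show ?case using v I by (intro exI[of _ vs']) simp
  }
qed

lemma lab_single_green:
  assumes "lab True x y T" "T \<subseteq> {2 * a + w}" "w < 2"
  shows "(T = {} \<and> x < 2 \<and> y < 2) \<or> (mn a \<and> Z a \<and> x \<in> {2, 3} \<and> y \<in> {2, 3}) \<or> (\<not> mn a \<and> mvdir w a x y \<and> x \<ge> 6 \<and> y \<ge> 6)"
  using lab_cases[OF assms(1)]
proof (elim disjE conjE)
  assume "lab_flip True x y T" "x \<in> {2, 3}" "y \<in> {2, 3}"
  then obtain a' u where T: "u < 2" "mn a'" "Z a'" "T = {2 * a' + u}" by (auto simp: lab_flip_def)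
  then have "a' = a" using assms(2) double_eq[OF T(1) assms(3), of a' a] by simp
  then show ?thesis using T \<open>x \<in> {2, 3}\<close> \<open>y \<in> {2, 3}\<close> by simp
next
  assume "lab_word True x y T" "x \<ge> 6" "y \<ge> 6"
  then obtain a' u where T: "u < 2" "\<not> mn a'" "mvdir u a' x y" "T = {2 * a' + u}" by (auto simp: lab_word_def)
  then have "a' = a" "u = w" using assms(2) double_eq[OF T(1) assms(3), of a' a] by simp_all
  then show ?thesis using T \<open>x \<ge> 6\<close> \<open>y \<ge> 6\<close> by simp
qed (simp add: lab_start_def)

text \<open>Red labels have one or two elements in every component. The emptiness excluded here is
  also what makes the goal query fail in red.\<close>

lemma lab_single_red:
  assumes "lab False x y T" "T \<subseteq> {l}"
  shows "T = {l}"
proof -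
  have "T \<noteq> {}" using assms(1) by (auto simp: lab_def lab_start_def lab_flip_def lab_word_def)
  then show ?thesis using assms(2) by blast
qed

text \<open>Each red label exhausts its only freed leg, so green has to answer with empty labels;
  the start edge does this for all positions at once, the path being folded onto it by
  parity.\<close>

lemma red_word_query_view:
  assumes less: "\<And>i. i < p \<Longrightarrow> 2 * w i + 1 < N"
  shows "view (word_query N p w) dom (model False) f \<subseteq> view (word_query N p w) dom (model True) f"
proof -
  have "view (word_query N p w) dom (model False) f \<subseteq> view (word_query N p w) dom (model (\<not> False)) f"
  proof (rule word_query_view[OF less])
    fix vs :: "nat \<Rightarrow> nat" and T
    assume a: "\<And>i. i < p \<Longrightarrow> lab False (vs (esrc 0 i)) (vs (etgt 0 i)) (T i) \<and> T i \<subseteq> {leg 0 i (w i)}"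
    have T: "T i = {leg 0 i (w i)}" if "i < p" for i
      by (rule lab_single_red[OF a[OF that, THEN conjunct1] a[OF that, THEN conjunct2]])
    have "lab True (esrc 0 i mod 2) (etgt 0 i mod 2) {}" for i
      by (auto simp: lab_def lab_start_def esrc_def etgt_def mod_2_eq_odd)
    then show "\<exists>vs'. \<forall>i<p. lab (\<not> False) (vs' (esrc 0 i)) (vs' (etgt 0 i)) ({leg 0 i (w i)} - T i)"
      using T by (intro exI[of _ "\<lambda>v. v mod 2"]) simp
  qed
  then show ?thesis by simp
qed

text \<open>The right end 2 is excluded from \<open>Z\<close>, so the last edge of a green match
  lies on the start edge, and connectedness forces all other edges there. Red answers with the path
  through the quotients by the prefixes of the start word.\<close>

lemma start_query_view:
  "view (word_query N (e + 3) (start_letter e)) dom (model True) f \<subseteq>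
   view (word_query N (e + 3) (start_letter e)) dom (model False) f"
proof -
  let ?p = "e + 3" and ?w = "start_letter e"
  have sl: "mn (?w i)" "?w i < 6" for i using fixed by (auto simp: start_letter_def)
  have "view (word_query N ?p ?w) dom (model True) f \<subseteq> view (word_query N ?p ?w) dom (model (\<not> True)) f"
  proof (rule word_query_view)
    show "2 * ?w i + 1 < N" for i using sl(2)[of i] by (simp add: legs_def)
    fix vs :: "nat \<Rightarrow> nat" and T
    assume a: "\<And>i. i < ?p \<Longrightarrow> lab True (vs (esrc 0 i)) (vs (etgt 0 i)) (T i) \<and> T i \<subseteq> {leg 0 i (?w i)}"
    have c: "(T i = {} \<and> vs i < 2 \<and> vs (Suc i) < 2) \<or> (Z (?w i) \<and> vs i \<in> {2, 3} \<and> vs (Suc i) \<in> {2, 3})" if "i < ?p" for i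
    proof -
      have "(esrc 0 i = i \<and> etgt 0 i = Suc i) \<or> (esrc 0 i = Suc i \<and> etgt 0 i = i)"
        by (auto simp: esrc_def etgt_def mod_2_eq_odd)
      moreover have "T i \<subseteq> {2 * ?w i + i mod 2}" using a[OF that] by (simp add: leg_def)
      ultimately show ?thesis
        using lab_single_green[OF a[OF that, THEN conjunct1], of "?w i" "i mod 2"] sl(1)[of i] by auto
    qed
    \<comment> \<open>The induction walks back from the last edge, number e + 2; neighbouring edges
      share a vertex.\<close>
    have "T (e + 2 - d) = {} \<and> vs (e + 2 - d) < 2" if "d \<le> e + 2" for d
      using that
    proof (induction d)
      case 0
      have "\<not> Z (?w (e + 2))" using Zfixed by (simp add: start_letter_def)
      then show ?case using c[of "e + 2"] by auto
    next
      case (Suc d)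
      have "Suc (e + 2 - Suc d) = e + 2 - d" using Suc.prems by simp
      then show ?case using c[of "e + 2 - Suc d"] Suc by auto
    qed
    note T0 = this
    have T: "T i = {}" if "i < ?p" for i using T0[of "e + 2 - i"] that by simp
    let ?s = "map ?w [0..<?p]"
    have tk: "take (Suc i) ?s = take i ?s @ [?w i]" if "i < ?p" for i
      using that by (subst take_Suc_conv_app_nth) auto
    have R: "res (take i ?s) \<in> Res" for i
      using startW append_take_drop_id[of i ?s] by (auto simp: Res_def res_def simp del: append_take_drop_id) metis
    have "mv (?w i) (vx (res (take i ?s))) (vx (res (take (Suc i) ?s)))" if "i < ?p" for i
      unfolding mv_def using R[of i] R[of "Suc i"] unfolding tk[OF that] der_res[symmetric] by blast
    then have "mvdir (i mod 2) (?w i) (vx (res (take (esrc 0 i) ?s))) (vx (res (take (etgt 0 i) ?s)))" if "i < ?p" for i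
      using that by (auto simp: mvdir_def esrc_def etgt_def mod_2_eq_odd)
    then have "lab False (vx (res (take (esrc 0 i) ?s))) (vx (res (take (etgt 0 i) ?s))) {leg 0 i (?w i)}" if "i < ?p" for i
      using lab_wordI[of "i mod 2" "?w i" False] sl(1) that by (simp add: leg_def)
    then show "\<exists>vs'. \<forall>i<?p. lab (\<not> True) (vs' (esrc 0 i)) (vs' (etgt 0 i)) ({leg 0 i (?w i)} - T i)"
      using T by (intro exI[of _ "\<lambda>v. vx (res (take v ?s))"]) simp
  qed
  then show ?thesis by simp
qed

text \<open>In green the colour-exchanged edge carries only main letters, and a match among the
  quotients would exhibit the alarm inside a word of \<open>W\<close>. What remains is the start
  edge, answered by the red colour-exchanged edge with vertex 1 placed at 3 and the others at
  2.\<close>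

lemma alarm_query_view:
  "view (word_query N 2 (\<lambda>i. 3 + i)) dom (model True) f \<subseteq> view (word_query N 2 (\<lambda>i. 3 + i)) dom (model False) f"
proof -
  have "view (word_query N 2 (\<lambda>i. 3 + i)) dom (model True) f \<subseteq> view (word_query N 2 (\<lambda>i. 3 + i)) dom (model (\<not> True)) f"
  proof (rule word_query_view)
    show "2 * (3 + i) + 1 < N" if "i < 2" for i using that by (simp add: legs_def)
    fix vs :: "nat \<Rightarrow> nat" and T
    assume a: "\<And>i. i < 2 \<Longrightarrow> lab True (vs (esrc 0 i)) (vs (etgt 0 i)) (T i) \<and> T i \<subseteq> {leg 0 i (3 + i)}"
    have a0: "lab True (vs 0) (vs 1) (T 0)" "T 0 \<subseteq> {2 * 3 + 0}" using a[of 0] by (simp_all add: esrc_def etgt_def leg_def)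
    have a1: "lab True (vs 2) (vs 1) (T 1)" "T 1 \<subseteq> {2 * 4 + 1}" using a[of 1] by (simp_all add: esrc_def etgt_def leg_def numeral_2_eq_2)
    have c0: "(T 0 = {} \<and> vs 1 < 2) \<or> (mv 3 (vs 0) (vs 1) \<and> vs 1 \<ge> 6)"
      using lab_single_green[OF a0] fixed by (auto simp: mvdir_def)
    have c1: "(T 1 = {} \<and> vs 1 < 2) \<or> (mv 4 (vs 1) (vs 2) \<and> vs 1 \<ge> 6)"
      using lab_single_green[OF a1] fixed by (auto simp: mvdir_def)
    have T: "T 0 = {}" "T 1 = {}" using c0 c1 mv_alarm by auto
    have l: "lab False 2 3 {2 * 3 + 0}" "lab False 2 3 {2 * 4 + 1}" by (rule lab_flipI; use fixed Zfixed in simp)+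
    have "lab False ((\<lambda>v. if v = 1 then 3 else 2) (esrc 0 i)) ((\<lambda>v. if v = 1 then 3 else 2) (etgt 0 i)) ({leg 0 i (3 + i)} - T i)" if "i < 2" for i
    proof -
      from that have "i = 0 \<or> i = 1" by auto
      then show ?thesis
      proof
        assume i: "i = 0" show ?thesis unfolding i T using l(1) by (simp add: esrc_def etgt_def leg_def)
      next
        assume i: "i = 1" show ?thesis unfolding i T using l(2) by (simp add: esrc_def etgt_def leg_def)
      qed
    qed
    then show "\<exists>vs'. \<forall>i<2. lab (\<not> True) (vs' (esrc 0 i)) (vs' (etgt 0 i)) ({leg 0 i (3 + i)} - T i)"
      by (intro exI[of _ "\<lambda>v. if v = 1 then 3 else 2"]) simp
  qed
  then show ?thesis by simp
qed

lemma not_fin_determines: "\<not> fin_determines (sig N) (queries e) (goal_query N)"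
proof
  assume det: "fin_determines (sig N) (queries e) (goal_query N)"
  let ?f = "\<lambda>_. 0 :: nat"
  have "view Q dom (model True) ?f = view Q dom (model False) ?f" if "Q \<in> set (queries e)" for Q
    using that
  proof (cases rule: queries_cases)
    case 1
    have "2 * start_letter e i + 1 < N" for i by (auto simp: legs_def start_letter_def)
    then show ?thesis unfolding 1 by (intro equalityI start_query_view red_word_query_view)
  next
    case 2
    show ?thesis unfolding 2
      by (intro equalityI alarm_query_view red_word_query_view) (simp add: legs_def)
  next
    case 3
    then show ?thesis by (simp add: view_def body_vars_def)
  next
    case (4 z a b n m)
    show ?thesis unfolding 4(3)
      using rule_query_view[OF 4(1,2), of True ?f] rule_query_view[OF 4(1,2), of False ?f] by simp
  qed
  then have eq: "view (goal_query N) dom (model True) ?f = view (goal_query N) dom (model False) ?f"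
    using det model_structure[of True ?f] model_structure[of False ?f] unfolding fin_determines_def by blast
  have green: "full_edge N (model True) 0 1"
    unfolding full_edge_def
  proof (intro exI[of _ "\<lambda>_. 4"] conjI)
    have "lab True 0 1 {j. j < N \<and> (4::nat) = knee (\<not> True)}" by (simp add: lab_def lab_start_def knee_def)
    then show "0 # 1 # map (\<lambda>_. 4) [0..<N] \<in> model True 0" unfolding model_def by auto
  qed (simp add: model_def knee_def)
  have red: "\<not> full_edge N (model False) x y" for x y
  proof
    assume "full_edge N (model False) x y"
    then obtain \<kappa> where k: "x # y # map \<kappa> [0..<N] \<in> model False 0" "\<And>j. j < N \<Longrightarrow> [\<kappa> j] \<in> model False 1"
      unfolding full_edge_def by auto
    from k(2) have k5: "\<kappa> j = 5" if "j < N" for j using that by (simp add: model_def knee_def)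
    from k(1) obtain \<kappa>' where k': "map \<kappa> [0..<N] = map \<kappa>' [0..<N]" "lab False x y {j. j < N \<and> \<kappa>' j = knee (\<not> False)}"
      unfolding model_def by auto
    have "\<kappa>' j = 5" if "j < N" for j using k'(1) k5[OF that] that by auto
    then have "{j. j < N \<and> \<kappa>' j = knee (\<not> False)} = {}" by (auto simp: knee_def)
    from k'(2)[unfolded this] have "lab False x y {}" .
    then show False using lab_single_red[of x y "{}" 0] by auto
  qed
  have ex: "\<exists>x y. full_edge N (model True) x y" using green by (intro exI)
  have nex: "\<not> (\<exists>x y. full_edge N (model False) x y)" using red by simp
  have "view (goal_query N) dom (model True) ?f = {[]}"
    unfolding goal_view[OF model_structure] by (rule if_P[OF ex])
  moreover have "view (goal_query N) dom (model False) ?f = {}"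
    unfolding goal_view[OF model_structure] by (rule if_not_P[OF nex])
  ultimately show False using eq by simp
qed

end

section \<open>The instances are computable\<close>

lemma enc_term_Var: "enc_term (Var v) = 2 * v"
  by (simp add: sum_encode_def)

lemma is_rec_esrc: "is_rec n z \<Longrightarrow> is_rec n i \<Longrightarrow> is_rec n (\<lambda>xs. esrc (z xs) (i xs))"
  unfolding esrc_def by (intro is_rec_add is_rec_mod is_rec_const) auto

lemma is_rec_etgt: "is_rec n z \<Longrightarrow> is_rec n i \<Longrightarrow> is_rec n (\<lambda>xs. etgt (z xs) (i xs))"
  unfolding etgt_def by (intro is_rec_add is_rec_mod is_rec_const) auto

lemma is_rec_kvar: "is_rec n N \<Longrightarrow> is_rec n i \<Longrightarrow> is_rec n j \<Longrightarrow> is_rec n (\<lambda>xs. kvar (N xs) (i xs) (j xs))"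
  unfolding kvar_def by (intro is_rec_add is_rec_mult is_rec_const is_rec_Suc)

lemma is_rec_leg: "is_rec n z \<Longrightarrow> is_rec n i \<Longrightarrow> is_rec n a \<Longrightarrow> is_rec n (\<lambda>xs. leg (z xs) (i xs) (a xs))"
  unfolding leg_def by (intro is_rec_add is_rec_mult is_rec_mod is_rec_const) auto

lemma is_rec_leg2: "is_rec n z \<Longrightarrow> is_rec n a \<Longrightarrow> is_rec n b \<Longrightarrow> is_rec n (\<lambda>xs. leg2 (z xs) (a xs) (b xs))"
  unfolding leg2_def by (intro is_rec_if_eq is_rec_leg is_rec_const)

lemma is_rec_H_atom:
  assumes "is_rec n N" "is_rec n z" "is_rec n i"
  shows "is_rec n (\<lambda>xs. enc_atom (H_atom (N xs) (z xs) (i xs)))"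
proof -
  have eq: "enc_atom (H_atom N z i) = prod_encode (0, list_encode
      (2 * (2 * esrc z i) # 2 * (2 * etgt z i) # map (\<lambda>j. 2 * kvar N i j) [0..<N]))" for N z i
    by (simp add: enc_atom_def H_atom_def enc_term_Var comp_def del: enc_term.simps list_encode.simps)
  show ?thesis unfolding eq
    by (intro is_rec_prod_encode is_rec_const is_rec_list(2-4) is_rec_mult is_rec_esrc is_rec_etgt assms
        is_rec_kvar is_rec_weaken[OF assms(1)] is_rec_weaken[OF assms(3)] is_rec_vars)
qed

lemma is_rec_C_atom:
  assumes "is_rec n N" "is_rec n i" "is_rec n j"
  shows "is_rec n (\<lambda>xs. enc_atom (C_atom (N xs) (i xs) (j xs)))"
proof -
  have eq: "enc_atom (C_atom N i j) = prod_encode (1, list_encode [2 * kvar N i j])" for N i j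
    by (simp add: enc_atom_def C_atom_def enc_term_Var del: enc_term.simps list_encode.simps)
  show ?thesis unfolding eq
    by (intro is_rec_prod_encode is_rec_const is_rec_list(3,4) is_rec_mult is_rec_kvar assms)
qed

text \<open>The set of freed legs enters through a recursive function with value 0 on them, so the
  choice between the atoms is a case distinction on a number.\<close>

lemma is_rec_path_query:
  assumes fr: "is_rec n (\<lambda>xs. list_encode (fr xs))" and N: "is_rec n N" and z: "is_rec n z" and p: "is_rec n p"
    and J: "is_rec (Suc n) (\<lambda>xs. if I (hd xs div Suc (N (tl xs))) (hd xs mod Suc (N (tl xs))) (tl xs) then 0 else 1)"
  shows "is_rec n (\<lambda>xs. enc_cq (fr xs, path_body (N xs) (z xs) (p xs) (\<lambda>i j. I i j xs)))"
proof -
  let ?F = "\<lambda>k xs. if (if I (k div Suc (N xs)) (k mod Suc (N xs)) xs then 0 else 1 :: nat) = 0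
        then enc_atom (H_atom (N xs) (z xs) (k div Suc (N xs)))
        else if k mod Suc (N xs) = N xs then enc_atom (H_atom (N xs) (z xs) (k div Suc (N xs)))
          else enc_atom (C_atom (N xs) (k div Suc (N xs)) (k mod Suc (N xs)))"
  have eq: "enc_cq (fr xs, path_body (N xs) (z xs) (p xs) (\<lambda>i j. I i j xs)) =
    prod_encode (list_encode (fr xs), list_encode (map (\<lambda>k. ?F k xs) [0..<p xs * Suc (N xs)]))" for xs
    unfolding enc_cq_def path_body_def fst_conv snd_conv map_map
    by (intro arg_cong[where f = prod_encode] arg_cong2[where f = Pair] refl arg_cong[where f = list_encode] map_cong) auto
  have N': "is_rec (Suc n) (\<lambda>xs. N (tl xs))" by (rule is_rec_weaken[OF N])
  have d: "is_rec (Suc n) (\<lambda>xs. hd xs div Suc (N (tl xs)))" "is_rec (Suc n) (\<lambda>xs. hd xs mod Suc (N (tl xs)))"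
    by (intro is_rec_div is_rec_mod is_rec_vars is_rec_Suc N'; simp)+
  have "is_rec (Suc n) (\<lambda>xs. ?F (hd xs) (tl xs))"
    by (intro is_rec_if_zero[OF J] is_rec_if_eq is_rec_H_atom is_rec_C_atom N' d is_rec_weaken[OF z])
  then show ?thesis unfolding eq
    by (intro is_rec_prod_encode fr is_rec_list(2) is_rec_mult is_rec_Suc N p)
qed

lemma is_rec_word_query:
  assumes N: "is_rec n N" and p: "is_rec n p" and w: "is_rec (Suc n) (\<lambda>xs. w (hd xs) (tl xs))"
    and w': "is_rec (Suc n) (\<lambda>xs. w (hd xs div Suc (N (tl xs))) (tl xs))"
  shows "is_rec n (\<lambda>xs. enc_cq (word_query (N xs) (p xs) (\<lambda>i. w i xs)))"
proof -
  have N': "is_rec (Suc n) (\<lambda>xs. N (tl xs))" by (rule is_rec_weaken[OF N])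
  have d: "is_rec (Suc n) (\<lambda>xs. hd xs div Suc (N (tl xs)))" "is_rec (Suc n) (\<lambda>xs. hd xs mod Suc (N (tl xs)))"
    by (intro is_rec_div is_rec_mod is_rec_vars is_rec_Suc N'; simp)+
  show ?thesis unfolding word_query_def
    by (rule is_rec_path_query[where I = "\<lambda>i j xs. j = leg 0 i (w i xs)"])
       (intro is_rec_list(2) is_rec_kvar is_rec_leg is_rec_vars is_rec_const N p N' w w' d is_rec_if_eq)+
qed

lemma is_rec_rule_query:
  assumes N: "is_rec n N" and z: "is_rec n z" and a: "is_rec n a" and b: "is_rec n b" and k: "is_rec n k" and m: "is_rec n m"
  shows "is_rec n (\<lambda>xs. enc_cq (rule_query (N xs) (z xs) (a xs) (b xs) (k xs) (m xs)))"
proof -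
  note w = is_rec_weaken[OF N] is_rec_weaken[OF z] is_rec_weaken[OF a] is_rec_weaken[OF b] is_rec_weaken[OF k] is_rec_weaken[OF m]
  let ?ks = "\<lambda>xs. [kvar (N xs) 0 (leg (z xs) 0 (a xs)), kvar (N xs) 0 (leg (z xs) 0 (k xs)),
     kvar (N xs) 1 (leg2 (z xs) (a xs) (b xs)), kvar (N xs) 1 (leg (z xs) 1 (m xs))]"
  have "is_rec n (\<lambda>xs. if a xs = b xs then list_encode (0 # ?ks xs) else list_encode (0 # 4 # ?ks xs))"
    by (intro is_rec_if_eq is_rec_list(3,4) is_rec_kvar is_rec_leg is_rec_leg2 is_rec_const N z a b k m)
  moreover have "(if a xs = b xs then list_encode (0 # ?ks xs) else list_encode (0 # 4 # ?ks xs))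
      = list_encode ((if a xs = b xs then [0] else [0, 4]) @ ?ks xs)" for xs by (simp del: list_encode.simps)
  ultimately have fr: "is_rec n (\<lambda>xs. list_encode ((if a xs = b xs then [0] else [0, 4]) @ ?ks xs))" by simp
  let ?I = "\<lambda>i j xs. if i = 0 then j = leg (z xs) 0 (a xs) \<or> j = leg (z xs) 0 (k xs)
     else j = leg2 (z xs) (a xs) (b xs) \<or> j = leg (z xs) 1 (m xs)"
  have d: "is_rec (Suc n) (\<lambda>xs. hd xs div Suc (N (tl xs)))" "is_rec (Suc n) (\<lambda>xs. hd xs mod Suc (N (tl xs)))"
    by (intro is_rec_div is_rec_mod is_rec_vars is_rec_Suc w; simp)+
  have e: "(if ?I i j xs then 0 else 1 :: nat) = (if i = 0 then (if j = leg (z xs) 0 (a xs) then 0 else if j = leg (z xs) 0 (k xs) then 0 else 1)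
     else (if j = leg2 (z xs) (a xs) (b xs) then 0 else if j = leg (z xs) 1 (m xs) then 0 else 1))" for i j xs
    by auto
  have J: "is_rec (Suc n) (\<lambda>xs. if ?I (hd xs div Suc (N (tl xs))) (hd xs mod Suc (N (tl xs))) (tl xs) then 0 else 1)"
    unfolding e by (intro is_rec_if_eq d is_rec_const is_rec_leg is_rec_leg2 w)
  show ?thesis unfolding rule_query_def
    by (rule is_rec_path_query[OF fr N z is_rec_const J])
qed

lemma is_rec_legs: "is_rec n a \<Longrightarrow> is_rec n (\<lambda>xs. legs (a xs))"
  unfolding legs_def by (intro is_rec_mult is_rec_add is_rec_const)

lemma is_rec_start_letter: "is_rec n a \<Longrightarrow> is_rec n i \<Longrightarrow> is_rec n (\<lambda>xs. start_letter (a xs) (i xs))"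
  unfolding start_letter_def by (intro is_rec_if_eq is_rec_add is_rec_const)

lemma is_rec_indexed_query:
  assumes "is_rec n a" "is_rec n i"
  shows "is_rec n (\<lambda>xs. enc_cq (indexed_query (a xs) (i xs)))"
proof -
  have eq: "enc_cq (indexed_query a i) = (if a div 2 ^ (i div 2) mod 2 = 1
     then enc_cq (rule_query (legs a) (i mod 2) (fst (prod_decode (fst (prod_decode (i div 2))))) (snd (prod_decode (fst (prod_decode (i div 2)))))
       (fst (prod_decode (snd (prod_decode (i div 2))))) (snd (prod_decode (snd (prod_decode (i div 2)))))) else enc_cq ([], []))" for a i
    by (simp add: indexed_query_def rule_of_def set_decode_def odd_iff_mod_2_eq_one case_prod_beta)
  show ?thesis unfolding eq
    by (intro is_rec_if_eq is_rec_mod is_rec_div is_rec_power is_rec_const assms is_rec_rule_query is_rec_prod_decode is_rec_legs; simp)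
qed

lemma is_rec_instance:
  "is_rec 1 (\<lambda>xs. enc_instance (sig (legs (hd xs))) (queries (hd xs)) (goal_query (legs (hd xs))))"
proof -
  have h: "is_rec 1 hd" using is_rec_hd[of 0] by simp
  have h2: "is_rec (Suc 1) (\<lambda>xs. hd (tl xs))" using is_rec_weaken[OF h] by simp
  note l = is_rec_legs[OF h]
  have S: "is_rec 1 (\<lambda>xs. enc_signature (sig (legs (hd xs))))"
  proof -
    have eq: "enc_signature (sig N) = prod_encode (list_encode [prod_encode (0, N + 2), prod_encode (1, 1)], list_encode [])" for N
      by (simp add: enc_signature_def sig_def del: list_encode.simps)
    show ?thesis unfolding eq
      by (intro is_rec_prod_encode is_rec_list(3,4) is_rec_add is_rec_const l)
  qed
  have d: "is_rec (Suc 1) (\<lambda>xs. hd xs div Suc (legs (hd (tl xs))))"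
    by (intro is_rec_div is_rec_vars is_rec_Suc is_rec_legs h2) simp
  have start: "is_rec 1 (\<lambda>xs. enc_cq (word_query (legs (hd xs)) (hd xs + 3) (start_letter (hd xs))))"
    by (rule is_rec_word_query[where w = "\<lambda>i xs. start_letter (hd xs) i"])
       (intro l h h2 d is_rec_add is_rec_const is_rec_start_letter is_rec_vars)+
  have alarm: "is_rec 1 (\<lambda>xs. enc_cq (word_query (legs (hd xs)) 2 (\<lambda>i. 3 + i)))"
    by (rule is_rec_word_query[where w = "\<lambda>i xs. 3 + i"])
       (intro l h h2 d is_rec_add is_rec_const is_rec_vars)+
  have Q: "is_rec 1 (\<lambda>xs. list_encode (map enc_cq (queries (hd xs))))"
  proof -
    have eq: "map enc_cq (queries a) = enc_cq (word_query (legs a) (a + 3) (start_letter a)) #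
      enc_cq (word_query (legs a) 2 (\<lambda>i. 3 + i)) # map (\<lambda>i. enc_cq (indexed_query a i)) [0..<2 * a]" for a
      by (simp add: queries_def comp_def)
    show ?thesis unfolding eq
      by (intro is_rec_list(2,4) start alarm is_rec_mult is_rec_const h is_rec_indexed_query h2 is_rec_vars)
  qed
  have goal: "is_rec 1 (\<lambda>xs. enc_cq (goal_query (legs (hd xs))))"
    unfolding goal_query_def
    by (rule is_rec_path_query[where I = "\<lambda>i j xs. False", OF is_rec_list_encode_Nil l is_rec_const is_rec_const])
       (simp add: is_rec_const)
  show ?thesis unfolding enc_instance_def by (intro is_rec_prod_encode S Q goal)
qed

section \<open>Register machines\<close>

text \<open>Loop r P stands for: while r > 0, decrement r and execute P.\<close>

datatype com = Inc nat | Loop nat "com list"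

inductive mstep :: "com list \<times> (nat \<Rightarrow> nat) \<Rightarrow> com list \<times> (nat \<Rightarrow> nat) \<Rightarrow> bool" where
  mstep_Inc: "mstep (Inc r # K, \<rho>) (K, \<rho>(r := Suc (\<rho> r)))"
| mstep_Loop0: "\<rho> r = 0 \<Longrightarrow> mstep (Loop r P # K, \<rho>) (K, \<rho>)"
| mstep_LoopS: "\<rho> r = Suc k \<Longrightarrow> mstep (Loop r P # K, \<rho>) (P @ Loop r P # K, \<rho>(r := k))"

text \<open>Quantifying over the continuation K lets a run be used before any further commands, in
  particular inside a loop, which is put back behind its body.\<close>

definition runs :: "com list \<Rightarrow> (nat \<Rightarrow> nat) \<Rightarrow> (nat \<Rightarrow> nat) \<Rightarrow> bool" where
  "runs P \<rho> \<rho>' = (\<forall>K. mstep\<^sup>*\<^sup>* (P @ K, \<rho>) (K, \<rho>'))"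

lemma runs_Nil: "runs [] \<rho> \<rho>"
  by (simp add: runs_def)

lemma runs_append: "runs P \<rho> \<rho>1 \<Longrightarrow> runs Q \<rho>1 \<rho>2 \<Longrightarrow> runs (P @ Q) \<rho> \<rho>2"
  unfolding runs_def by (metis append_assoc rtranclp_trans)

lemma runs_Cons: "runs [c] \<rho> \<rho>1 \<Longrightarrow> runs Q \<rho>1 \<rho>2 \<Longrightarrow> runs (c # Q) \<rho> \<rho>2"
  using runs_append[of "[c]"] by simp

lemma runs_Inc: "runs [Inc r] \<rho> (\<rho>(r := Suc (\<rho> r)))"
  unfolding runs_def by (auto intro: mstep_Inc)

lemma runs_Loop0: "\<rho> r = 0 \<Longrightarrow> runs [Loop r P] \<rho> \<rho>"
  unfolding runs_def by (auto intro: mstep_Loop0)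

lemma runs_LoopS:
  assumes "\<rho> r = Suc k" "runs P (\<rho>(r := k)) \<rho>1" "runs [Loop r P] \<rho>1 \<rho>2"
  shows "runs [Loop r P] \<rho> \<rho>2"
  unfolding runs_def
proof
  fix K
  have "mstep\<^sup>*\<^sup>* ([Loop r P] @ K, \<rho>) (P @ Loop r P # K, \<rho>(r := k))"
    using mstep_LoopS[of \<rho> r k, OF assms(1)] by auto
  also have "mstep\<^sup>*\<^sup>* (P @ Loop r P # K, \<rho>(r := k)) (Loop r P # K, \<rho>1)"
    using assms(2) unfolding runs_def by blast
  also have "mstep\<^sup>*\<^sup>* (Loop r P # K, \<rho>1) (K, \<rho>2)"
    using assms(3) unfolding runs_def by (metis append_Cons append_Nil)
  finally (rtranclp_trans) show "mstep\<^sup>*\<^sup>* ([Loop r P] @ K, \<rho>) (K, \<rho>2)" by simp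
qed

text \<open>The states are indexed by the number of rounds still to go, which is the value of the
  loop register.\<close>

lemma runs_Loop_count:
  assumes "\<And>k. k < n \<Longrightarrow> runs P ((\<sigma> (Suc k))(r := k)) (\<sigma> k)" "\<And>k. k \<le> n \<Longrightarrow> \<sigma> k r = k"
  shows "runs [Loop r P] (\<sigma> n) (\<sigma> 0)"
  using assms
proof (induction n)
  case 0
  then show ?case by (simp add: runs_Loop0)
next
  case (Suc n)
  show ?case by (rule runs_LoopS[of "\<sigma> (Suc n)" r n P "\<sigma> n"]) (use Suc.prems(1)[of n] Suc.prems(2)[of "Suc n"] Suc in \<open>auto simp del: fun_upd_apply\<close>)
qed

lemma runs_clear: "runs [Loop r []] \<rho> (\<rho>(r := 0))"
  using runs_Loop_count[of "\<rho> r" "[]" "\<lambda>k. \<rho>(r := k)" r] by (simp add: runs_Nil)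

lemma runs_move: "s \<noteq> t \<Longrightarrow> runs [Loop s [Inc t]] \<rho> (\<rho>(s := 0, t := \<rho> t + \<rho> s))"
proof -
  assume st: "s \<noteq> t"
  have "runs [Loop s [Inc t]] ((\<lambda>k. \<rho>(s := k, t := \<rho> t + (\<rho> s - k))) (\<rho> s)) ((\<lambda>k. \<rho>(s := k, t := \<rho> t + (\<rho> s - k))) 0)"
  proof (rule runs_Loop_count)
    fix k assume k: "k < \<rho> s"
    have "\<rho>(s := k, t := \<rho> t + (\<rho> s - k)) = (let \<tau> = (\<rho>(s := Suc k, t := \<rho> t + (\<rho> s - Suc k)))(s := k) in \<tau>(t := Suc (\<tau> t)))"
      using st k by (auto simp: fun_eq_iff Let_def)
    then show "runs [Inc t] ((\<rho>(s := Suc k, t := \<rho> t + (\<rho> s - Suc k)))(s := k)) (\<rho>(s := k, t := \<rho> t + (\<rho> s - k)))"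
      using runs_Inc[of t "(\<rho>(s := Suc k, t := \<rho> t + (\<rho> s - Suc k)))(s := k)"] by (simp add: Let_def)
  qed (use st in auto)
  then show ?thesis using st by simp
qed

text \<open>A loop consumes its register, so the value is doubled into t and the scratch register u,
  from which s is restored.\<close>

lemma runs_copy:
  assumes "distinct [s, t, u]" "\<rho> u = 0"
  shows "runs [Loop s [Inc t, Inc u], Loop u [Inc s]] \<rho> (\<rho>(t := \<rho> t + \<rho> s))"
proof -
  let ?\<sigma> = "\<lambda>k. \<rho>(s := k, t := \<rho> t + (\<rho> s - k), u := \<rho> s - k)"
  have 1: "runs [Loop s [Inc t, Inc u]] (?\<sigma> (\<rho> s)) (?\<sigma> 0)"
  proof (rule runs_Loop_count)
    fix k assume k: "k < \<rho> s"
    let ?\<tau> = "(?\<sigma> (Suc k))(s := k)"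
    have "runs [Inc t, Inc u] ?\<tau> ((?\<tau>(t := Suc (?\<tau> t)))(u := Suc ((?\<tau>(t := Suc (?\<tau> t))) u)))"
      by (rule runs_Cons[OF runs_Inc runs_Inc])
    also have "(?\<tau>(t := Suc (?\<tau> t)))(u := Suc ((?\<tau>(t := Suc (?\<tau> t))) u)) = ?\<sigma> k"
      using assms k by (auto simp: fun_eq_iff)
    finally show "runs [Inc t, Inc u] ?\<tau> (?\<sigma> k)" .
  qed (use assms in auto)
  have 2: "?\<sigma> (\<rho> s) = \<rho>" using assms by (auto simp: fun_eq_iff)
  have 3: "runs [Loop u [Inc s]] (?\<sigma> 0) ((?\<sigma> 0)(u := 0, s := ?\<sigma> 0 s + ?\<sigma> 0 u))"
    using assms by (intro runs_move) auto
  have 4: "(?\<sigma> 0)(u := 0, s := ?\<sigma> 0 s + ?\<sigma> 0 u) = \<rho>(t := \<rho> t + \<rho> s)"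
    using assms by (auto simp: fun_eq_iff)
  show ?thesis using runs_Cons[OF 1[unfolded 2] 3[unfolded 4]] .
qed

lemma runs_clear_all:
  "runs (map (\<lambda>r. Loop r []) rs) \<rho> (\<lambda>r. if r \<in> set rs then 0 else \<rho> r)"
proof (induction rs arbitrary: \<rho>)
  case Nil
  then show ?case by (simp add: runs_Nil)
next
  case (Cons a rs)
  have eq: "(\<lambda>r. if r \<in> set (a # rs) then 0 else \<rho> r) = (\<lambda>r. if r \<in> set rs then 0 else (\<rho>(a := 0)) r)"
    by (auto simp: fun_eq_iff)
  show ?case unfolding eq list.map by (rule runs_Cons[OF runs_clear Cons.IH])
qed

text \<open>Inputs in the registers listed by is, output in o'; registers from b on are scratch space,
  zero before and after.\<close>

definition implementable :: "recf \<Rightarrow> bool" where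
  "implementable f = (\<forall>is o' b. o' < b \<and> set is \<subseteq> {..<b} \<and> o' \<notin> set is \<longrightarrow>
     (\<exists>P. \<forall>y \<rho>. eval f (map \<rho> is) y \<and> \<rho> o' = 0 \<and> (\<forall>j\<ge>b. \<rho> j = 0) \<longrightarrow> runs P \<rho> (\<rho>(o' := y))))"

lemma implementableE:
  assumes "implementable f" "o' < b" "set is \<subseteq> {..<b}" "o' \<notin> set is"
  obtains P where "\<And>y \<rho>. eval f (map \<rho> is) y \<Longrightarrow> \<rho> o' = 0 \<Longrightarrow> (\<And>j. j \<ge> b \<Longrightarrow> \<rho> j = 0) \<Longrightarrow> runs P \<rho> (\<rho>(o' := y))"
proof -
  have "\<exists>P. \<forall>y \<rho>. eval f (map \<rho> is) y \<and> \<rho> o' = 0 \<and> (\<forall>j\<ge>b. \<rho> j = 0) \<longrightarrow> runs P \<rho> (\<rho>(o' := y))"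
    using assms(1)[unfolded implementable_def, THEN spec[of _ "is"], THEN spec[of _ o'], THEN spec[of _ b]] assms(2-4)
    by (elim mp) (intro conjI)
  then obtain P where P: "\<forall>y \<rho>. eval f (map \<rho> is) y \<and> \<rho> o' = 0 \<and> (\<forall>j\<ge>b. \<rho> j = 0) \<longrightarrow> runs P \<rho> (\<rho>(o' := y))"
    by (elim exE)
  show thesis
  proof (rule that[of P])
    fix y \<rho> assume "eval f (map \<rho> is) y" "\<rho> o' = 0" "\<And>j. j \<ge> b \<Longrightarrow> \<rho> j = 0"
    then show "runs P \<rho> (\<rho>(o' := y))" by (intro P[THEN spec, THEN spec, THEN mp]) simp
  qed
qed

inductive_cases eval_ZeroE: "eval Zero xs y"
inductive_cases eval_SuccE: "eval Succ xs y"
inductive_cases eval_ProjE: "eval (Proj i) xs y"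
inductive_cases eval_CompE: "eval (Comp f gs) xs y"
inductive_cases eval_Prim0E: "eval (Prim f g) (0 # xs) y"
inductive_cases eval_PrimSE: "eval (Prim f g) (Suc n # xs) y"
inductive_cases eval_PrimNilE: "eval (Prim f g) [] y"
inductive_cases eval_MnE: "eval (Mn f) xs y"

lemma implementable_Zero: "implementable Zero"
  unfolding implementable_def
proof (intro allI impI exI[of _ "[]"])
  fix "is" :: "nat list" and o' b y :: nat and \<rho> :: "nat \<Rightarrow> nat"
  assume "eval Zero (map \<rho> is) y \<and> \<rho> o' = 0 \<and> (\<forall>j\<ge>b. \<rho> j = 0)"
  then have "\<rho>(o' := y) = \<rho>" by (auto elim!: eval_ZeroE simp: fun_upd_idem)
  then show "runs [] \<rho> (\<rho>(o' := y))" by (simp add: runs_Nil)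
qed

lemma implementable_Proj: "implementable (Proj i)"
  unfolding implementable_def
proof (intro allI impI)
  fix "is" :: "nat list" and o' b :: nat
  assume b: "o' < b \<and> set is \<subseteq> {..<b} \<and> o' \<notin> set is"
  show "\<exists>P. \<forall>y \<rho>. eval (Proj i) (map \<rho> is) y \<and> \<rho> o' = 0 \<and> (\<forall>j\<ge>b. \<rho> j = 0) \<longrightarrow> runs P \<rho> (\<rho>(o' := y))"
  proof (intro exI allI impI)
    fix y \<rho> assume a: "eval (Proj i) (map \<rho> is) y \<and> \<rho> o' = 0 \<and> (\<forall>j\<ge>b. \<rho> j = 0)"
    then have i: "i < length is" "y = \<rho> (is ! i)" by (auto elim: eval_ProjE)
    have "is ! i \<in> set is" using i by simp
    then have "distinct [is ! i, o', b]" using b by auto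
    from runs_copy[OF this, of \<rho>] show "runs [Loop (is ! i) [Inc o', Inc b], Loop b [Inc (is ! i)]] \<rho> (\<rho>(o' := y))"
      using a i by simp
  qed
qed

lemma implementable_Succ: "implementable Succ"
  unfolding implementable_def
proof (intro allI impI)
  fix "is" :: "nat list" and o' b :: nat
  assume b: "o' < b \<and> set is \<subseteq> {..<b} \<and> o' \<notin> set is"
  show "\<exists>P. \<forall>y \<rho>. eval Succ (map \<rho> is) y \<and> \<rho> o' = 0 \<and> (\<forall>j\<ge>b. \<rho> j = 0) \<longrightarrow> runs P \<rho> (\<rho>(o' := y))"
  proof (intro exI allI impI)
    fix y \<rho> assume a: "eval Succ (map \<rho> is) y \<and> \<rho> o' = 0 \<and> (\<forall>j\<ge>b. \<rho> j = 0)"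
    then obtain i is' where i: "is = i # is'" "y = Suc (\<rho> (hd is))" by (auto elim: eval_SuccE)
    then have "distinct [hd is, o', b]" using b by auto
    from runs_append[OF runs_copy[OF this, of \<rho>] runs_Inc[of o']]
    show "runs ([Loop (hd is) [Inc o', Inc b], Loop b [Inc (hd is)]] @ [Inc o']) \<rho> (\<rho>(o' := y))"
      using a i by simp
  qed
qed

definition fill :: "(nat \<Rightarrow> nat) \<Rightarrow> nat \<Rightarrow> nat list \<Rightarrow> nat \<Rightarrow> nat" where
  "fill \<rho> s ys = (\<lambda>r. if s \<le> r \<and> r < s + length ys then ys ! (r - s) else \<rho> r)"

lemma fill_Cons: "fill (\<rho>(s := y)) (Suc s) ys = fill \<rho> s (y # ys)"
  by (auto simp: fill_def fun_eq_iff nth_Cons split: nat.splits) (metis Suc_diff_Suc diff_Suc_1 le_neq_implies_less nat.simps(3) Suc_le_eq)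

lemma implementable_args:
  assumes "\<And>g. g \<in> set gs \<Longrightarrow> implementable g" "set is \<subseteq> {..<s}" "s + length gs \<le> b"
  shows "\<exists>P. \<forall>ys \<rho>. list_all2 (\<lambda>g y. eval g (map \<rho> is) y) gs ys \<and> (\<forall>j\<ge>s. \<rho> j = 0) \<longrightarrow> runs P \<rho> (fill \<rho> s ys)"
  using assms
proof (induction gs arbitrary: s)
  case Nil
  have "fill \<rho> s [] = \<rho>" for \<rho> by (auto simp: fill_def)
  then show ?case by (auto intro!: exI[of _ "[]"] runs_Nil)
next
  case (Cons g gs)
  obtain P where P: "\<And>y \<rho>. eval g (map \<rho> is) y \<Longrightarrow> \<rho> s = 0 \<Longrightarrow> (\<And>j. j \<ge> b \<Longrightarrow> \<rho> j = 0) \<Longrightarrow> runs P \<rho> (\<rho>(s := y))"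
    by (rule implementableE[of g s b "is"]) (use Cons.prems in \<open>auto\<close>)
  have "\<exists>Q. \<forall>ys \<rho>. list_all2 (\<lambda>g y. eval g (map \<rho> is) y) gs ys \<and> (\<forall>j\<ge>Suc s. \<rho> j = 0) \<longrightarrow> runs Q \<rho> (fill \<rho> (Suc s) ys)"
    by (rule Cons.IH) (use Cons.prems in auto)
  then obtain Q where Q: "\<forall>ys \<rho>. list_all2 (\<lambda>g y. eval g (map \<rho> is) y) gs ys \<and> (\<forall>j\<ge>Suc s. \<rho> j = 0) \<longrightarrow> runs Q \<rho> (fill \<rho> (Suc s) ys)"
    by (elim exE)
  show ?case
  proof (intro exI[of _ "P @ Q"] allI impI)
    fix ys \<rho> assume a: "list_all2 (\<lambda>g y. eval g (map \<rho> is) y) (g # gs) ys \<and> (\<forall>j\<ge>s. \<rho> j = 0)"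
    then obtain y ys' where ys: "ys = y # ys'" "eval g (map \<rho> is) y"
      "list_all2 (\<lambda>g y. eval g (map \<rho> is) y) gs ys'" by (auto simp: list_all2_Cons1)
    have m: "map (\<rho>(s := y)) is = map \<rho> is" using Cons.prems(2) by auto
    have "runs (P @ Q) \<rho> (fill (\<rho>(s := y)) (Suc s) ys')"
      by (rule runs_append[OF P Q[THEN spec, THEN spec, THEN mp]]) (unfold m, use ys a Cons.prems(3) in auto)
    then show "runs (P @ Q) \<rho> (fill \<rho> s ys)" by (simp add: fill_Cons ys)
  qed
qed

lemma implementable_Comp:
  assumes f: "implementable f" and gs: "\<And>g. g \<in> set gs \<Longrightarrow> implementable g"
  shows "implementable (Comp f gs)"
  unfolding implementable_def
proof (intro allI impI)
  fix "is" :: "nat list" and o' b :: nat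
  assume b: "o' < b \<and> set is \<subseteq> {..<b} \<and> o' \<notin> set is"
  let ?B = "b + length gs"
  have "\<exists>P. \<forall>ys \<rho>. list_all2 (\<lambda>g y. eval g (map \<rho> is) y) gs ys \<and> (\<forall>j\<ge>b. \<rho> j = 0) \<longrightarrow> runs P \<rho> (fill \<rho> b ys)"
    by (rule implementable_args[of _ _ _ ?B]) (use gs b in auto)
  then obtain P where P: "\<forall>ys \<rho>. list_all2 (\<lambda>g y. eval g (map \<rho> is) y) gs ys \<and> (\<forall>j\<ge>b. \<rho> j = 0) \<longrightarrow> runs P \<rho> (fill \<rho> b ys)"
    by (elim exE)
  obtain Q where Q: "\<And>y \<rho>. eval f (map \<rho> [b..<?B]) y \<Longrightarrow> \<rho> o' = 0 \<Longrightarrow> (\<And>j. j \<ge> ?B \<Longrightarrow> \<rho> j = 0) \<Longrightarrow> runs Q \<rho> (\<rho>(o' := y))"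
    by (rule implementableE[OF f, of o' ?B "[b..<?B]"]) (use b in auto)
  show "\<exists>P. \<forall>y \<rho>. eval (Comp f gs) (map \<rho> is) y \<and> \<rho> o' = 0 \<and> (\<forall>j\<ge>b. \<rho> j = 0) \<longrightarrow> runs P \<rho> (\<rho>(o' := y))"
  proof (intro exI allI impI)
    fix y \<rho> assume a: "eval (Comp f gs) (map \<rho> is) y \<and> \<rho> o' = 0 \<and> (\<forall>j\<ge>b. \<rho> j = 0)"
    then obtain ys where ys: "list_all2 (\<lambda>g y. eval g (map \<rho> is) y) gs ys" "eval f ys y"
      by (auto elim: eval_CompE)
    have len: "length ys = length gs" using ys(1) by (simp add: list_all2_lengthD)
    have m: "map (fill \<rho> b ys) [b..<?B] = ys"
      by (rule nth_equalityI) (auto simp: fill_def len)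
    have z: "(\<lambda>r. if r \<in> set [b..<?B] then 0 else ((fill \<rho> b ys)(o' := y)) r) = \<rho>(o' := y)"
      using a b len by (auto simp: fill_def fun_eq_iff)
    have "runs ((P @ Q) @ map (\<lambda>r. Loop r []) [b..<?B]) \<rho> (\<lambda>r. if r \<in> set [b..<?B] then 0 else ((fill \<rho> b ys)(o' := y)) r)"
      by (rule runs_append[OF runs_append[OF P[THEN spec, THEN spec, THEN mp] Q] runs_clear_all]) (use a b m len ys in \<open>auto simp: fill_def\<close>)
    then show "runs ((P @ Q) @ map (\<lambda>r. Loop r []) [b..<?B]) \<rho> (\<rho>(o' := y))" unfolding z .
  qed
qed

text \<open>The table v of intermediate values provides the invariant of the counting loop that
  implements the recursion.\<close>

lemma eval_Prim_values:
  "eval (Prim f g) (n # xs) y \<Longrightarrow> \<exists>v. eval f xs (v 0) \<and> (\<forall>k<n. eval g (k # v k # xs) (v (Suc k))) \<and> v n = y"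
proof (induction n arbitrary: y)
  case 0
  then show ?case by (auto elim!: eval_Prim0E intro: exI[of _ "\<lambda>_. y"])
next
  case (Suc n)
  from Suc.prems obtain r where r: "eval (Prim f g) (n # xs) r" "eval g (n # r # xs) y"
    by (auto elim: eval_PrimSE)
  from Suc.IH[OF r(1)] obtain v where v: "eval f xs (v 0)" "\<And>k. k < n \<Longrightarrow> eval g (k # v k # xs) (v (Suc k))" "v n = r"
    by blast
  show ?case
    by (rule exI[of _ "v(Suc n := y)"]) (use v r in \<open>auto simp: less_Suc_eq\<close>)
qed

lemma implementable_Prim:
  assumes f: "implementable f" and g: "implementable g"
  shows "implementable (Prim f g)"
  unfolding implementable_def
proof (intro allI impI)
  fix "is" :: "nat list" and o' b :: nat
  assume b: "o' < b \<and> set is \<subseteq> {..<b} \<and> o' \<notin> set is"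
  show "\<exists>P. \<forall>y \<rho>. eval (Prim f g) (map \<rho> is) y \<and> \<rho> o' = 0 \<and> (\<forall>j\<ge>b. \<rho> j = 0) \<longrightarrow> runs P \<rho> (\<rho>(o' := y))"
  proof (cases "is")
    case Nil
    then show ?thesis by (auto elim: eval_PrimNilE)
  next
    case (Cons i js)
    obtain P where P: "\<And>y \<rho>. eval f (map \<rho> js) y \<Longrightarrow> \<rho> (b+2) = 0 \<Longrightarrow> (\<And>j. j \<ge> b+4 \<Longrightarrow> \<rho> j = 0) \<Longrightarrow> runs P \<rho> (\<rho>(b+2 := y))"
      by (rule implementableE[OF f, of "b+2" "b+4" js]) (use b Cons in auto)
    obtain Q where Q: "\<And>y \<rho>. eval g (map \<rho> ((b+1) # (b+2) # js)) y \<Longrightarrow> \<rho> (b+3) = 0 \<Longrightarrow> (\<And>j. j \<ge> b+4 \<Longrightarrow> \<rho> j = 0) \<Longrightarrow> runs Q \<rho> (\<rho>(b+3 := y))"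
      by (rule implementableE[OF g, of "b+3" "b+4" "(b+1) # (b+2) # js"]) (use b Cons in auto)
    \<comment> \<open>Register b counts the rounds left, b + 1 is the current index, b + 2 holds the
      value reached so far and b + 3 receives the next one.\<close>
    let ?body = "Q @ [Loop (b+2) [], Loop (b+3) [Inc (b+2)], Inc (b+1)]"
    let ?prog = "[Loop i [Inc b, Inc (b+1)], Loop (b+1) [Inc i]] @ P @ [Loop b ?body, Loop (b+1) [], Loop (b+2) [Inc o']]"
    show ?thesis
    proof (intro exI[of _ ?prog] allI impI)
      fix y \<rho> assume a: "eval (Prim f g) (map \<rho> is) y \<and> \<rho> o' = 0 \<and> (\<forall>j\<ge>b. \<rho> j = 0)"
      let ?n = "\<rho> i"
      obtain v where v: "eval f (map \<rho> js) (v 0)" "\<And>k. k < ?n \<Longrightarrow> eval g (k # v k # map \<rho> js) (v (Suc k))" "v ?n = y"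
        using a eval_Prim_values[of f g ?n "map \<rho> js" y] Cons by auto
      have js: "\<And>j. j \<in> set js \<Longrightarrow> j < b" "i < b" using b Cons by auto
      let ?\<sigma> = "\<lambda>k. \<rho>(b := k, b+1 := ?n - k, b+2 := v (?n - k))"
      have 1: "runs [Loop i [Inc b, Inc (b+1)], Loop (b+1) [Inc i]] \<rho> (\<rho>(b := ?n))"
        using runs_copy[of i b "b+1" \<rho>] a js by simp
      have mjs: "map (\<rho>(b := ?n)) js = map \<rho> js" using js by auto
      have "runs P (\<rho>(b := ?n)) ((\<rho>(b := ?n))(b+2 := v 0))"
        by (rule P) (unfold mjs, use a v in auto)
      also have "(\<rho>(b := ?n))(b+2 := v 0) = ?\<sigma> ?n" using a by (auto simp: fun_eq_iff)
      finally have 2: "runs P (\<rho>(b := ?n)) (?\<sigma> ?n)" .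
      have 3: "runs [Loop b ?body] (?\<sigma> ?n) (?\<sigma> 0)"
      proof (rule runs_Loop_count)
        fix k assume k: "k < ?n"
        define m where "m = ?n - Suc k"
        have m: "?n - k = Suc m" "m < ?n" using k by (auto simp: m_def)
        let ?\<tau> = "\<rho>(b := k, b+1 := m, b+2 := v m)"
        have mjs: "map ?\<tau> ((b+1) # (b+2) # js) = m # v m # map \<rho> js"
          using js(1)[of b] js(1)[of "Suc b"] js(1)[of "Suc (Suc b)"] by auto
        have "runs Q ?\<tau> (?\<tau>(b+3 := v (Suc m)))"
          by (rule Q) (unfold mjs, use a v(2)[OF m(2)] in auto)
        note Qrun = this
        have ne: "b + 3 \<noteq> b + 2" by simp
        have "runs ?body ?\<tau>
           (let \<tau>1 = ?\<tau>(b+3 := v (Suc m)); \<tau>2 = \<tau>1(b+2 := 0); \<tau>3 = \<tau>2(b+3 := 0, b+2 := \<tau>2 (b+2) + \<tau>2 (b+3))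
            in \<tau>3(b+1 := Suc (\<tau>3 (b+1))))" unfolding Let_def
          by (rule runs_append[OF Qrun runs_Cons[OF runs_clear runs_Cons[OF runs_move[OF ne] runs_Inc]]])
        also have "(let \<tau>1 = ?\<tau>(b+3 := v (Suc m)); \<tau>2 = \<tau>1(b+2 := 0); \<tau>3 = \<tau>2(b+3 := 0, b+2 := \<tau>2 (b+2) + \<tau>2 (b+3))
            in \<tau>3(b+1 := Suc (\<tau>3 (b+1)))) = ?\<sigma> k"
          using a m by (auto simp: fun_eq_iff Let_def)
        also have "?\<tau> = (?\<sigma> (Suc k))(b := k)" by (auto simp: fun_eq_iff m_def)
        finally show "runs ?body ((?\<sigma> (Suc k))(b := k)) (?\<sigma> k)" .
      qed auto
      have ne: "b + 2 \<noteq> o'" using b by auto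
      have "runs ?prog \<rho> (let \<tau> = (?\<sigma> 0)(b+1 := 0) in \<tau>(b+2 := 0, o' := \<tau> o' + \<tau> (b+2)))" unfolding Let_def
        by (rule runs_append[OF 1 runs_append[OF 2 runs_Cons[OF 3 runs_Cons[OF runs_clear runs_move[OF ne]]]]])
      also have "(let \<tau> = (?\<sigma> 0)(b+1 := 0) in \<tau>(b+2 := 0, o' := \<tau> o' + \<tau> (b+2))) = \<rho>(o' := y)"
        using a b v(3) by (auto simp: fun_eq_iff Let_def)
      finally show "runs ?prog \<rho> (\<rho>(o' := y))" .
    qed
  qed
qed

lemma implementable_Mn:
  assumes f: "implementable f"
  shows "implementable (Mn f)"
  unfolding implementable_def
proof (intro allI impI)
  fix "is" :: "nat list" and o' b :: nat
  assume b: "o' < b \<and> set is \<subseteq> {..<b} \<and> o' \<notin> set is"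
  obtain P where P: "\<And>y \<rho>. eval f (map \<rho> (b # is)) y \<Longrightarrow> \<rho> (b+2) = 0 \<Longrightarrow> (\<And>j. j \<ge> b+3 \<Longrightarrow> \<rho> j = 0) \<Longrightarrow> runs P \<rho> (\<rho>(b+2 := y))"
    by (rule implementableE[OF f, of "b+2" "b+3" "b # is"]) (use b in auto)
  \<comment> \<open>Register b is the candidate, b + 1 a flag that keeps the search going, b + 2 the
    value of f. The loop on b + 2 clears its own register at once and thus acts as a conditional: a
    positive value moves on to the next candidate and sets the flag again.\<close>
  let ?body = "P @ [Loop (b+2) [Loop (b+2) [], Inc b, Inc (b+1)]]"
  let ?prog = "[Inc (b+1), Loop (b+1) ?body, Loop b [Inc o']]"
  show "\<exists>P. \<forall>y \<rho>. eval (Mn f) (map \<rho> is) y \<and> \<rho> o' = 0 \<and> (\<forall>j\<ge>b. \<rho> j = 0) \<longrightarrow> runs P \<rho> (\<rho>(o' := y))"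
  proof (intro exI[of _ ?prog] allI impI)
    fix n \<rho> assume a: "eval (Mn f) (map \<rho> is) n \<and> \<rho> o' = 0 \<and> (\<forall>j\<ge>b. \<rho> j = 0)"
    then have ev: "eval f (n # map \<rho> is) 0" "\<And>m. m < n \<Longrightarrow> \<exists>y. eval f (m # map \<rho> is) y \<and> 0 < y"
      by (auto elim: eval_MnE)
    define \<tau> where "\<tau> k flag = \<rho>(b := k, b+1 := flag)" for k flag
    have map_\<tau>: "map (\<tau> k flag) (b # is) = k # map \<rho> is" for k flag using b by (auto simp: \<tau>_def)
    have \<tau>0: "\<tau> k flag j = 0" if "j \<ge> b + 2" for k flag j using a that by (auto simp: \<tau>_def)
    have \<tau>_upd: "(\<tau> k flag)(b + 2 := 0) = \<tau> k flag" "(\<tau> k flag)(b + 1 := flag') = \<tau> k flag'"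
      "(\<tau> k flag)(b := k') = \<tau> k' flag" for k k' flag flag'
      using a by (auto simp: \<tau>_def fun_eq_iff)
    have \<tau>_app: "\<tau> k flag b = k" "\<tau> k flag (b + 1) = flag" for k flag by (auto simp: \<tau>_def)
    have \<tau>_1: "\<tau> k 1 (b + 1) = Suc 0" for k by (simp add: \<tau>_def)
    have Pr: "runs P (\<tau> k 0) ((\<tau> k 0)(b+2 := y))" if "eval f (k # map \<rho> is) y" for k y
      by (rule P) (unfold map_\<tau>, rule that, auto intro: \<tau>0)
    have loop: "runs [Loop (b+1) ?body] (\<tau> k 1) (\<tau> n 0)" if "k \<le> n" for k
      using that
    proof (induction k rule: inc_induct)
      case base
      have "runs ?body (\<tau> n 0) (\<tau> n 0)"
        by (rule runs_append[OF Pr[OF ev(1), unfolded \<tau>_upd] runs_Loop0[of "\<tau> n 0" "b+2", OF \<tau>0[OF order.refl]]])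
      then have "runs ?body ((\<tau> n 1)(b+1 := 0)) (\<tau> n 0)" by (simp only: \<tau>_upd)
      then show ?case by (rule runs_LoopS[of "\<tau> n 1" "b+1" 0, OF \<tau>_1 _ runs_Loop0[of "\<tau> n 0" "b+1", OF \<tau>_app(2)]])
    next
      case (step k)
      obtain y0 where y0: "eval f (k # map \<rho> is) y0 \<and> 0 < y0" using ev(2)[OF step(2)] by (elim exE)
      then obtain y where y: "eval f (k # map \<rho> is) (Suc y)" by (cases y0) auto
      have h1: "runs [Loop (b+2) []] ((\<tau> k 0)(b+2 := y)) (\<tau> k 0)"
        using runs_clear[of "b+2" "(\<tau> k 0)(b+2 := y)"] by (simp only: fun_upd_upd \<tau>_upd)
      have h2: "runs [Inc b] (\<tau> k 0) (\<tau> (Suc k) 0)"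
        using runs_Inc[of b "\<tau> k 0"] by (simp only: \<tau>_app \<tau>_upd)
      have h3: "runs [Inc (b+1)] (\<tau> (Suc k) 0) (\<tau> (Suc k) (Suc 0))"
        using runs_Inc[of "b+1" "\<tau> (Suc k) 0"] by (simp only: \<tau>_app \<tau>_upd)
      have in1: "runs [Loop (b+2) [], Inc b, Inc (b+1)] (((\<tau> k 0)(b+2 := Suc y))(b+2 := y)) (\<tau> (Suc k) 1)"
        using runs_Cons[OF h1 runs_Cons[OF h2 h3]] by simp
      have "runs [Loop (b+2) [Loop (b+2) [], Inc b, Inc (b+1)]] ((\<tau> k 0)(b+2 := Suc y)) (\<tau> (Suc k) 1)"
        by (rule runs_LoopS[of "(\<tau> k 0)(b+2 := Suc y)" "b+2" y, OF _ in1 runs_Loop0[of "\<tau> (Suc k) 1" "b+2", OF \<tau>0[OF order.refl]]]) simp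
      then have "runs ?body (\<tau> k 0) (\<tau> (Suc k) 1)" by (rule runs_append[OF Pr[OF y]])
      then have "runs ?body ((\<tau> k 1)(b+1 := 0)) (\<tau> (Suc k) 1)" by (simp only: \<tau>_upd)
      then show ?case by (rule runs_LoopS[of "\<tau> k 1" "b+1" 0, OF \<tau>_1 _ step.IH])
    qed
    have s: "\<rho>(b+1 := Suc (\<rho> (b+1))) = \<tau> 0 1" using a by (auto simp: \<tau>_def fun_eq_iff)
    have ne: "b \<noteq> o'" using b by auto
    have "runs ?prog \<rho> ((\<tau> n 0)(b := 0, o' := \<tau> n 0 o' + \<tau> n 0 b))"
      by (rule runs_Cons[OF runs_Inc[of "b+1" \<rho>, unfolded s] runs_Cons[OF loop[of 0, OF le0] runs_move[OF ne]]])
    also have "(\<tau> n 0)(b := 0, o' := \<tau> n 0 o' + \<tau> n 0 b) = \<rho>(o' := n)"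
      using a b by (auto simp: \<tau>_def fun_eq_iff)
    finally show "runs ?prog \<rho> (\<rho>(o' := n))" .
  qed
qed

lemma implementable_recf: "implementable f"
  by (induction f) (auto intro: implementable_Zero implementable_Succ implementable_Proj implementable_Comp
      implementable_Prim implementable_Mn)

lemma recf_program:
  obtains P where "\<And>x y. eval f [x] y \<Longrightarrow>
    mstep\<^sup>*\<^sup>* (P, (\<lambda>_. 0)(0 := x)) ([], (\<lambda>_. 0)(0 := x, 1 := y))"
proof -
  obtain P where P: "\<And>y \<rho>. eval f (map \<rho> [0]) y \<Longrightarrow> \<rho> 1 = 0 \<Longrightarrow> (\<And>j. j \<ge> 2 \<Longrightarrow> \<rho> j = 0) \<Longrightarrow> runs P \<rho> (\<rho>(1 := y))"
    by (rule implementableE[OF implementable_recf, of 1 2 "[0]"]) auto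
  have "runs P ((\<lambda>_. 0)(0 := x)) ((\<lambda>_. 0)(0 := x, 1 := y))" if "eval f [x] y" for x y
    using P[of "(\<lambda>_. 0)(0 := x)" y] that by simp
  then show thesis using that[of P] unfolding runs_def by (metis append_Nil2)
qed

section \<open>Register machines as rewriting systems\<close>

text \<open>The control state of a program is the list of commands still to be executed; labels P K are
  the control states that occur while P runs in front of K.\<close>

fun labels :: "com list \<Rightarrow> com list \<Rightarrow> com list set" where
  "labels [] K = {K}"
| "labels (Inc r # P) K = insert ((Inc r # P) @ K) (labels P K)"
| "labels (Loop r Q # P) K = insert ((Loop r Q # P) @ K) (labels Q ((Loop r Q # P) @ K) \<union> labels P K)"

lemma finite_labels: "finite (labels P K)"
  by (induction P K rule: labels.induct) auto

lemma labels_start: "P @ K \<in> labels P K"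
  by (cases "(P, K)" rule: labels.cases) auto

lemma labels_end: "K \<in> labels P K"
  by (induction P K rule: labels.induct) auto

inductive_cases mstepE: "mstep (K, \<rho>) (K', \<rho>')"

lemma labels_mstep:
  "K1 \<in> labels P K \<Longrightarrow> mstep (K1, \<rho>) (K2, \<rho>') \<Longrightarrow> K1 \<noteq> K \<Longrightarrow> K2 \<in> labels P K"
proof (induction P K rule: labels.induct)
  case (2 r P K)
  then show ?case using labels_start[of P K] labels_end[of K P] by (auto elim!: mstepE)
next
  case (3 r Q P K)
  show ?case
  proof (cases "K1 = (Loop r Q # P) @ K")
    case True
    then show ?thesis using 3(4) labels_start[of P K] labels_start[of Q "(Loop r Q # P) @ K"]
      by (auto elim!: mstepE)
  next
    case False
    then show ?thesis using 3 by auto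
  qed
qed auto

text \<open>The word of a configuration is L, the state Rs K, a tape with as many letters A r as the value
  of register r (in any order, B being blank), and E. The state Rs K travels to the right to perform
  the first command of K, and Ls returns to L with the next label; Ls None means output 0.
  F K is an E that is about to be extended by one cell; Al1 Al2 is the alarm; I1 a b and
  I2 a b are the intermediate letters of the step that rewrites ab.\<close>

datatype letter = L | E | A nat | B | Rs "com list" | Ls "com list option" | F "com list"
  | Al1 | Al2 | I1 letter letter | I2 letter letter

fun tape :: "letter \<Rightarrow> bool" where
  "tape (A r) = True" | "tape B = True" | "tape _ = False"

text \<open>The letters at which a travelling state must stop. The empty program tests the output
  register 1, and \<open>delta\<close> has no rule for its state on \<open>A 1\<close>: a nonzero
  output ends the rewriting right there, without alarm.\<close>

fun hits :: "com list \<Rightarrow> letter \<Rightarrow> bool" where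
  "hits (Loop r P # K) (A s) = (r = s)" | "hits [] (A s) = (s = 1)" | "hits _ _ = False"

inductive delta :: "letter \<Rightarrow> letter \<Rightarrow> letter \<Rightarrow> letter \<Rightarrow> bool" where
  delta_right: "tape x \<Longrightarrow> \<not> hits K x \<Longrightarrow> delta (Rs K) x x (Rs K)"
| delta_inc: "delta (Rs (Inc r # K)) E (A r) (F K)"
| delta_loopS: "delta (Rs (Loop r P # K)) (A r) (Ls (Some (P @ Loop r P # K))) B"
| delta_loop0: "delta (Rs (Loop r P # K)) E (Ls (Some K)) E"
| delta_halt0: "delta (Rs []) E (Ls None) E"
| delta_left: "tape x \<Longrightarrow> delta x (Ls Z) (Ls Z) x"
| delta_turn: "delta L (Ls (Some K)) L (Rs K)"

inductive_cases deltaE: "delta a b c d"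

lemma delta_det: "delta a b c d \<Longrightarrow> delta a b c' d' \<Longrightarrow> c' = c \<and> d' = d"
  by (erule delta.cases; erule deltaE) auto

text \<open>Marks the place where a word can be rewritten. In an intermediate pair the first letter
  plays this role; whether the pair closes the word is recorded in the second.\<close>

fun head :: "letter \<Rightarrow> bool" where
  "head (Rs K) = True" | "head (Ls Z) = True" | "head (F K) = True" | "head Al1 = True"
| "head (I1 a b) = True" | "head _ = False"

fun ending :: "letter \<Rightarrow> bool" where
  "ending E = True" | "ending (F K) = True" | "ending (I2 a b) = ending b" | "ending _ = False"

fun main :: "letter \<Rightarrow> bool" where
  "main Al1 = False" | "main Al2 = False" | "main (I1 a b) = False" | "main (I2 a b) = False"
| "main _ = True"

text \<open>Views equate main pairs with intermediate pairs only, so each step passes through an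
  intermediate pair named after its left side: \<open>fwd\<close> creates that pair,
  \<open>bwd\<close> resolves it. The doubled \<open>F K\<close> codes the expansion of the last
  letter; the alarm pair is never resolved.\<close>

definition fwd :: "letter set \<Rightarrow> (letter \<times> letter \<times> letter \<times> letter) set" where
  "fwd S = {(a, b, I1 a b, I2 a b) | a b c d. delta a b c d \<and> {a, b, c, d} \<subseteq> S}
     \<union> {(F K, F K, I1 (F K) (F K), I2 (F K) (F K)) | K. {F K, Ls (Some K), E} \<subseteq> S}
     \<union> {(L, Ls None, Al1, Al2)}"

definition bwd :: "letter set \<Rightarrow> (letter \<times> letter \<times> letter \<times> letter) set" where
  "bwd S = {(c, d, I1 a b, I2 a b) | a b c d. delta a b c d \<and> {a, b, c, d} \<subseteq> S}
     \<union> {(Ls (Some K), E, I1 (F K) (F K), I2 (F K) (F K)) | K. {F K, Ls (Some K), E} \<subseteq> S}"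

inductive rew :: "letter set \<Rightarrow> letter list \<Rightarrow> letter list \<Rightarrow> bool" for S where
  rew_fwd: "(a, b, n, m) \<in> fwd S \<Longrightarrow> a \<noteq> b \<Longrightarrow> rew S (u @ [a, b] @ v) (u @ [n, m] @ v)"
| rew_tail: "(a, a, n, m) \<in> fwd S \<Longrightarrow> rew S (u @ [a]) (u @ [n, m])"
| rew_bwd: "(a, b, n, m) \<in> bwd S \<Longrightarrow> rew S (u @ [n, m] @ v) (u @ [a, b] @ v)"

lemma tape_simps: "tape x \<Longrightarrow> \<not> head x \<and> \<not> ending x \<and> main x"
  by (cases x) auto

lemma delta_props:
  "delta a b c d \<Longrightarrow> head a \<noteq> head b \<and> head c \<noteq> head d \<and> \<not> ending a \<and> \<not> ending c \<and>
     (ending b \<longleftrightarrow> ending d) \<and> main a \<and> main b \<and> main c \<and> main d \<and> a \<noteq> b \<and> c \<noteq> d"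
  by (erule delta.cases) (auto dest: tape_simps)

lemma fwd_props:
  "(a, b, n, m) \<in> fwd S \<Longrightarrow> (a \<noteq> b \<longrightarrow> head a \<noteq> head b \<and> \<not> ending a) \<and> (a = b \<longrightarrow> head a \<and> ending a)
     \<and> head n \<and> \<not> head m \<and> \<not> ending n \<and> (ending b \<longleftrightarrow> ending m) \<and> main a \<and> main b \<and> \<not> main n \<and> \<not> main m"
  by (auto simp: fwd_def dest: delta_props)

lemma bwd_props:
  "(a, b, n, m) \<in> bwd S \<Longrightarrow> a \<noteq> b \<and> head a \<noteq> head b \<and> \<not> ending a
     \<and> head n \<and> \<not> head m \<and> \<not> ending n \<and> (ending b \<longleftrightarrow> ending m) \<and> main a \<and> main b \<and> \<not> main n \<and> \<not> main m"
  by (auto simp: bwd_def dest: delta_props)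

definition alphabet :: "letter set \<Rightarrow> letter set" where
  "alphabet S = S \<union> {L, Ls None, Al1, Al2} \<union> case_prod I1 ` (S \<times> S) \<union> case_prod I2 ` (S \<times> S)"

lemma fwd_alphabet: "(a, b, n, m) \<in> fwd S \<Longrightarrow> {a, b, n, m} \<subseteq> alphabet S"
  by (auto simp: fwd_def alphabet_def)

lemma bwd_alphabet: "(a, b, n, m) \<in> bwd S \<Longrightarrow> {a, b, n, m} \<subseteq> alphabet S"
  by (auto simp: bwd_def alphabet_def)

lemma finite_alphabet: "finite S \<Longrightarrow> finite (alphabet S)"
  by (simp add: alphabet_def)

definition heads :: "letter list \<Rightarrow> nat" where
  "heads w = length (filter head w)"

text \<open>The single head yields determinism, and having the only ending letter in last place
  confines tail rules to the end of the word.\<close>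

definition valid :: "letter set \<Rightarrow> letter list \<Rightarrow> bool" where
  "valid S w = (heads w = 1 \<and> (\<exists>k. map ending w = replicate k False @ [True]) \<and> set w \<subseteq> alphabet S)"

lemma rew_valid: "rew S x y \<Longrightarrow> valid S x \<longleftrightarrow> valid S y"
proof (induction rule: rew.induct)
  case (rew_fwd a b n m u v)
  note p = fwd_props[OF this(1)] and q = fwd_alphabet[OF this(1)]
  have "heads (u @ [a, b] @ v) = heads (u @ [n, m] @ v)" using p rew_fwd(2) by (auto simp: heads_def)
  moreover have "map ending (u @ [a, b] @ v) = map ending (u @ [n, m] @ v)" using p rew_fwd(2) by auto
  ultimately show ?case using q unfolding valid_def by simp
next
  case (rew_bwd a b n m u v)
  note p = bwd_props[OF this(1)] and q = bwd_alphabet[OF this(1)]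
  have "heads (u @ [a, b] @ v) = heads (u @ [n, m] @ v)" using p by (auto simp: heads_def)
  moreover have "map ending (u @ [a, b] @ v) = map ending (u @ [n, m] @ v)" using p by auto
  ultimately show ?case using q unfolding valid_def by simp
next
  case (rew_tail a n m u)
  note p = fwd_props[OF this(1)] and q = fwd_alphabet[OF this(1)]
  have "heads (u @ [a]) = heads (u @ [n, m])" using p by (auto simp: heads_def)
  moreover have "(\<exists>k. map ending (u @ [a]) = replicate k False @ [True]) \<longleftrightarrow>
      (\<exists>k. map ending (u @ [n, m]) = replicate k False @ [True])" (is "?l \<longleftrightarrow> ?r")
  proof
    assume ?l
    then obtain k where "map ending u = replicate k False" by auto
    then have "map ending (u @ [n, m]) = replicate (Suc k) False @ [True]"
      using p by (auto simp: replicate_append_same)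
    then show ?r by blast
  next
    assume ?r
    then obtain k where k: "map ending u @ [False] = replicate k False" using p by auto
    then obtain k' where "k = Suc k'" by (cases k) auto
    with k have "map ending u = replicate k' False"
      by (metis append_eq_append_conv last_snoc replicate_Suc replicate_append_same butlast_snoc)
    then show ?l using p by auto
  qed
  ultimately show ?case using q unfolding valid_def by simp
qed

lemma rew_length: "rew S x y \<Longrightarrow> length x \<le> length y"
  by (induction rule: rew.induct) auto

text \<open>A word with a single head has at most one redex, the one containing the head.\<close>

definition redex :: "letter list \<Rightarrow> letter \<Rightarrow> letter list \<Rightarrow> letter list \<Rightarrow> bool" where
  "redex p h s x = (case h of
      Rs K \<Rightarrow> (\<exists>b v c d. s = b # v \<and> delta h b c d \<and> x = p @ [I1 h b, I2 h b] @ v)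
    | Ls Z \<Rightarrow> (\<exists>u a. p = u @ [a] \<and> x = u @ (if a = L \<and> Z = None then [Al1, Al2] else [I1 a h, I2 a h]) @ s)
    | F K \<Rightarrow> x = p @ [I1 h h, I2 h h]
    | I1 a b \<Rightarrow> (\<exists>m v c d. s = m # v \<and> x = p @ [c, d] @ v \<and>
        (delta a b c d \<or> (\<exists>K. a = F K \<and> b = F K \<and> c = Ls (Some K) \<and> d = E)))
    | _ \<Rightarrow> False)"

lemma delta_cases_head:
  "delta a b c d \<Longrightarrow> (\<exists>K. a = Rs K \<and> \<not> head b) \<or> (\<exists>Z. b = Ls Z \<and> \<not> head a \<and> (a = L \<longrightarrow> Z \<noteq> None))"
  by (erule delta.cases) (auto dest: tape_simps)

lemma not_delta_F: "\<not> delta (F K) b c d"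
  by (auto elim: delta.cases)

lemma redex_det: "redex p h s x \<Longrightarrow> redex p h s y \<Longrightarrow> x = y"
  unfolding redex_def
  by (cases h) (auto dest: delta_det simp: not_delta_F)

lemma rew_redex: "rew S w x \<Longrightarrow> \<exists>p h s. w = p @ h # s \<and> head h \<and> redex p h s x"
proof (induction rule: rew.induct)
  case (rew_fwd a b n m u v)
  from rew_fwd(1,2) consider (d) c d where "delta a b c d" "n = I1 a b" "m = I2 a b"
    | (al) "a = L" "b = Ls None" "n = Al1" "m = Al2" by (auto simp: fwd_def)
  then show ?case
  proof cases
    case d
    from delta_cases_head[OF d(1)] show ?thesis
    proof (elim disjE exE conjE)
      fix K assume "a = Rs K"
      then show ?thesis using d by (intro exI[of _ u] exI[of _ a] exI[of _ "b # v"]) (auto simp: redex_def)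
    next
      fix Z assume "b = Ls Z" "a = L \<longrightarrow> Z \<noteq> None"
      then show ?thesis using d by (intro exI[of _ "u @ [a]"] exI[of _ b] exI[of _ v]) (auto simp: redex_def)
    qed
  next
    case al
    then show ?thesis by (intro exI[of _ "u @ [a]"] exI[of _ b] exI[of _ v]) (auto simp: redex_def)
  qed
next
  case (rew_tail a n m u)
  then obtain K where "a = F K" "n = I1 a a" "m = I2 a a" by (auto simp: fwd_def dest: delta_props)
  then show ?case by (intro exI[of _ u] exI[of _ a] exI[of _ "[]"]) (auto simp: redex_def)
next
  case (rew_bwd a b n m u v)
  then show ?case
    by (intro exI[of _ u] exI[of _ n] exI[of _ "m # v"]) (auto simp: redex_def bwd_def)
qed

lemma single_head_unique:
  assumes "heads (p @ h # s) = 1" "p @ h # s = p' @ h' # s'" "head h" "head h'"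
  shows "p' = p \<and> h' = h \<and> s' = s"
proof -
  have no: "\<forall>x\<in>set p. \<not> head x" using assms(1,3) by (auto simp: heads_def filter_empty_conv)
  have no': "\<forall>x\<in>set p'. \<not> head x" using assms(1,4) unfolding assms(2) by (auto simp: heads_def filter_empty_conv)
  have "takeWhile (\<lambda>x. \<not> head x) (p @ h # s) = p" using no assms(3) by (simp add: takeWhile_append2)
  moreover have "takeWhile (\<lambda>x. \<not> head x) (p' @ h' # s') = p'" using no' assms(4) by (simp add: takeWhile_append2)
  ultimately have "p' = p" using assms(2) by simp
  then show ?thesis using assms(2) by simp
qed

text \<open>The unique head locates the redex, and \<open>delta\<close> is functional on it.\<close>

lemma rew_det: "heads w = 1 \<Longrightarrow> rew S w x \<Longrightarrow> rew S w y \<Longrightarrow> x = y"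
  by (metis rew_redex redex_det single_head_unique)

section \<open>The finite class of ancestors of a final word\<close>

definition class_of :: "letter set \<Rightarrow> letter list \<Rightarrow> letter list set" where
  "class_of S wn = {w. valid S w \<and> (rew S)\<^sup>*\<^sup>* w wn}"

text \<open>Forwards, the run from x to \<open>wn\<close> is not empty because \<open>wn\<close>
  admits no step, and by determinism it begins with the given step. Backwards, the step is put in
  front of the run.\<close>

lemma class_rew:
  assumes "\<And>y. \<not> rew S wn y" "rew S x y"
  shows "x \<in> class_of S wn \<longleftrightarrow> y \<in> class_of S wn"
proof
  assume x: "x \<in> class_of S wn"
  then have v: "valid S x" "(rew S)\<^sup>*\<^sup>* x wn" by (auto simp: class_of_def)
  from v(2) have "(rew S)\<^sup>*\<^sup>* y wn"
  proof (cases rule: converse_rtranclpE)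
    case base
    then show ?thesis using assms by auto
  next
    case (step z)
    then show ?thesis using rew_det[OF _ assms(2) step(1)] v(1) by (simp add: valid_def)
  qed
  then show "y \<in> class_of S wn" using v rew_valid[OF assms(2)] by (simp add: class_of_def)
next
  assume "y \<in> class_of S wn"
  then show "x \<in> class_of S wn"
    using rew_valid[OF assms(2)] assms(2) by (auto simp: class_of_def intro: converse_rtranclp_into_rtranclp)
qed

lemma rew_star_length: "(rew S)\<^sup>*\<^sup>* x y \<Longrightarrow> length x \<le> length y"
  by (induction rule: rtranclp_induct) (auto dest: rew_length)

text \<open>Steps never shorten a word, so ancestors are at most as long as \<open>wn\<close>, over
  a finite alphabet.\<close>

lemma finite_class: "finite S \<Longrightarrow> finite (class_of S wn)"
  by (rule finite_subset[OF _ finite_lists_length_le[OF finite_alphabet, of S "length wn"]])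
     (auto simp: class_of_def valid_def dest: rew_star_length)

lemma class_ending:
  assumes "u @ a # v \<in> class_of S wn" "ending a" shows "v = []"
proof -
  obtain k where k: "map ending (u @ a # v) = replicate k False @ [True]"
    using assms(1) by (auto simp: class_of_def valid_def)
  have "map ending v = []"
  proof (rule ccontr)
    assume "map ending v \<noteq> []"
    then obtain v' z where v: "map ending v = v' @ [z]" by (metis rev_exhaust)
    then have "map ending u @ True # v' = replicate k False" using k assms(2) by simp
    then have "True \<in> set (replicate k False)" by (metis in_set_conv_decomp)
    then show False by simp
  qed
  then show ?thesis by simp
qed

lemma class_pair:
  assumes t: "\<And>y. \<not> rew S wn y" and q: "(a, b, n, m) \<in> fwd S \<union> bwd S" "a \<noteq> b"
  shows "u @ [a, b] @ v \<in> class_of S wn \<longleftrightarrow> u @ [n, m] @ v \<in> class_of S wn"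
  using q class_rew[OF t rew_fwd[of a b n m S u v]] class_rew[OF t rew_bwd[of a b n m S u v]] by auto

lemma class_tail:
  assumes t: "\<And>y. \<not> rew S wn y" and q: "(a, a, n, m) \<in> fwd S \<union> bwd S"
  shows "u @ [a] \<in> class_of S wn \<longleftrightarrow> u @ [n, m] \<in> class_of S wn"
    "u @ [a] @ v \<in> class_of S wn \<Longrightarrow> v = []" "u @ [n, m] @ v \<in> class_of S wn \<Longrightarrow> v = []"
proof -
  have f: "(a, a, n, m) \<in> fwd S" using q bwd_props[of a a n m S] by auto
  note p = fwd_props[OF f]
  show "u @ [a] \<in> class_of S wn \<longleftrightarrow> u @ [n, m] \<in> class_of S wn"
    by (rule class_rew[OF t rew_tail[OF f]])
  show "v = []" if "u @ [a] @ v \<in> class_of S wn"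
    using class_ending[of u a v] that p by auto
  show "v = []" if "u @ [n, m] @ v \<in> class_of S wn"
    using class_ending[of "u @ [n]" m v] that p by auto
qed

text \<open>\<open>Al1\<close> is a head without a redex. A valid word with the alarm therefore
  admits no step and could only be \<open>wn\<close> itself.\<close>

lemma class_no_alarm:
  assumes "Al1 \<notin> set wn"
  shows "u @ [Al1, Al2] @ v \<notin> class_of S wn"
proof
  assume a: "u @ [Al1, Al2] @ v \<in> class_of S wn"
  let ?w = "u @ [Al1, Al2] @ v"
  have h: "heads ?w = 1" and r: "(rew S)\<^sup>*\<^sup>* ?w wn" using a by (auto simp: class_of_def valid_def)
  from r show False
  proof (cases rule: converse_rtranclpE)
    case base
    then show ?thesis using assms by auto
  next
    case (step z)
    from rew_redex[OF step(1)] obtain p h s where "?w = p @ h # s" "head h" "redex p h s z" by blast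
    with single_head_unique[of u Al1 "Al2 # v" p h s] h show False by (simp add: redex_def)
  qed
qed

section \<open>Simulating a program by rewriting\<close>

lemma rew_delta:
  assumes "delta a b c d" "{a, b, c, d} \<subseteq> S"
  shows "(rew S)\<^sup>*\<^sup>* (u @ a # b # v) (u @ c # d # v)"
proof -
  have "(a, b, I1 a b, I2 a b) \<in> fwd S" "(c, d, I1 a b, I2 a b) \<in> bwd S"
    using assms by (auto simp: fwd_def bwd_def)
  then have "rew S (u @ [a, b] @ v) (u @ [I1 a b, I2 a b] @ v)" "rew S (u @ [I1 a b, I2 a b] @ v) (u @ [c, d] @ v)"
    using delta_props[OF assms(1)] by (auto intro: rew_fwd rew_bwd simp del: append.simps)
  then show ?thesis by (simp add: converse_rtranclp_into_rtranclp)
qed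

lemma rew_F:
  assumes "{F K, Ls (Some K), E} \<subseteq> S"
  shows "(rew S)\<^sup>*\<^sup>* (u @ [F K]) (u @ [Ls (Some K), E])"
proof -
  have "(F K, F K, I1 (F K) (F K), I2 (F K) (F K)) \<in> fwd S" "(Ls (Some K), E, I1 (F K) (F K), I2 (F K) (F K)) \<in> bwd S"
    using assms by (auto simp: fwd_def bwd_def)
  then have "rew S (u @ [F K]) (u @ [I1 (F K) (F K), I2 (F K) (F K)])"
    "rew S (u @ [I1 (F K) (F K), I2 (F K) (F K)] @ []) (u @ [Ls (Some K), E] @ [])"
    by (auto simp del: append.simps append_Nil2 intro: rew_tail rew_bwd)
  then show ?thesis by (simp add: converse_rtranclp_into_rtranclp)
qed

lemma sweep_right:
  "(\<And>x. x \<in> set t \<Longrightarrow> tape x \<and> \<not> hits K x \<and> x \<in> S) \<Longrightarrow> Rs K \<in> S \<Longrightarrow>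
     (rew S)\<^sup>*\<^sup>* (u @ Rs K # t @ v) (u @ t @ Rs K # v)"
proof (induction t arbitrary: u)
  case (Cons x t)
  have "(rew S)\<^sup>*\<^sup>* (u @ Rs K # x # t @ v) (u @ x # Rs K # t @ v)"
    by (rule rew_delta[OF delta_right]) (use Cons.prems in auto)
  moreover have "(rew S)\<^sup>*\<^sup>* ((u @ [x]) @ Rs K # t @ v) ((u @ [x]) @ t @ Rs K # v)"
    by (rule Cons.IH) (use Cons.prems in auto)
  ultimately show ?case by simp
qed simp

lemma sweep_left:
  "(\<And>x. x \<in> set t \<Longrightarrow> tape x \<and> x \<in> S) \<Longrightarrow> Ls Z \<in> S \<Longrightarrow>
     (rew S)\<^sup>*\<^sup>* (u @ t @ Ls Z # v) (u @ Ls Z # t @ v)"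
proof (induction t arbitrary: v rule: rev_induct)
  case (snoc x t)
  have "(rew S)\<^sup>*\<^sup>* ((u @ t) @ x # Ls Z # v) ((u @ t) @ Ls Z # x # v)"
    by (rule rew_delta[OF delta_left]) (use snoc.prems in auto)
  moreover have "(rew S)\<^sup>*\<^sup>* (u @ t @ Ls Z # x # v) (u @ Ls Z # t @ x # v)"
    by (rule snoc.IH) (use snoc.prems in auto)
  ultimately show ?case by simp
qed simp

lemma sweep_return:
  assumes "\<And>x. x \<in> set t \<Longrightarrow> tape x \<and> x \<in> S" "{L, Ls (Some K), Rs K} \<subseteq> S"
  shows "(rew S)\<^sup>*\<^sup>* (L # t @ Ls (Some K) # v) (L # Rs K # t @ v)"
proof -
  have "(rew S)\<^sup>*\<^sup>* ([L] @ t @ Ls (Some K) # v) ([L] @ Ls (Some K) # t @ v)"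
    by (rule sweep_left) (use assms in auto)
  moreover have "(rew S)\<^sup>*\<^sup>* ([] @ L # Ls (Some K) # t @ v) ([] @ L # Rs K # t @ v)"
    by (rule rew_delta[OF delta_turn]) (use assms in auto)
  ultimately show ?thesis by simp
qed

definition letters :: "com list set \<Rightarrow> nat set \<Rightarrow> letter set" where
  "letters M G = {L, E, B, Ls None} \<union> A ` G \<union> Rs ` M \<union> (\<lambda>K. Ls (Some K)) ` M \<union> F ` M"

definition represents :: "nat set \<Rightarrow> letter list \<Rightarrow> (nat \<Rightarrow> nat) \<Rightarrow> bool" where
  "represents G t \<rho> = (set t \<subseteq> insert B (A ` G) \<and> (\<forall>r. count_list t (A r) = \<rho> r))"

definition word :: "com list \<Rightarrow> letter list \<Rightarrow> letter list" where
  "word K t = L # Rs K # t @ [E]"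

lemma represents_letters:
  "represents G t \<rho> \<Longrightarrow> x \<in> set t \<Longrightarrow> tape x \<and> x \<in> letters M G"
  by (auto simp: represents_def letters_def)

lemma hits_iff: "hits K x \<longleftrightarrow> (\<exists>r P K'. K = Loop r P # K' \<and> x = A r) \<or> (K = [] \<and> x = A 1)"
  by (cases "(K, x)" rule: hits.cases) auto

fun register :: "com list \<Rightarrow> nat" where
  "register [] = 1" | "register (Inc r # K) = r" | "register (Loop r P # K) = r"

text \<open>The state sweeps right to the letter that decides its command, acts there, and sweeps
  back to L. An increment appends a cell at the right end and a decrement blanks the leftmost cell
  of its register; only the number of cells per register matters.\<close>

lemma simulate_step:
  assumes "mstep (K, \<rho>) (K', \<rho>')" "represents G t \<rho>" "K \<in> M" "K' \<in> M" "register ` M \<subseteq> G"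
  shows "\<exists>t'. represents G t' \<rho>' \<and> (rew (letters M G))\<^sup>*\<^sup>* (word K t) (word K' t')"
proof -
  let ?S = "letters M G"
  note tp = represents_letters[OF assms(2), of _ M]
  have reg: "register K \<in> G" using assms(3,5) by auto
  have S: "{L, E, B, Rs K, Rs K', Ls (Some K), Ls (Some K'), F K, F K', A (register K)} \<subseteq> ?S"
    using assms(3,4) reg by (auto simp: letters_def)
  from assms(1) show ?thesis
  proof cases
    case (mstep_Inc r)
    then have K: "K = Inc r # K'" "\<rho>' = \<rho>(r := Suc (\<rho> r))" by auto
    have rp: "represents G (t @ [A r]) \<rho>'" using assms(2) reg K by (auto simp: represents_def)
    have "(rew ?S)\<^sup>*\<^sup>* ([L] @ Rs K # t @ [E]) ([L] @ t @ Rs K # [E])"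
      by (rule sweep_right) (use tp S K in \<open>auto simp: hits_iff\<close>)
    moreover have "(rew ?S)\<^sup>*\<^sup>* ((L # t) @ Rs K # E # []) ((L # t) @ A r # F K' # [])"
      unfolding K(1) by (rule rew_delta[OF delta_inc]) (use S K in auto)
    moreover have "(rew ?S)\<^sup>*\<^sup>* ((L # t @ [A r]) @ [F K']) ((L # t @ [A r]) @ [Ls (Some K'), E])"
      by (rule rew_F) (use S in auto)
    moreover have "(rew ?S)\<^sup>*\<^sup>* (L # (t @ [A r]) @ Ls (Some K') # [E]) (L # Rs K' # (t @ [A r]) @ [E])"
      by (rule sweep_return) (use represents_letters[OF rp, of _ M] S in auto)
    ultimately have "(rew ?S)\<^sup>*\<^sup>* (word K t) (word K' (t @ [A r]))" by (simp add: word_def)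
    with rp show ?thesis by blast
  next
    case (mstep_Loop0 r P)
    then have K: "K = Loop r P # K'" "\<rho>' = \<rho>" "\<rho> r = 0" by auto
    then have "A r \<notin> set t" using assms(2) by (metis represents_def count_list_0_iff)
    then have "(rew ?S)\<^sup>*\<^sup>* ([L] @ Rs K # t @ [E]) ([L] @ t @ Rs K # [E])"
      by (intro sweep_right) (use tp S K in \<open>auto simp: hits_iff\<close>)
    moreover have "(rew ?S)\<^sup>*\<^sup>* ((L # t) @ Rs K # E # []) ((L # t) @ Ls (Some K') # E # [])"
      unfolding K(1) by (rule rew_delta[OF delta_loop0]) (use S K in auto)
    moreover have "(rew ?S)\<^sup>*\<^sup>* (L # t @ Ls (Some K') # [E]) (L # Rs K' # t @ [E])"
      by (rule sweep_return) (use tp S in auto)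
    ultimately have "(rew ?S)\<^sup>*\<^sup>* (word K t) (word K' t)" by (simp add: word_def)
    with assms(2) K show ?thesis by blast
  next
    case (mstep_LoopS r k P K0)
    then have K: "K = Loop r P # K0" "K' = P @ Loop r P # K0" "\<rho>' = \<rho>(r := k)" "\<rho> r = Suc k" by auto
    have "count_list t (A r) \<noteq> 0" using assms(2) K(4) by (auto simp: represents_def)
    then have "A r \<in> set t" by (metis count_list_0_iff)
    then obtain t1 t2 where t: "t = t1 @ A r # t2" "A r \<notin> set t1" by (metis split_list_first)
    have c: "count_list t (A s) = \<rho> s" for s using assms(2) by (simp add: represents_def)
    have "count_list (t1 @ B # t2) (A s) = \<rho>' s" for s
      using c[of s] K(3,4) by (auto simp: t(1) split: if_splits)
    then have rp: "represents G (t1 @ B # t2) \<rho>'"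
      using assms(2) by (auto simp: represents_def t)
    have "(rew ?S)\<^sup>*\<^sup>* ([L] @ Rs K # t1 @ (A r # t2 @ [E])) ([L] @ t1 @ Rs K # (A r # t2 @ [E]))"
      by (rule sweep_right) (use tp S K t in \<open>auto simp: hits_iff\<close>)
    moreover have "(rew ?S)\<^sup>*\<^sup>* ((L # t1) @ Rs K # A r # t2 @ [E]) ((L # t1) @ Ls (Some K') # B # t2 @ [E])"
      unfolding K(1,2) by (rule rew_delta[OF delta_loopS]) (use S K in auto)
    moreover have "(rew ?S)\<^sup>*\<^sup>* (L # t1 @ Ls (Some K') # (B # t2 @ [E])) (L # Rs K' # t1 @ (B # t2 @ [E]))"
      by (rule sweep_return) (use tp S t in auto)
    ultimately have "(rew ?S)\<^sup>*\<^sup>* (word K t) (word K' (t1 @ B # t2))" by (simp add: word_def t)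
    with rp show ?thesis by blast
  qed
qed

lemma mstep_nonempty: "mstep (K, \<rho>) x \<Longrightarrow> K \<noteq> []"
  by (auto elim: mstep.cases)

lemma simulate_run:
  assumes "mstep\<^sup>*\<^sup>* (P, \<rho>0) (K, \<rho>)" "represents G t0 \<rho>0" "register ` labels P [] \<subseteq> G"
  shows "K \<in> labels P [] \<and> (\<exists>t. represents G t \<rho> \<and> (rew (letters (labels P []) G))\<^sup>*\<^sup>* (word P t0) (word K t))"
  using assms(1)
proof (induction "(K, \<rho>)" arbitrary: K \<rho> rule: rtranclp_induct)
  case base
  then show ?case using labels_start[of P "[]"] assms(2) by auto
next
  case (step y)
  obtain K1 \<rho>1 where y: "y = (K1, \<rho>1)" by (cases y)
  from step(3)[OF y] obtain t where t: "K1 \<in> labels P []" "represents G t \<rho>1"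
    "(rew (letters (labels P []) G))\<^sup>*\<^sup>* (word P t0) (word K1 t)" by blast
  have K: "K \<in> labels P []"
    using labels_mstep[OF t(1)] step(2) mstep_nonempty unfolding y by blast
  from simulate_step[OF step(2)[unfolded y] t(2,1) K assms(3)] t(3) K show ?case
    by (meson rtranclp_trans)
qed

definition start_word :: "com list \<Rightarrow> nat \<Rightarrow> letter list" where
  "start_word P x = L # Rs P # replicate x (A 0) @ [E]"

text \<open>The set S depends on the program only and serves all inputs x, so the rules can be coded
  by a number that afterwards becomes the input.\<close>

lemma program_words:
  obtains S where "finite S" "{L, E, A 0, Rs P, Ls None} \<subseteq> S"
    "\<And>x y. mstep\<^sup>*\<^sup>* (P, (\<lambda>_. 0)(0 := x)) ([], (\<lambda>_. 0)(0 := x, 1 := y)) \<Longrightarrow> y = 0 \<Longrightarrow>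
        \<exists>v. (rew S)\<^sup>*\<^sup>* (start_word P x) (Al1 # Al2 # v)"
    "\<And>x y. mstep\<^sup>*\<^sup>* (P, (\<lambda>_. 0)(0 := x)) ([], (\<lambda>_. 0)(0 := x, 1 := y)) \<Longrightarrow> y \<noteq> 0 \<Longrightarrow>
        \<exists>wn. (rew S)\<^sup>*\<^sup>* (start_word P x) wn \<and> (\<forall>z. \<not> rew S wn z) \<and> Al1 \<notin> set wn"
proof -
  define M where "M = labels P []"
  define G where "G = insert 0 (register ` M)"
  define S where "S = letters M G"
  have fin: "finite S" by (simp add: S_def letters_def G_def M_def finite_labels)
  have mem: "P \<in> M" "[] \<in> M" using labels_start[of P "[]"] labels_end[of "[]" P] by (auto simp: M_def)
  then have "1 \<in> G" unfolding G_def by force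
  then have S: "{L, E, A 0, A 1, Rs P, Rs [], Ls None} \<subseteq> S" using mem by (auto simp: S_def letters_def G_def)
  have rp0: "represents G (replicate x (A 0)) ((\<lambda>_. 0)(0 := x))" for x
  proof -
    have "count_list (replicate x (A 0)) (A r) = ((\<lambda>_. 0)(0 := x)) r" for r by (induction x) auto
    then show ?thesis by (auto simp: represents_def G_def)
  qed
  have run: "\<exists>t. represents G t ((\<lambda>_. 0)(0 := x, 1 := y)) \<and> (rew S)\<^sup>*\<^sup>* (start_word P x) (word [] t)"
    if "mstep\<^sup>*\<^sup>* (P, (\<lambda>_. 0)(0 := x)) ([], (\<lambda>_. 0)(0 := x, 1 := y))" for x y
    using simulate_run[OF that rp0, unfolded word_def, folded M_def]
    by (simp add: S_def G_def start_word_def word_def subset_insertI)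
  show thesis
  proof (rule that[OF fin])
    show "{L, E, A 0, Rs P, Ls None} \<subseteq> S" using S by auto
  next
    fix x y assume r: "mstep\<^sup>*\<^sup>* (P, (\<lambda>_. 0)(0 := x)) ([], (\<lambda>_. 0)(0 := x, 1 := y))" and y: "y = (0::nat)"
    from run[OF r] obtain t where t: "represents G t ((\<lambda>_. 0)(0 := x, 1 := y))" "(rew S)\<^sup>*\<^sup>* (start_word P x) (word [] t)"
      by blast
    note tp = represents_letters[OF t(1), of _ M, folded S_def]
    have "count_list t (A 1) = 0" using t(1) y by (simp add: represents_def)
    then have A1: "A 1 \<notin> set t" by (metis count_list_0_iff)
    note t(2)
    also have "(rew S)\<^sup>*\<^sup>* (word [] t) ((L # t) @ Rs [] # E # [])"
      using sweep_right[of t "[]" S "[L]" "[E]"] tp A1 S by (auto simp: word_def hits_iff)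
    also have "(rew S)\<^sup>*\<^sup>* ((L # t) @ Rs [] # E # []) ((L # t) @ Ls None # E # [])"
      by (rule rew_delta[OF delta_halt0]) (use S in auto)
    also have "(rew S)\<^sup>*\<^sup>* ((L # t) @ Ls None # E # []) (L # Ls None # t @ [E])"
      using sweep_left[of t S None "[L]" "[E]"] tp S by auto
    also have "(rew S)\<^sup>*\<^sup>* (L # Ls None # t @ [E]) (Al1 # Al2 # t @ [E])"
      using rew_fwd[of L "Ls None" Al1 Al2 S "[]" "t @ [E]"] by (auto simp: fwd_def)
    finally show "\<exists>v. (rew S)\<^sup>*\<^sup>* (start_word P x) (Al1 # Al2 # v)" by blast
  next
    fix x y assume r: "mstep\<^sup>*\<^sup>* (P, (\<lambda>_. 0)(0 := x)) ([], (\<lambda>_. 0)(0 := x, 1 := y))" and y: "y \<noteq> (0::nat)"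
    from run[OF r] obtain t where t: "represents G t ((\<lambda>_. 0)(0 := x, 1 := y))" "(rew S)\<^sup>*\<^sup>* (start_word P x) (word [] t)"
      by blast
    note tp = represents_letters[OF t(1), of _ M, folded S_def]
    have "count_list t (A 1) \<noteq> 0" using t(1) y by (simp add: represents_def)
    then have "A 1 \<in> set t" by (metis count_list_0_iff)
    then obtain t1 t2 where t12: "t = t1 @ A 1 # t2" "A 1 \<notin> set t1" by (metis split_list_first)
    let ?wn = "(L # t1) @ Rs [] # A 1 # t2 @ [E]"
    have "(rew S)\<^sup>*\<^sup>* (word [] t) ?wn"
      using sweep_right[of t1 "[]" S "[L]" "A 1 # t2 @ [E]"] tp t12 S by (auto simp: word_def hits_iff)
    moreover have "\<not> rew S ?wn z" for z
    proof
      assume "rew S ?wn z"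
      from rew_redex[OF this] obtain p h s where p: "?wn = p @ h # s" "head h" "redex p h s z" by blast
      have "\<forall>x\<in>set t. \<not> head x" using tp tape_simps by blast
      then have "heads ?wn = 1" by (auto simp: heads_def t12)
      from single_head_unique[OF this p(1) _ p(2)] have "h = Rs []" "s = A 1 # t2 @ [E]" by simp_all
      with p(3) have "\<exists>c d. delta (Rs []) (A 1) c d" by (auto simp: redex_def)
      then show False by (auto elim: delta.cases)
    qed
    moreover have "Al1 \<notin> set ?wn" using tp[of Al1] t12(1) by auto
    ultimately show "\<exists>wn. (rew S)\<^sup>*\<^sup>* (start_word P x) wn \<and> (\<forall>z. \<not> rew S wn z) \<and> Al1 \<notin> set wn"
      using t(2) by (meson rtranclp_trans)
  qed
qed

section \<open>Diagonalisation\<close>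

lemma map_decompose:
  assumes "inj_on f X" "set w \<subseteq> X" "set x \<subseteq> X" "map f w = u @ map f x @ v"
  shows "\<exists>u' v'. w = u' @ x @ v' \<and> u = map f u' \<and> v = map f v'"
proof -
  from assms(4) obtain u' w' where 1: "w = u' @ w'" "u = map f u'" "map f x @ v = map f w'"
    unfolding map_eq_append_conv by metis
  from 1(3)[symmetric] obtain x' v' where 2: "w' = x' @ v'" "map f x = map f x'" "v = map f v'"
    unfolding map_eq_append_conv by metis
  have "set x' \<subseteq> X" using assms(2) 1 2 by simp
  then have "inj_on f (set x \<union> set x')" using assms(1,3) by (meson Un_least inj_on_subset)
  then have "x = x'" using 2(2) by (simp add: inj_on_map_eq_map)
  with 1 2 show ?thesis by blast
qed

text \<open>Occurrences of a factor in the numbered words come from occurrences in the original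
  words, by injectivity of f; closure properties thus carry over to the image.\<close>

lemma map_image_exchange:
  assumes "inj_on f X" "\<And>w. w \<in> C \<Longrightarrow> set w \<subseteq> X" "set x \<subseteq> X"
    and "\<And>u v. u @ x @ v \<in> C \<Longrightarrow> u @ y @ v \<in> C" "u @ map f x @ v \<in> map f ` C"
  shows "u @ map f y @ v \<in> map f ` C"
proof -
  from assms(5) obtain w where w: "w \<in> C" "map f w = u @ map f x @ v" by auto
  from map_decompose[OF assms(1) assms(2)[OF w(1)] assms(3) w(2)] obtain u' v'
    where "w = u' @ x @ v'" "u = map f u'" "v = map f v'" by blast
  then show ?thesis using assms(4)[of u' v'] w(1) by (auto intro!: image_eqI[of _ _ "u' @ y @ v'"])
qed

definition rule_code :: "nat \<times> nat \<times> nat \<times> nat \<Rightarrow> nat" where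
  "rule_code = (\<lambda>(a, b, n, m). prod_encode (prod_encode (a, b), prod_encode (n, m)))"

lemma rule_of_code: "rule_of (rule_code q) = q"
  by (cases q) (simp add: rule_of_def rule_code_def)

lemma rules_set_encode: "finite Q \<Longrightarrow> rules (set_encode (rule_code ` Q)) = Q"
  by (simp add: rules_def set_encode_inverse image_image rule_of_code)

lemma rules_less:
  assumes "(a, b, n, m) \<in> rules e"
  shows "a < e \<and> b < e \<and> n < e \<and> m < e"
proof -
  from assms obtain j where j: "j \<in> set_decode e" "rule_of j = (a, b, n, m)" by (auto simp: rules_def)
  have "fst (prod_decode k) \<le> k" "snd (prod_decode k) \<le> k" for k
    using le_prod_encode_1[of "fst (prod_decode k)" "snd (prod_decode k)"]
      le_prod_encode_2[of "snd (prod_decode k)" "fst (prod_decode k)"] by simp_all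
  moreover have "a = fst (prod_decode (fst (prod_decode j)))" "b = snd (prod_decode (fst (prod_decode j)))"
    "n = fst (prod_decode (snd (prod_decode j)))" "m = snd (prod_decode (snd (prod_decode j)))"
    using j(2) unfolding rule_of_def by (auto simp only: prod.inject)
  ultimately have "a \<le> j \<and> b \<le> j \<and> n \<le> j \<and> m \<le> j" by (metis order.trans)
  then show ?thesis using set_decode_less[OF j(1)] by auto
qed

locale coded =
  fixes S :: "letter set" and P :: "com list" and f :: "letter \<Rightarrow> nat" and e :: nat
  assumes fin: "finite S" and mem: "{L, E, A 0, Rs P, Ls None} \<subseteq> S"
    and inj: "inj_on f (alphabet S)"
    and f: "f L = 0" "f (A 0) = 1" "f E = 2" "f Al1 = 3" "f Al2 = 4" "f (Rs P) = 5"
    and rules: "rules e = (\<lambda>(a, b, n, m). (f a, f b, f n, f m)) ` (fwd S \<union> bwd S)"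
begin

definition nmain :: "nat \<Rightarrow> bool" where
  "nmain k = main (inv_into (alphabet S) f k)"

text \<open>Serves as the predicate \<open>Z\<close> of the counterexample. Rules respect it because
  the second letters of both sides are ending or not together, while first letters are not ending; a
  doubled tail letter is ending, and so is the second letter of its expansion.\<close>

definition ninner :: "nat \<Rightarrow> bool" where
  "ninner k = (\<not> ending (inv_into (alphabet S) f k))"

lemma nmain: "x \<in> alphabet S \<Longrightarrow> nmain (f x) = main x"
  by (simp add: nmain_def inv_into_f_f[OF inj])

lemma ninner: "x \<in> alphabet S \<Longrightarrow> ninner (f x) = (\<not> ending x)"
  by (simp add: ninner_def inv_into_f_f[OF inj])

lemma mem_alphabet: "{L, E, A 0, Rs P, Al1, Al2} \<subseteq> alphabet S"
  using mem by (auto simp: alphabet_def)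

lemma fixed: "nmain 0" "nmain 1" "nmain 2" "nmain 5" "\<not> nmain 3" "\<not> nmain 4"
  "ninner 3" "ninner 4" "\<not> ninner 2"
  using mem_alphabet nmain[of L] nmain[of "A 0"] nmain[of E] nmain[of "Rs P"] nmain[of Al1] nmain[of Al2]
    ninner[of Al1] ninner[of Al2] ninner[of E] by (simp_all add: f)

lemma rulesE:
  assumes "(a, b, n, m) \<in> rules e"
  obtains a' b' n' m' where "(a', b', n', m') \<in> fwd S \<union> bwd S" "a = f a'" "b = f b'" "n = f n'" "m = f m'"
    "{a', b', n', m'} \<subseteq> alphabet S" "a = b \<longleftrightarrow> a' = b'"
proof -
  from assms obtain a' b' n' m' where q: "(a', b', n', m') \<in> fwd S \<union> bwd S" "a = f a'" "b = f b'" "n = f n'" "m = f m'"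
    unfolding rules by auto
  have al: "{a', b', n', m'} \<subseteq> alphabet S" using q(1) fwd_alphabet bwd_alphabet by blast
  then have "a = b \<longleftrightarrow> a' = b'" using inj_on_eq_iff[OF inj, of a' b'] q by simp
  with q al show thesis using that by blast
qed

lemma rules_props:
  assumes "(a, b, n, m) \<in> rules e"
  shows "nmain a \<and> nmain b \<and> \<not> nmain n \<and> \<not> nmain m \<and> a < e + 6 \<and> b < e + 6 \<and> n < e + 6 \<and> m < e + 6"
    "ninner a \<and> ninner b \<longleftrightarrow> ninner n \<and> ninner m"
proof -
  obtain a' b' n' m' where q: "(a', b', n', m') \<in> fwd S \<union> bwd S" "a = f a'" "b = f b'" "n = f n'" "m = f m'"
    "{a', b', n', m'} \<subseteq> alphabet S" by (rule rulesE[OF assms])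
  have props: "main a' \<and> main b' \<and> \<not> main n' \<and> \<not> main m' \<and> (ending b' \<longleftrightarrow> ending m') \<and> \<not> ending n' \<and>
      (a' \<noteq> b' \<longrightarrow> \<not> ending a') \<and> (a' = b' \<longrightarrow> ending a')"
    using q(1) fwd_props[of a' b' n' m' S] bwd_props[of a' b' n' m' S] by blast
  then show "nmain a \<and> nmain b \<and> \<not> nmain n \<and> \<not> nmain m \<and> a < e + 6 \<and> b < e + 6 \<and> n < e + 6 \<and> m < e + 6"
    using q(6) nmain rules_less[OF assms] unfolding q(2-5) by simp
  show "ninner a \<and> ninner b \<longleftrightarrow> ninner n \<and> ninner m"
    using props q(6) ninner unfolding q(2-5) by auto
qed

lemma start: "map f (start_word P e) = map (start_letter e) [0..<e + 3]"
proof (rule nth_equalityI)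
  fix i assume "i < length (map f (start_word P e))"
  then have "i < e + 3" by (simp add: start_word_def)
  then show "map f (start_word P e) ! i = map (start_letter e) [0..<e + 3] ! i"
    by (auto simp: start_word_def start_letter_def f nth_Cons nth_append split: nat.splits)
qed (simp add: start_word_def)

lemma rew_thue: "rew S x y \<Longrightarrow> thue (rules e) (map f x) (map f y)"
proof (induction rule: rew.induct)
  case (rew_fwd a b n m u v)
  then have "(f a, f b, f n, f m) \<in> rules e" unfolding rules by force
  moreover have "f a \<noteq> f b" using inj_on_eq_iff[OF inj, of a b] fwd_alphabet[OF rew_fwd(1)] rew_fwd(2) by simp
  ultimately show ?case using thue_fwd[of "f a" "f b" "f n" "f m" "rules e" "map f u" "map f v"] by simp
next
  case (rew_tail a n m u)
  then have "(f a, f a, f n, f m) \<in> rules e" unfolding rules by force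
  then show ?case using thue_tail[of "f a" "f n" "f m" "rules e" "map f u"] by simp
next
  case (rew_bwd a b n m u v)
  then have "(f a, f b, f n, f m) \<in> rules e" unfolding rules by force
  moreover have "f a \<noteq> f b" using inj_on_eq_iff[OF inj, of a b] bwd_alphabet[OF rew_bwd(1)] bwd_props[OF rew_bwd(1)] by simp
  ultimately show ?case using thue_bwd[of "f a" "f b" "f n" "f m" "rules e" "map f u" "map f v"] by simp
qed

lemma determined:
  assumes "(rew S)\<^sup>*\<^sup>* (start_word P e) (Al1 # Al2 # v)"
  shows "fin_determines (sig (legs e)) (queries e) (goal_query (legs e))"
proof (rule alarm_fin_determines[of e nmain])
  have "(thue (rules e))\<^sup>*\<^sup>* (map f (start_word P e)) (map f (Al1 # Al2 # v))"
    using assms by (induction rule: rtranclp_induct) (auto intro: rtranclp.rtrancl_into_rtrancl rew_thue)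
  then show "(thue (rules e))\<^sup>*\<^sup>* (map (start_letter e) [0..<e + 3]) (3 # 4 # map f v)"
    unfolding start by (simp add: f)
qed (use rules_props fixed in auto)

lemma start_valid: "valid S (start_word P e)"
proof -
  have "map ending (start_word P e) = replicate (e + 2) False @ [True]" by (simp add: start_word_def)
  moreover have "heads (start_word P e) = 1" by (simp add: start_word_def heads_def)
  moreover have "set (start_word P e) \<subseteq> alphabet S" using mem_alphabet by (auto simp: start_word_def)
  ultimately show ?thesis unfolding valid_def by blast
qed

lemma not_determined:
  assumes run: "(rew S)\<^sup>*\<^sup>* (start_word P e) wn" and halt: "\<And>z. \<not> rew S wn z" and no: "Al1 \<notin> set wn"
  shows "\<not> fin_determines (sig (legs e)) (queries e) (goal_query (legs e))"
proof -
  let ?C = "class_of S wn"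
  have C: "set w \<subseteq> alphabet S" if "w \<in> ?C" for w using that by (simp add: class_of_def valid_def)
  have exchange: "u @ map f y @ v \<in> map f ` ?C"
    if "set x \<subseteq> alphabet S" "\<And>u v. u @ x @ v \<in> ?C \<Longrightarrow> u @ y @ v \<in> ?C" "u @ map f x @ v \<in> map f ` ?C" for x y u v
    by (rule map_image_exchange[OF inj C that])
  interpret countermodel e nmain ninner "map f ` ?C"
  proof
    show "finite (map f ` ?C)" using finite_class[OF fin] by simp
    show "map (start_letter e) [0..<e + 3] \<in> map f ` ?C"
      unfolding start[symmetric] using start_valid run by (auto simp: class_of_def)
  next
    fix a b n m u v assume r: "(a, b, n, m) \<in> rules e" and ne: "a \<noteq> b"
    obtain a' b' n' m' where q: "(a', b', n', m') \<in> fwd S \<union> bwd S" "a = f a'" "b = f b'" "n = f n'" "m = f m'"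
      "{a', b', n', m'} \<subseteq> alphabet S" "a = b \<longleftrightarrow> a' = b'" by (rule rulesE[OF r])
    have ne': "a' \<noteq> b'" using ne q(7) by simp
    have eq: "u @ [a', b'] @ v \<in> ?C \<longleftrightarrow> u @ [n', m'] @ v \<in> ?C" for u v
      by (rule class_pair[OF halt q(1) ne'])
    show "u @ [a, b] @ v \<in> map f ` ?C \<longleftrightarrow> u @ [n, m] @ v \<in> map f ` ?C"
      using exchange[where x = "[a', b']" and y = "[n', m']" and u = u and v = v]
        exchange[where x = "[n', m']" and y = "[a', b']" and u = u and v = v] eq q(6) unfolding q(2-5) by auto
  next
    fix a n m u assume r: "(a, a, n, m) \<in> rules e"
    obtain a' b' n' m' where q: "(a', b', n', m') \<in> fwd S \<union> bwd S" "a = f a'" "a = f b'" "n = f n'" "m = f m'"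
      "{a', b', n', m'} \<subseteq> alphabet S" "a = a \<longleftrightarrow> a' = b'" by (rule rulesE[OF r])
    have r': "(a', a', n', m') \<in> fwd S \<union> bwd S" using q by simp
    \<comment> \<open>For nonempty v both sides fail, since ending letters occur only in last
      place.\<close>
    have t: "u @ [a'] @ v \<in> ?C \<longleftrightarrow> u @ [n', m'] @ v \<in> ?C" for u v
    proof (cases "v = []")
      case True
      then show ?thesis using class_tail(1)[OF halt r', of u] by simp
    next
      case False
      then show ?thesis using class_tail(2,3)[OF halt r', of u v] by blast
    qed
    show "u @ [a] \<in> map f ` ?C \<longleftrightarrow> u @ [n, m] \<in> map f ` ?C"
      using exchange[where x = "[a']" and y = "[n', m']" and u = u and v = "[]"]
        exchange[where x = "[n', m']" and y = "[a']" and u = u and v = "[]"] t q(6) unfolding q(2,4,5) by auto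
  next
    fix a n m u v assume r: "(a, a, n, m) \<in> rules e"
    obtain a' b' n' m' where q: "(a', b', n', m') \<in> fwd S \<union> bwd S" "a = f a'" "a = f b'" "n = f n'" "m = f m'"
      "{a', b', n', m'} \<subseteq> alphabet S" "a = a \<longleftrightarrow> a' = b'" by (rule rulesE[OF r])
    have r': "(a', a', n', m') \<in> fwd S \<union> bwd S" using q by simp
    show "v = []" if "u @ [a] @ v \<in> map f ` ?C"
    proof -
      from that obtain w where w: "w \<in> ?C" "map f w = u @ map f [a'] @ v" unfolding q(2) by auto
      from map_decompose[OF inj C[OF w(1)] _ w(2)] q(6) obtain u' v' where "w = u' @ [a'] @ v'" "v = map f v'" by auto
      then show ?thesis using class_tail(2)[OF halt r', of u' v'] w(1) by simp
    qed
    show "v = []" if "u @ [n, m] @ v \<in> map f ` ?C"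
    proof -
      from that obtain w where w: "w \<in> ?C" "map f w = u @ map f [n', m'] @ v" unfolding q(4,5) by auto
      from map_decompose[OF inj C[OF w(1)] _ w(2)] q(6) obtain u' v' where "w = u' @ [n', m'] @ v'" "v = map f v'" by auto
      then show ?thesis using class_tail(3)[OF halt r', of u' v'] w(1) by simp
    qed
  next
    fix u v
    show "u @ [3, 4] @ v \<notin> map f ` ?C"
    proof
      assume "u @ [3, 4] @ v \<in> map f ` ?C"
      then obtain w where w: "w \<in> ?C" "map f w = u @ map f [Al1, Al2] @ v" by (auto simp: f)
      from map_decompose[OF inj C[OF w(1)] _ w(2)] mem_alphabet obtain u' v' where "w = u' @ [Al1, Al2] @ v'" by auto
      then show False using class_no_alarm[OF no] w(1) by blast
    qed
  qed (use rules_props fixed in auto)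
  show ?thesis by (rule not_fin_determines)
qed

lemma wf: "wf_instance (sig (legs e)) (queries e) (goal_query (legs e))"
  unfolding wf_instance_def
proof (intro conjI ballI)
  show "wf_signature (sig (legs e))" by (simp add: wf_signature_def sig_def)
  show "cq_over (sig (legs e)) (goal_query (legs e))" by (rule cq_over_goal_query)
  fix Q assume "Q \<in> set (queries e)"
  then show "cq_over (sig (legs e)) Q"
  proof (cases rule: queries_cases)
    case 1
    show ?thesis unfolding 1 by (rule cq_over_word_query) (auto simp: legs_def start_letter_def)
  next
    case 2
    show ?thesis unfolding 2 by (rule cq_over_word_query) (simp add: legs_def)
  next
    case 3
    then show ?thesis by (simp add: cq_over_def)
  next
    case (4 z a b n m)
    note p = rules_props(1)[OF 4(1)]
    have "a \<noteq> n" "b \<noteq> m" using p by auto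
    then show ?thesis unfolding 4(3) using p 4(2) by (intro cq_over_rule_query) (simp_all add: legs_def)
  qed
qed

end

text \<open>The six letters with a prescribed role take the numbers 0 to 5 and all others are
  shifted by 6. Once f is fixed, e is read off as the number whose binary digits mark the rule
  codes.\<close>

lemma coding_exists:
  assumes "finite S" "{L, E, A 0, Rs P, Ls None} \<subseteq> S"
  shows "\<exists>f e. coded S P f e"
proof -
  obtain g :: "letter \<Rightarrow> nat" where g: "inj_on g (alphabet S)"
    using finite_imp_inj_to_nat_seg[OF finite_alphabet[OF assms(1)]] by blast
  define f where "f x = (if x = L then 0 else if x = A 0 then 1 else if x = E then 2 else if x = Al1 then 3
     else if x = Al2 then 4 else if x = Rs P then 5 else g x + 6)" for x
  have inj: "inj_on f (alphabet S)"
  proof (rule inj_onI)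
    fix x y assume "x \<in> alphabet S" "y \<in> alphabet S" "f x = f y"
    then show "x = y" using inj_onD[OF g, of x y] by (auto simp: f_def split: if_splits)
  qed
  have "fwd S \<union> bwd S \<subseteq> alphabet S \<times> alphabet S \<times> alphabet S \<times> alphabet S"
    using fwd_alphabet[of _ _ _ _ S] bwd_alphabet[of _ _ _ _ S] by auto
  then have "finite (fwd S \<union> bwd S)"
    by (rule finite_subset) (simp add: finite_alphabet[OF assms(1)])
  then have "finite ((\<lambda>(a, b, n, m). (f a, f b, f n, f m)) ` (fwd S \<union> bwd S))" by (rule finite_imageI)
  from rules_set_encode[OF this] assms inj show ?thesis
    by (intro exI[of _ f] exI) (rule coded.intro, auto simp: f_def)
qed

theorem theorem1:
  shows "\<not> (\<exists>f :: recf. \<forall>\<Sigma> Qs Q0. wf_instance \<Sigma> Qs Q0 \<longrightarrow>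
            eval f [enc_instance \<Sigma> Qs Q0] (if fin_determines \<Sigma> Qs Q0 then 1 else 0))"
proof
  assume "\<exists>f :: recf. \<forall>\<Sigma> Qs Q0. wf_instance \<Sigma> Qs Q0 \<longrightarrow>
            eval f [enc_instance \<Sigma> Qs Q0] (if fin_determines \<Sigma> Qs Q0 then 1 else 0)"
  then obtain d where d: "\<And>\<Sigma> Qs Q0. wf_instance \<Sigma> Qs Q0 \<Longrightarrow>
            eval d [enc_instance \<Sigma> Qs Q0] (if fin_determines \<Sigma> Qs Q0 then 1 else 0)" by blast
  obtain g where g: "\<And>e. eval g [e] (enc_instance (sig (legs e)) (queries e) (goal_query (legs e)))"
  proof -
    from is_rec_instance obtain g where g: "\<forall>xs. length xs = 1 \<longrightarrow>
        eval g xs (enc_instance (sig (legs (hd xs))) (queries (hd xs)) (goal_query (legs (hd xs))))"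
      unfolding is_rec_def by (elim exE)
    show thesis by (rule that[of g]) (use g[THEN spec, of "[e]" for e] in simp)
  qed
  \<comment> \<open>The program maps any x to the alleged decision on the instance of x. It is
    chosen before S and e, so it can afterwards be run on the code e of its own rewriting
    rules.\<close>
  obtain P where P: "\<And>x y. eval (Comp d [g]) [x] y \<Longrightarrow>
    mstep\<^sup>*\<^sup>* (P, (\<lambda>_. 0)(0 := x)) ([], (\<lambda>_. 0)(0 := x, 1 := y))"
    using recf_program[of "Comp d [g]"] by blast
  obtain S where S: "finite S" "{L, E, A 0, Rs P, Ls None} \<subseteq> S"
    and zero: "\<And>x y. mstep\<^sup>*\<^sup>* (P, (\<lambda>_. 0)(0 := x)) ([], (\<lambda>_. 0)(0 := x, 1 := y)) \<Longrightarrow> y = 0 \<Longrightarrow>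
        \<exists>v. (rew S)\<^sup>*\<^sup>* (start_word P x) (Al1 # Al2 # v)"
    and one: "\<And>x y. mstep\<^sup>*\<^sup>* (P, (\<lambda>_. 0)(0 := x)) ([], (\<lambda>_. 0)(0 := x, 1 := y)) \<Longrightarrow> y \<noteq> 0 \<Longrightarrow>
        \<exists>wn. (rew S)\<^sup>*\<^sup>* (start_word P x) wn \<and> (\<forall>z. \<not> rew S wn z) \<and> Al1 \<notin> set wn"
    using program_words[of P] by blast
  obtain f e where "coded S P f e" using coding_exists[OF S] by blast
  then interpret coded S P f e .
  let ?det = "fin_determines (sig (legs e)) (queries e) (goal_query (legs e))"
  have "eval (Comp d [g]) [e] (if ?det then 1 else 0)"
    by (rule eval_Comp[OF _ d[OF wf]]) (simp add: g)
  note run = P[OF this]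
  show False
  proof (cases ?det)
    case True
    from one[OF run] True obtain wn where "(rew S)\<^sup>*\<^sup>* (start_word P e) wn" "\<And>z. \<not> rew S wn z" "Al1 \<notin> set wn" by auto
    then show False using not_determined True by blast
  next
    case False
    from zero[OF run] False obtain v where "(rew S)\<^sup>*\<^sup>* (start_word P e) (Al1 # Al2 # v)" by auto
    then show False using determined False by blast
  qed
qed

end
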